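(* Let $(W_t)_{t\in[0,1]}$ be a $d$-dimensional standard Brownian motion, $d\ge1$, defined on a probability space $(\Omega,\mathcal A,\mathbb P)$, and let $(k(n))_{n\ge1}$ be a sequence of positive integers. For $n\ge1$ and $1\le j\le k(n)$ let $W_{k(n),j}$ be the standard Brownian motion $$W_{k(n),j}(t)=k(n)^{1/2}\Big(W\Big(\frac{t+(j-1)}{k(n)}\Big)-W\Big(\frac{j-1}{k(n)}\Big)\Big),\quad t\in[0,1],$$ and define the probability measures on $C_0([0,1])$ $$\mu_n^\omega=\frac1{k(n)}\sum_{j=1}^{k(n)}\delta_{x_{k(n),j}(\omega)},\qquad x_{k(n),j}(\omega)=\frac{W_{k(n),j}(\omega)}{n^{1/2}}.$$ Suppose that $\lim_{n\to\infty}\frac{\log k(n)}n=\infty$. Then, with probability 1, $(\mu_n^\omega)_{n\ge1}$ satisfies in $C_0([0,1])$ the large deviation principle with good rate function $$I(\phi)=\begin{cases}\frac12\int_0^1\|\phi'(t)\|^2\,dt&\text{if }\phi\in H^1,\\ \infty&\text{otherwise.}\end{cases}$$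
   Context: $C_0([0,1])$ is the space of $\mathbb R^d$-valued continuous functions $\phi$ on $[0,1]$ with $\phi(0)=0$, with the uniform norm; $H^1$ is the Sobolev space of absolutely continuous elements of $C_0([0,1])$ with square integrable derivative. A sequence $(\mu_n)$ of probability measures on a topological space $\mathcal Y$ (with completed Borel $\sigma$-field $B_{\mathcal Y}$) satisfies the large deviation principle with rate function $I:\mathcal Y\to[0,\infty]$ (lower semicontinuous) if for all $\Gamma\in B_{\mathcal Y}$, $-\inf_{\mathring\Gamma}I\le\liminf_n\frac1n\log\mu_n(\Gamma)\le\limsup_n\frac1n\log\mu_n(\Gamma)\le-\inf_{\overline\Gamma}I$; the rate function is good if all level sets $\{I\le\alpha\}$, $\alpha\in\mathbb R_+$, are compact. *)

theory Defs
  imports "HOL-Probability.Probability"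
begin

section \<open>Large deviation principles\<close>

definition borel_of :: "'a topology \<Rightarrow> 'a measure" where
  "borel_of Y = sigma (topspace Y) {U. openin Y U}"

text \<open>The logarithm with \<open>log 0 = -\<infinity>\<close>; the library has \<open>ln 0 = 0\<close> on the reals.\<close>

definition elog :: "real \<Rightarrow> ereal" where
  "elog p = (if p = 0 then -\<infinity> else ereal (ln p))"

text \<open>Lower semicontinuity is expressed by the closedness of the level sets.\<close>

definition rate_function :: "'a topology \<Rightarrow> ('a \<Rightarrow> ereal) \<Rightarrow> bool" where
  "rate_function Y I \<longleftrightarrow>
     (\<forall>y\<in>topspace Y. 0 \<le> I y) \<and>
     (\<forall>\<alpha>::real. closedin Y {y \<in> topspace Y. I y \<le> ereal \<alpha>})"

definition good_rate_function :: "'a topology \<Rightarrow> ('a \<Rightarrow> ereal) \<Rightarrow> bool" where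
  "good_rate_function Y I \<longleftrightarrow>
     rate_function Y I \<and>
     (\<forall>\<alpha>::real. \<alpha> \<ge> 0 \<longrightarrow> compactin Y {y \<in> topspace Y. I y \<le> ereal \<alpha>})"

text \<open>
  The sequence is indexed by \<open>n \<ge> 1\<close>; the value at \<open>n = 0\<close> is irrelevant. The sets \<open>\<Gamma>\<close> range
  over everything that is measurable for the completion of each \<open>\<mu> n\<close> (and so in particular
  over all Borel sets), and \<open>\<mu> n\<close> is evaluated through its completion. In \<open>ereal\<close> the infimum
  over the empty set is \<open>\<infinity>\<close>.
\<close>

definition satisfies_LDP :: "'a topology \<Rightarrow> (nat \<Rightarrow> 'a measure) \<Rightarrow> ('a \<Rightarrow> ereal) \<Rightarrow> bool" where
  "satisfies_LDP Y \<mu> I \<longleftrightarrow>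
     (\<forall>n\<ge>1. prob_space (\<mu> n) \<and> sets (\<mu> n) = sets (borel_of Y)) \<and>
     rate_function Y I \<and>
     (\<forall>\<Gamma>. (\<forall>n\<ge>1. \<Gamma> \<in> sets (completion (\<mu> n))) \<longrightarrow>
        (let r = (\<lambda>n. ereal (1 / real n) * elog (measure (completion (\<mu> n)) \<Gamma>)) in
           - (INF y\<in>Y interior_of \<Gamma>. I y) \<le> liminf r \<and>
           liminf r \<le> limsup r \<and>
           limsup r \<le> - (INF y\<in>Y closure_of \<Gamma>. I y)))"


section \<open>Empirical measures\<close>

definition empirical_measure :: "'a measure \<Rightarrow> nat \<Rightarrow> (nat \<Rightarrow> 'a) \<Rightarrow> 'a measure" where
  "empirical_measure N k x =
     measure_of (space N) (sets N) (\<lambda>A. (\<Sum>j=1..k. emeasure (return N (x j)) A) / of_nat k)"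

lemma space_empirical_measure [simp]: "space (empirical_measure N k x) = space N"
  by (simp add: empirical_measure_def)

lemma sets_empirical_measure [simp]: "sets (empirical_measure N k x) = sets N"
  by (simp add: empirical_measure_def)

lemma emeasure_empirical_measure:
  assumes "A \<in> sets N"
  shows "emeasure (empirical_measure N k x) A
           = (\<Sum>j=1..k. emeasure (return N (x j)) A) / of_nat k"
proof (rule emeasure_measure_of[OF empirical_measure_def sets.space_closed])
  show "A \<in> sets (empirical_measure N k x)"
    using assms by simp
  show "positive (sets (empirical_measure N k x))
          (\<lambda>A. (\<Sum>j=1..k. emeasure (return N (x j)) A) / of_nat k)"
    by (simp add: positive_def)
  show "countably_additive (sets (empirical_measure N k x))
          (\<lambda>A. (\<Sum>j=1..k. emeasure (return N (x j)) A) / of_nat k)"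
  proof (rule countably_additiveI)
    fix B :: "nat \<Rightarrow> 'a set"
    assume B: "range B \<subseteq> sets (empirical_measure N k x)" "disjoint_family B"
    have "(\<Sum>i. (\<Sum>j=1..k. emeasure (return N (x j)) (B i)) / of_nat k)
        = (\<Sum>i. \<Sum>j=1..k. emeasure (return N (x j)) (B i)) / of_nat k"
      by (rule ennreal_suminf_divide)
    also have "(\<Sum>i. \<Sum>j=1..k. emeasure (return N (x j)) (B i))
        = (\<Sum>j=1..k. \<Sum>i. emeasure (return N (x j)) (B i))"
      by (rule suminf_sum) simp
    also have "\<dots> = (\<Sum>j=1..k. emeasure (return N (x j)) (\<Union>i. B i))"
      using B by (intro sum.cong refl suminf_emeasure) auto
    finally show "(\<Sum>i. (\<Sum>j=1..k. emeasure (return N (x j)) (B i)) / of_nat k)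
        = (\<Sum>j=1..k. emeasure (return N (x j)) (\<Union>i. B i)) / of_nat k" .
  qed
qed

lemma prob_space_empirical_measure:
  assumes "k \<ge> 1" "\<And>j. j \<in> {1..k} \<Longrightarrow> x j \<in> space N"
  shows "prob_space (empirical_measure N k x)"
proof (rule prob_spaceI)
  have "(\<Sum>j=1..k. emeasure (return N (x j)) (space N)) = (\<Sum>j=1..k. 1)"
    using assms by (intro sum.cong refl) (simp add: emeasure_return)
  then show "emeasure (empirical_measure N k x) (space (empirical_measure N k x)) = 1"
    using assms(1)
    by (simp add: emeasure_empirical_measure ennreal_divide_self of_nat_less_top del: emeasure_return)
qed


section \<open>The path space and the rate function\<close>

text \<open>
  Paths are functions on the reals that are \<open>extensional\<close> on \<open>[0,1]\<close>, so that two paths are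
  equal iff they agree on \<open>[0,1]\<close>.
\<close>

definition C0 :: "(real \<Rightarrow> real ^ 'd) metric" where
  "C0 = submetric (cfunspace (top_of_set {0..1}) euclidean_metric) {\<phi>. \<phi> 0 = 0}"

lemma mspace_C0:
  "mspace C0 = {\<phi> :: real \<Rightarrow> real ^ 'd. \<phi> \<in> extensional {0..1} \<and> continuous_on {0..1} \<phi> \<and> \<phi> 0 = 0}"
proof -
  have "compactin (top_of_set {0..1::real}) (topspace (top_of_set {0..1::real}))"
    by (simp add: compactin_subtopology)
  from compactin_mspace_cfunspace[OF this, of "euclidean_metric :: (real ^ 'd) metric"]
  show ?thesis
    unfolding C0_def mspace_submetric by auto
qed

lemma mdist_C0:
  assumes "\<phi> \<in> mspace C0" "\<psi> \<in> mspace C0"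
  shows "mdist C0 \<phi> \<psi> = (SUP t\<in>{0..1}. norm (\<phi> t - \<psi> t))"
proof -
  have "\<phi> \<in> mspace (funspace {0..1} euclidean_metric)" "\<psi> \<in> mspace (funspace {0..1} euclidean_metric)"
    using assms cfunspace_subset_funspace[of "top_of_set {0..1}" euclidean_metric]
    unfolding C0_def mspace_submetric by auto
  then show ?thesis
    by (simp add: C0_def mdist_cfunspace_eq_mdist_funspace dist_norm
        Metric_space.fdist_def[OF Metric_space_mspace_mdist[of euclidean_metric], simplified])
qed

definition absolutely_continuous_on :: "real \<Rightarrow> real \<Rightarrow> (real \<Rightarrow> 'a::real_normed_vector) \<Rightarrow> bool" where
  "absolutely_continuous_on a b f \<longleftrightarrow>
     (\<forall>\<epsilon>>0. \<exists>\<delta>>0. \<forall>(m::nat) u v.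
        (\<forall>i<m. a \<le> u i \<and> u i \<le> v i \<and> v i \<le> b) \<and>
        disjoint_family_on (\<lambda>i. {u i<..<v i}) {..<m} \<and>
        (\<Sum>i<m. v i - u i) < \<delta> \<longrightarrow>
        (\<Sum>i<m. norm (f (v i) - f (u i))) < \<epsilon>)"

definition path_deriv :: "(real \<Rightarrow> real ^ 'd) \<Rightarrow> real \<Rightarrow> real ^ 'd" where
  "path_deriv \<phi> t = vector_derivative \<phi> (at t within {0..1})"

text \<open>
  An absolutely continuous function is differentiable almost everywhere, so the second clause
  excludes nothing; it records that \<open>path_deriv \<phi>\<close> is the derivative off a null set (where
  \<open>vector_derivative\<close> is an arbitrary value).
\<close>

definition H1 :: "(real \<Rightarrow> real ^ 'd) set" where
  "H1 = {\<phi> \<in> mspace C0.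
     absolutely_continuous_on 0 1 \<phi> \<and>
     (AE t in lebesgue_on {0..1}. \<phi> differentiable (at t within {0..1})) \<and>
     integrable (lebesgue_on {0..1}) (\<lambda>t. (norm (path_deriv \<phi> t))\<^sup>2)}"

definition action :: "(real \<Rightarrow> real ^ 'd) \<Rightarrow> ereal" where
  "action \<phi> =
     (if \<phi> \<in> H1 then ereal (1 / 2 * (LINT t|lebesgue_on {0..1}. (norm (path_deriv \<phi> t))\<^sup>2))
      else \<infinity>)"


section \<open>Brownian motion on the unit interval\<close>

text \<open>
  \<open>W s \<omega>\<close> is the position at time \<open>s\<close>; only times in \<open>[0,1]\<close> matter. The density is that of the
  centred Gaussian law with covariance matrix \<open>(t - s)\<close> times the identity (\<open>normal_density\<close>
  takes the standard deviation as its second argument). Start at \<open>0\<close> and continuity of the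
  paths are required almost surely, which includes the case where they hold everywhere.
\<close>

definition std_brownian_motion :: "'w measure \<Rightarrow> (real \<Rightarrow> 'w \<Rightarrow> real ^ 'd) \<Rightarrow> bool" where
  "std_brownian_motion M W \<longleftrightarrow>
     prob_space M \<and>
     (\<forall>t\<in>{0..1}. W t \<in> borel_measurable M) \<and>
     (AE \<omega> in M. W 0 \<omega> = 0) \<and>
     (AE \<omega> in M. continuous_on {0..1} (\<lambda>t. W t \<omega>)) \<and>
     (\<forall>s t. 0 \<le> s \<and> s < t \<and> t \<le> 1 \<longrightarrow>
        distributed M lborel (\<lambda>\<omega>. W t \<omega> - W s \<omega>)
          (\<lambda>x. ennreal (\<Prod>i\<in>UNIV. normal_density 0 (sqrt (t - s)) (x $ i)))) \<and>
     (\<forall>(m::nat) \<tau>. (\<forall>i\<le>m. \<tau> i \<in> {0..1}) \<and> (\<forall>i<m. \<tau> i < \<tau> (Suc i)) \<longrightarrow>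
        prob_space.indep_vars M (\<lambda>_. borel) (\<lambda>i \<omega>. W (\<tau> (Suc i)) \<omega> - W (\<tau> i) \<omega>) {..<m})"

definition rescaled_block ::
    "(real \<Rightarrow> 'w \<Rightarrow> real ^ 'd) \<Rightarrow> nat \<Rightarrow> nat \<Rightarrow> 'w \<Rightarrow> real \<Rightarrow> real ^ 'd" where
  "rescaled_block W k j \<omega> t =
     sqrt (real k) *\<^sub>R (W ((t + (real j - 1)) / real k) \<omega> - W ((real j - 1) / real k) \<omega>)"

definition sample_path ::
    "(real \<Rightarrow> 'w \<Rightarrow> real ^ 'd) \<Rightarrow> nat \<Rightarrow> nat \<Rightarrow> nat \<Rightarrow> 'w \<Rightarrow> real \<Rightarrow> real ^ 'd" where
  "sample_path W n k j \<omega> = (\<lambda>t\<in>{0..1}. rescaled_block W k j \<omega> t /\<^sub>R sqrt (real n))"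

definition brownian_empirical ::
    "(real \<Rightarrow> 'w \<Rightarrow> real ^ 'd) \<Rightarrow> (nat \<Rightarrow> nat) \<Rightarrow> 'w \<Rightarrow> nat \<Rightarrow> (real \<Rightarrow> real ^ 'd) measure" where
  "brownian_empirical W k \<omega> n =
     empirical_measure (borel_of (mtopology_of C0)) (k n) (\<lambda>j. sample_path W n (k n) j \<omega>)"

end

theory Submission
  imports Defs "HOL-Complex_Analysis.Great_Picard"
begin

text \<open>
  The value of \<open>\<mu>\<^sub>n\<close> on a set is the proportion of the \<open>k(n)\<close> sample paths that lie in it, and
  the sample paths are independent copies of \<open>W / sqrt n\<close>. If such a copy lies in the set with
  probability about \<open>exp (- n c)\<close>, then about \<open>k(n) exp (- n c)\<close> sample paths do. Since \<open>k(n)\<close>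
  grows faster than every exponential, this number is so large that the proportion stays near
  its mean except with probabilities summable in \<open>n\<close>. From above this is Markov's inequality and
  the Borel-Cantelli lemma (\<open>eventually_few_events\<close>), for arbitrarily dependent events; from
  below it is Chebyshev's inequality for pairwise independent events (\<open>eventually_many_events\<close>).
  The almost sure principle is thereby reduced to Schilder's estimates for a single path, applied
  to countably many events that together control all sets.

  All these events are read off from the increments of the path over dyadic intervals. The
  dyadic energy at level \<open>p\<close> is twice the action of the polygon through the values of the path at
  the multiples of \<open>1 / 2 ^ p\<close>. It increases with \<open>p\<close>, and its supremum is twice the action of
  the path (\<open>action_le_iff\<close>). One half of this is the fundamental theorem of calculus for
  absolutely continuous functions followed by the Cauchy-Schwarz inequality. For the other half
  a path of bounded energy must be shown to be differentiable almost everywhere: it differs from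
  its polygons by functions of small energy, and by Vitali's covering lemma a function of small
  energy is steep only on a small set (\<open>steep_set_measure\<close>). Fatou's lemma then bounds the
  integral of the squared derivative. Bounded energy also gives a Hoelder modulus, so the level
  sets of the action are compact by the Arzela-Ascoli theorem.

  Three kinds of events suffice.
  \<^item> The energy at level \<open>q\<close> exceeds \<open>2 a\<close>. Times \<open>n\<close> it is a sum of squares of independent
    standard Gaussians, so this has probability at most \<open>C exp (- n c a)\<close> for every \<open>c\<close> in \<open>[0, 1)\<close>
    (\<open>sample_energy_tail\<close>).
  \<^item> The path fails to be \<open>chained\<close>: the increments at some level beyond \<open>m\<close> are not geometrically
    small. This has a probability whose exponential rate is as large as desired, by the choice of
    \<open>m\<close> (\<open>not_chained_tail\<close>). A chained path is uniformly close to its polygon.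
  \<^item> The increments at level \<open>q\<close> are within \<open>\<delta>\<close> of those of a given path \<open>\<psi>\<close>. The Gaussian density
    bounds the probability of this from below, at a rate that tends to half the energy of \<open>\<psi>\<close> as \<open>\<delta>\<close> tends to \<open>0\<close>
    (\<open>tube_events\<close>, \<open>tube_rate_less\<close>).

  A closed set on which the action exceeds \<open>a\<close> has positive distance from the compact level set,
  so a sample path in it has energy above \<open>2 a\<close> or is not chained; this is the upper bound. For the
  lower bound, a chained path in a narrow tube around \<open>\<psi>\<close> is uniformly close to \<open>\<psi>\<close>. Being chained
  is not independent of lying in the tube, but it need not be: the paths that are not chained are
  exponentially fewer and are simply subtracted. It is enough to let \<open>\<psi>\<close> range over a countable set
  that is dense in every level set with rational level.
\<close>

section \<open>Dyadic energy\<close>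

definition dyadic_incr :: "nat \<Rightarrow> (real \<Rightarrow> 'a::real_vector) \<Rightarrow> nat \<Rightarrow> 'a" where
  "dyadic_incr p f i = f ((real i + 1) / 2 ^ p) - f (real i / 2 ^ p)"

definition dyadic_energy :: "nat \<Rightarrow> (real \<Rightarrow> 'a::real_normed_vector) \<Rightarrow> real" where
  "dyadic_energy p f = 2 ^ p * (\<Sum>i<2 ^ p. (norm (dyadic_incr p f i))\<^sup>2)"

lemma dyadic_incr_split:
  "dyadic_incr p f i = dyadic_incr (Suc p) f (2 * i) + dyadic_incr (Suc p) f (2 * i + 1)"
proof -
  have "(2 * real i + 2) / (2 * 2 ^ p) = (real i + 1) / 2 ^ p" "(2 * real i) / (2 * 2 ^ p) = real i / 2 ^ p"
    by (simp_all add: field_simps)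
  then show ?thesis by (simp add: dyadic_incr_def add.commute)
qed

lemma dyadic_incr_diff:
  "dyadic_incr p (\<lambda>t. f t - g t) i = dyadic_incr p f i - dyadic_incr p g i"
  by (simp add: dyadic_incr_def)

lemma sum_pairs: "(\<Sum>i<2 * n. g i) = (\<Sum>i<n. g (2 * i) + g (2 * i + 1))"
  for g :: "nat \<Rightarrow> 'b::comm_monoid_add"
  by (induction n) (simp_all add: add.assoc)

text \<open>
  The parallelogram law on each pair of neighbouring intervals. The new term consists of second
  differences, so it vanishes when the value at each midpoint is the mean of the values at the two ends.
\<close>
lemma dyadic_energy_Suc:
  fixes f :: "real \<Rightarrow> 'a::real_inner"
  shows "dyadic_energy (Suc p) f = dyadic_energy p f +
    2 ^ p * (\<Sum>i<2 ^ p. (norm (dyadic_incr (Suc p) f (2 * i) - dyadic_incr (Suc p) f (2 * i + 1)))\<^sup>2)"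
proof -
  have par: "2 * ((norm x)\<^sup>2 + (norm y)\<^sup>2) = (norm (x + y))\<^sup>2 + (norm (x - y))\<^sup>2" for x y :: 'a
    by (simp add: power2_norm_eq_inner inner_add inner_diff algebra_simps)
  have "dyadic_energy (Suc p) f = 2 ^ p * (\<Sum>i<2 ^ p. 2 * ((norm (dyadic_incr (Suc p) f (2 * i)))\<^sup>2
      + (norm (dyadic_incr (Suc p) f (2 * i + 1)))\<^sup>2))"
    
    unfolding dyadic_energy_def power_Suc sum_pairs by (simp add: sum_distrib_left algebra_simps)
  then show ?thesis
    unfolding par dyadic_incr_split[symmetric] by (simp add: sum.distrib dyadic_energy_def distrib_left)
qed

lemma dyadic_energy_mono:
  fixes f :: "real \<Rightarrow> 'a::real_inner"
  assumes "p \<le> q"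
  shows "dyadic_energy p f \<le> dyadic_energy q f"
  using assms
proof (induction rule: dec_induct)
  case (step q)
  have "dyadic_energy q f \<le> dyadic_energy (Suc q) f"
    unfolding dyadic_energy_Suc by (simp add: sum_nonneg)
  with step show ?case by linarith
qed simp

lemma dyadic_energy_nonneg: "0 \<le> dyadic_energy p f"
  by (simp add: dyadic_energy_def sum_nonneg)

lemma sum_dyadic_incr:
  assumes "a \<le> b"
  shows "(\<Sum>l\<in>{a..<b}. dyadic_incr p f l) = f (real b / 2 ^ p) - f (real a / 2 ^ p)"
  using assms
  by (induction rule: dec_induct) (simp_all add: dyadic_incr_def add.commute)

text \<open>
  Merging neighbouring dyadic intervals does not increase the energy, by the Cauchy-Schwarz inequality.
\<close>
lemma norm_dyadic_diff_le:
  fixes f :: "real \<Rightarrow> 'a::real_inner"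
  assumes "a \<le> b"
  shows "(norm (f (real b / 2 ^ p) - f (real a / 2 ^ p)))\<^sup>2 / (real b / 2 ^ p - real a / 2 ^ p)
    \<le> 2 ^ p * (\<Sum>l\<in>{a..<b}. (norm (dyadic_incr p f l))\<^sup>2)"
proof (cases "a = b")
  case False
  with assms have ab: "real b - real a > 0" by simp
  have "norm (f (real b / 2 ^ p) - f (real a / 2 ^ p)) \<le> (\<Sum>l\<in>{a..<b}. norm (dyadic_incr p f l))"
    unfolding sum_dyadic_incr[OF assms, symmetric] by (rule norm_sum)
  then have "(norm (f (real b / 2 ^ p) - f (real a / 2 ^ p)))\<^sup>2 \<le> (\<Sum>l\<in>{a..<b}. norm (dyadic_incr p f l))\<^sup>2"
    by (rule power_mono) simp
  also have "\<dots> \<le> real (card {a..<b}) * (\<Sum>l\<in>{a..<b}. (norm (dyadic_incr p f l))\<^sup>2)"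
    using sum_squared_le_sum_of_squares[of "\<lambda>l. norm (dyadic_incr p f l)" "{a..<b}"] by (simp add: mult.commute)
  also have "\<dots> = (real b - real a) * (\<Sum>l\<in>{a..<b}. (norm (dyadic_incr p f l))\<^sup>2)"
    using assms by (simp add: of_nat_diff)
  finally have *: "(norm (f (real b / 2 ^ p) - f (real a / 2 ^ p)))\<^sup>2 / (real b - real a)
      \<le> (\<Sum>l\<in>{a..<b}. (norm (dyadic_incr p f l))\<^sup>2)"
    using ab by (simp add: divide_le_eq mult.commute)
  show ?thesis
    using mult_left_mono[OF *, of "2 ^ p"] by (simp add: diff_divide_distrib[symmetric] mult.commute)
qed (simp add: sum_nonneg)

definition dyadic_floor :: "nat \<Rightarrow> real \<Rightarrow> nat" where
  "dyadic_floor p t = nat \<lfloor>2 ^ p * t\<rfloor>"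

lemma dyadic_floor_bounds:
  assumes "0 \<le> t"
  shows "real (dyadic_floor p t) / 2 ^ p \<le> t" "t < (real (dyadic_floor p t) + 1) / 2 ^ p"
proof -
  have "real (dyadic_floor p t) = of_int \<lfloor>2 ^ p * t\<rfloor>"
    using assms by (simp add: dyadic_floor_def)
  moreover have "of_int \<lfloor>2 ^ p * t\<rfloor> \<le> 2 ^ p * t" "2 ^ p * t < of_int \<lfloor>2 ^ p * t\<rfloor> + 1" by linarith+
  ultimately show "real (dyadic_floor p t) / 2 ^ p \<le> t" "t < (real (dyadic_floor p t) + 1) / 2 ^ p"
    by (simp_all add: field_simps)
qed

lemma dyadic_floor_mono: "s \<le> t \<Longrightarrow> dyadic_floor p s \<le> dyadic_floor p t"
  unfolding dyadic_floor_def by (intro nat_mono floor_mono mult_left_mono) auto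

lemma dyadic_floor_1 [simp]: "dyadic_floor p 1 = 2 ^ p"
proof -
  have "\<lfloor>2 ^ p :: real\<rfloor> = 2 ^ p" by (metis floor_of_int of_int_numeral of_int_power)
  then show ?thesis by (simp add: dyadic_floor_def nat_power_eq)
qed

lemma dyadic_floor_le: "t \<le> 1 \<Longrightarrow> dyadic_floor p t \<le> 2 ^ p"
  using dyadic_floor_mono[of t 1 p] by simp

lemma dyadic_floor_less:
  assumes "0 \<le> t" "t < 1" shows "dyadic_floor p t < 2 ^ p"
proof -
  have "real (dyadic_floor p t) < 2 ^ p"
    using le_less_trans[OF dyadic_floor_bounds(1)[OF assms(1), of p] assms(2)]
    by (simp add: divide_less_eq)
  then show ?thesis by (metis of_nat_less_iff of_nat_numeral of_nat_power)
qed

lemma dyadic_floor_tendsto: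
  assumes "0 \<le> t"
  shows "(\<lambda>p. real (dyadic_floor p t) / 2 ^ p) \<longlonglongrightarrow> t"
proof (rule tendsto_sandwich)
  show "\<forall>\<^sub>F p in sequentially. t - (1/2) ^ p \<le> real (dyadic_floor p t) / 2 ^ p"
  proof (intro always_eventually allI)
    fix p show "t - (1/2) ^ p \<le> real (dyadic_floor p t) / 2 ^ p"
      using dyadic_floor_bounds(2)[OF assms, of p] by (simp add: add_divide_distrib power_one_over)
  qed
  show "\<forall>\<^sub>F p in sequentially. real (dyadic_floor p t) / 2 ^ p \<le> t"
    using dyadic_floor_bounds(1)[OF assms] by auto
  have "(\<lambda>p. t - (1/2::real) ^ p) \<longlonglongrightarrow> t - 0" by (intro tendsto_intros) simp
  then show "(\<lambda>p. t - (1/2::real) ^ p) \<longlonglongrightarrow> t" by simp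
qed simp

lemma dyadic_floor_in_unit:
  "t \<in> {0..1} \<Longrightarrow> real (dyadic_floor p t) / 2 ^ p \<in> {0..1}"
  using dyadic_floor_bounds(1)[of t p] by (auto intro: order_trans simp del: divide_le_eq_1_pos)

lemma tendsto_dyadic_floor:
  assumes "continuous_on {0..1} f" "t \<in> {0..1}"
  shows "(\<lambda>p. f (real (dyadic_floor p t) / 2 ^ p)) \<longlonglongrightarrow> f t"
  using assms dyadic_floor_in_unit
  by (intro continuous_on_tendsto_compose[OF assms(1) dyadic_floor_tendsto]) auto

text \<open>
  Arbitrary intervals reduce to dyadic ones by rounding their end points down to the grid, which
  keeps disjoint intervals disjoint; continuity then allows the mesh to tend to \<open>0\<close>.
\<close>
lemma energy_intervals:
  fixes f :: "real \<Rightarrow> 'a::real_inner"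
  assumes cont: "continuous_on {0..1} f" and c: "\<And>p. dyadic_energy p f \<le> c"
    and "finite A" and uv: "\<And>i. i \<in> A \<Longrightarrow> 0 \<le> u i \<and> u i \<le> v i \<and> v i \<le> 1"
    and disj: "disjoint_family_on (\<lambda>i. {u i<..<v i}) A"
  shows "(\<Sum>i\<in>A. (norm (f (v i) - f (u i)))\<^sup>2 / (v i - u i)) \<le> c"
proof -
  \<comment> \<open>Degenerate intervals contribute 0 / 0 = 0, but the quotients would not pass to the limit for them.\<close>
  define A' where "A' = {i\<in>A. u i < v i}"
  have A': "finite A'" "A' \<subseteq> A" using \<open>finite A\<close> by (auto simp: A'_def)
  have ord: "v i \<le> u j \<or> v j \<le> u i" if "i \<in> A'" "j \<in> A'" "i \<noteq> j" for i j
  proof (rule ccontr)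
    assume n: "\<not> ?thesis"
    define m where "m = (max (u i) (u j) + min (v i) (v j)) / 2"
    have "max (u i) (u j) < min (v i) (v j)" using n that by (auto simp: A'_def)
    then have "m \<in> {u i<..<v i} \<inter> {u j<..<v j}" by (auto simp: m_def)
    moreover have "{u i<..<v i} \<inter> {u j<..<v j} = {}"
      using disj that A'(2) unfolding disjoint_family_on_def by blast
    ultimately show False by blast
  qed
  define a where "a p i = dyadic_floor p (u i)" for p i
  define b where "b p i = dyadic_floor p (v i)" for p i
  have "(\<Sum>i\<in>A'. (norm (f (real (b p i) / 2 ^ p) - f (real (a p i) / 2 ^ p)))\<^sup>2
       / (real (b p i) / 2 ^ p - real (a p i) / 2 ^ p)) \<le> c" for p
  proof -
    have dj: "disjoint_family_on (\<lambda>i. {a p i..<b p i}) A'"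
      unfolding disjoint_family_on_def
    proof (intro ballI impI)
      fix i j assume "i \<in> A'" "j \<in> A'" "i \<noteq> j"
      from ord[OF this] have "b p i \<le> a p j \<or> b p j \<le> a p i"
        unfolding a_def b_def by (auto intro: dyadic_floor_mono)
      then show "{a p i..<b p i} \<inter> {a p j..<b p j} = {}" by auto
    qed
    have "(\<Sum>i\<in>A'. (norm (f (real (b p i) / 2 ^ p) - f (real (a p i) / 2 ^ p)))\<^sup>2
       / (real (b p i) / 2 ^ p - real (a p i) / 2 ^ p))
       \<le> (\<Sum>i\<in>A'. 2 ^ p * (\<Sum>l\<in>{a p i..<b p i}. (norm (dyadic_incr p f l))\<^sup>2))"
      by (intro sum_mono norm_dyadic_diff_le) (auto simp: a_def b_def A'_def intro: dyadic_floor_mono)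
    also have "\<dots> = 2 ^ p * (\<Sum>l\<in>(\<Union>i\<in>A'. {a p i..<b p i}). (norm (dyadic_incr p f l))\<^sup>2)"
      using A'(1) dj by (subst sum.UNION_disjoint) (auto simp: sum_distrib_left disjoint_family_on_def)
    also have "\<dots> \<le> 2 ^ p * (\<Sum>l<2 ^ p. (norm (dyadic_incr p f l))\<^sup>2)"
    proof (intro mult_left_mono sum_mono2)
      show "(\<Union>i\<in>A'. {a p i..<b p i}) \<subseteq> {..<2 ^ p}"
        using uv A'(2) dyadic_floor_le unfolding b_def by (fastforce intro: less_le_trans)
    qed auto
    also have "\<dots> \<le> c" using c[of p] by (simp add: dyadic_energy_def)
    finally show ?thesis .
  qed
  moreover have "(\<lambda>p. \<Sum>i\<in>A'. (norm (f (real (b p i) / 2 ^ p) - f (real (a p i) / 2 ^ p)))\<^sup>2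
       / (real (b p i) / 2 ^ p - real (a p i) / 2 ^ p))
       \<longlonglongrightarrow> (\<Sum>i\<in>A'. (norm (f (v i) - f (u i)))\<^sup>2 / (v i - u i))"
  proof (intro tendsto_intros)
    fix i assume "i \<in> A'"
    then have i: "u i \<in> {0..1}" "v i \<in> {0..1}" "0 \<le> u i" "0 \<le> v i" and "v i - u i \<noteq> 0"
      using uv[of i] by (auto simp: A'_def)
    then show "(\<lambda>p. f (real (b p i) / 2 ^ p)) \<longlonglongrightarrow> f (v i)" "(\<lambda>p. f (real (a p i) / 2 ^ p)) \<longlonglongrightarrow> f (u i)"
      "(\<lambda>p. real (b p i) / 2 ^ p) \<longlonglongrightarrow> v i" "(\<lambda>p. real (a p i) / 2 ^ p) \<longlonglongrightarrow> u i" "v i - u i \<noteq> 0"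
      unfolding a_def b_def by (auto intro: tendsto_dyadic_floor[OF cont] dyadic_floor_tendsto)
  qed
  ultimately have "(\<Sum>i\<in>A'. (norm (f (v i) - f (u i)))\<^sup>2 / (v i - u i)) \<le> c"
    by (intro LIMSEQ_le_const2) auto
  also have "(\<Sum>i\<in>A'. (norm (f (v i) - f (u i)))\<^sup>2 / (v i - u i)) = (\<Sum>i\<in>A. (norm (f (v i) - f (u i)))\<^sup>2 / (v i - u i))"
    using \<open>finite A\<close> A'(2) uv by (intro sum.mono_neutral_left) (auto simp: A'_def, fastforce)
  finally show ?thesis .
qed

lemma energy_Holder:
  fixes f :: "real \<Rightarrow> 'a::real_inner"
  assumes cont: "continuous_on {0..1} f" and c: "\<And>p. dyadic_energy p f \<le> c"
    and "s \<in> {0..1}" "t \<in> {0..1}"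
  shows "(norm (f t - f s))\<^sup>2 \<le> c * \<bar>t - s\<bar>"
proof -
  have *: "(norm (f t - f s))\<^sup>2 \<le> c * (t - s)" if "0 \<le> s" "s \<le> t" "t \<le> 1" for s t
    using energy_intervals[OF cont c, of "{()}" "\<lambda>_. s" "\<lambda>_. t"] that
    by (cases "s = t") (auto simp: disjoint_family_on_def divide_le_eq)
  show ?thesis
    using *[of s t] *[of t s] assms(3,4) by (cases "s \<le> t") (auto simp: norm_minus_commute)
qed

text \<open>
  The elementary inequality \<open>2 x \<le> k x\<^sup>2 / l + l / k\<close>, with \<open>l\<close> the length of an interval and \<open>x\<close>
  the norm of the increment over it, trades the energy bound against the total length.
\<close>
lemma energy_absolutely_continuous:
  fixes f :: "real \<Rightarrow> 'a::real_inner"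
  assumes cont: "continuous_on {0..1} f" and c: "\<And>p. dyadic_energy p f \<le> c"
  shows "absolutely_continuous_on 0 1 f"
  unfolding absolutely_continuous_on_def
proof (intro allI impI)
  fix e :: real assume "e > 0"
  have "c \<ge> 0" using c[of 0] dyadic_energy_nonneg[of 0 f] by linarith
  \<comment> \<open>Chosen so that the energy part k c and the length part d / k are each at most e.\<close>
  define k where "k = e / (c + 1)"
  have k: "k > 0" "k * c < e" using \<open>e > 0\<close> \<open>c \<ge> 0\<close> by (auto simp: k_def field_simps)
  show "\<exists>d>0. \<forall>(m::nat) u v. (\<forall>i<m. 0 \<le> u i \<and> u i \<le> v i \<and> v i \<le> 1) \<and>
       disjoint_family_on (\<lambda>i. {u i<..<v i}) {..<m} \<and> (\<Sum>i<m. v i - u i) < d \<longrightarrow>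
       (\<Sum>i<m. norm (f (v i) - f (u i))) < e"
  proof (intro exI[of _ "e * k"] conjI allI impI)
    fix m :: nat and u v :: "nat \<Rightarrow> real"
    assume a: "(\<forall>i<m. 0 \<le> u i \<and> u i \<le> v i \<and> v i \<le> 1) \<and>
       disjoint_family_on (\<lambda>i. {u i<..<v i}) {..<m} \<and> (\<Sum>i<m. v i - u i) < e * k"
    have "norm (f (v i) - f (u i)) \<le> (k * ((norm (f (v i) - f (u i)))\<^sup>2 / (v i - u i)) + (v i - u i) / k) / 2"
      if "i < m" for i
    proof (cases "u i = v i")
      case False
      then have d: "v i - u i > 0" using a that by auto
      define x where "x = norm (f (v i) - f (u i))"
      have "0 \<le> (k * x - (v i - u i))\<^sup>2 / (k * (v i - u i))" using d k by simp
      also have "\<dots> = k * (x\<^sup>2 / (v i - u i)) + (v i - u i) / k - 2 * x"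
        using d k by (simp add: power2_eq_square field_simps)
      finally show ?thesis by (simp add: x_def)
    qed simp
    then have "(\<Sum>i<m. norm (f (v i) - f (u i))) \<le>
       (\<Sum>i<m. (k * ((norm (f (v i) - f (u i)))\<^sup>2 / (v i - u i)) + (v i - u i) / k) / 2)"
      by (intro sum_mono) auto
    also have "\<dots> = (k * (\<Sum>i<m. (norm (f (v i) - f (u i)))\<^sup>2 / (v i - u i)) + (\<Sum>i<m. v i - u i) / k) / 2"
      by (simp add: sum_distrib_left sum.distrib sum_divide_distrib add_divide_distrib)
    also have "\<dots> \<le> (k * c + (\<Sum>i<m. v i - u i) / k) / 2"
      using energy_intervals[OF cont c, of "{..<m}" u v] a k by auto
    also have "\<dots> < (e + e) / 2"
    proof -
      have "(\<Sum>i<m. v i - u i) / k < e" using a k by (simp add: field_simps)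
      then show ?thesis using k by simp
    qed
    finally show "(\<Sum>i<m. norm (f (v i) - f (u i))) < e" by simp
  qed (use \<open>e > 0\<close> k in auto)
qed

section \<open>Polygonal interpolation\<close>
text \<open>
  The sum of clamped linear functions is visibly continuous; on each cell all but one of its terms
  are constant.
\<close>
definition polygon :: "nat \<Rightarrow> (real \<Rightarrow> 'a::real_vector) \<Rightarrow> real \<Rightarrow> 'a" where
  "polygon p f t = f 0 + (\<Sum>i<2 ^ p. max 0 (min 1 (2 ^ p * t - real i)) *\<^sub>R dyadic_incr p f i)"

lemma polygon_on_cell:
  fixes f :: "real \<Rightarrow> 'a::real_normed_vector"
  assumes l: "l < 2 ^ p" and t: "real l / 2 ^ p \<le> t" "t \<le> (real l + 1) / 2 ^ p"
  shows "polygon p f t = f (real l / 2 ^ p) + (2 ^ p * t - real l) *\<^sub>R dyadic_incr p f l"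
proof -
  let ?g = "\<lambda>i. max 0 (min 1 (2 ^ p * t - real i)) *\<^sub>R dyadic_incr p f i"
  have tl: "real l \<le> 2 ^ p * t" "2 ^ p * t \<le> real l + 1"
    using t by (simp_all add: field_simps)
  have "(\<Sum>i<2 ^ p. ?g i) = (\<Sum>i\<in>{0..<l}. ?g i) + (\<Sum>i\<in>{l..<2 ^ p}. ?g i)"
    using l by (simp add: sum.atLeastLessThan_concat atLeast0LessThan[symmetric])
  also have "(\<Sum>i\<in>{l..<2 ^ p}. ?g i) = ?g l + (\<Sum>i\<in>{Suc l..<2 ^ p}. ?g i)"
    using l by (rule sum.atLeast_Suc_lessThan)
  also have "(\<Sum>i\<in>{Suc l..<2 ^ p}. ?g i) = 0"
    using tl by (intro sum.neutral) auto
  also have "(\<Sum>i\<in>{0..<l}. ?g i) = (\<Sum>i\<in>{0..<l}. dyadic_incr p f i)"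
    using tl by (intro sum.cong) auto
  also have "\<dots> = f (real l / 2 ^ p) - f 0"
    using sum_dyadic_incr[of 0 l p f] by simp
  finally show ?thesis using tl by (simp add: polygon_def)
qed

lemma polygon_grid:
  fixes f :: "real \<Rightarrow> 'a::real_normed_vector"
  assumes "i \<le> 2 ^ p"
  shows "polygon p f (real i / 2 ^ p) = f (real i / 2 ^ p)"
proof (cases "i < 2 ^ p")
  case True
  then show ?thesis by (subst polygon_on_cell[of i]) (auto simp: field_simps)
next
  case False
  then have i: "i = Suc (2 ^ p - 1)" using assms by simp
  show ?thesis
    by (subst polygon_on_cell[of "2 ^ p - 1"]) (auto simp: i dyadic_incr_def field_simps of_nat_diff)
qed

lemma polygon_0 [simp]: "polygon p f 0 = f 0"
  for f :: "real \<Rightarrow> 'a::real_normed_vector"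
  using polygon_grid[of 0 p f] by simp

lemma continuous_on_polygon: "continuous_on S (polygon p f)"
  for f :: "real \<Rightarrow> 'a::real_normed_vector"
  unfolding polygon_def by (intro continuous_intros)

lemma dyadic_incr_polygon:
  fixes f :: "real \<Rightarrow> 'a::real_normed_vector"
  assumes "p \<le> q" "i < 2 ^ q"
  shows "dyadic_incr q (polygon p f) i = (1 / 2 ^ (q - p)) *\<^sub>R dyadic_incr p f (i div 2 ^ (q - p))"
proof -
  define r where "r = q - p"
  define l where "l = i div 2 ^ r"
  have q: "q = p + r" using assms by (simp add: r_def)
  have l: "l < 2 ^ p"
    using assms(2) unfolding q l_def by (simp add: less_mult_imp_div_less power_add)
  have "l * 2 ^ r \<le> i" "i + 1 \<le> (l + 1) * 2 ^ r"
    using dividend_less_div_times[of "2 ^ r" i] by (simp_all add: l_def algebra_simps)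
  then have "real (l * 2 ^ r) \<le> real i" "real (i + 1) \<le> real ((l + 1) * 2 ^ r)"
    by (simp_all only: of_nat_le_iff)
  then have i: "real l * 2 ^ r \<le> real i" "real i + 1 \<le> (real l + 1) * 2 ^ r"
    by (simp_all add: algebra_simps)
  have eq: "2 ^ p * (x / 2 ^ q) = x / 2 ^ r" "2 ^ p * x / 2 ^ q = x / 2 ^ r" for x :: real
    by (simp_all add: q power_add)
  have "real l / 2 ^ p \<le> real i / 2 ^ q" "(real i + 1) / 2 ^ q \<le> (real l + 1) / 2 ^ p"
  proof -
    have "real l \<le> real i / 2 ^ r" "(real i + 1) / 2 ^ r \<le> real l + 1"
      using i by (simp_all add: pos_le_divide_eq pos_divide_le_eq)
    moreover have e: "x / 2 ^ q = x / 2 ^ r / 2 ^ p" for x :: real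
      by (simp add: q power_add mult.commute)
    ultimately show "real l / 2 ^ p \<le> real i / 2 ^ q" "(real i + 1) / 2 ^ q \<le> (real l + 1) / 2 ^ p"
      unfolding e by (auto intro: divide_right_mono simp del: divide_divide_eq_left)
  qed
  moreover have "real i / 2 ^ q \<le> (real i + 1) / 2 ^ q" by (simp add: divide_right_mono)
  ultimately have "real l / 2 ^ p \<le> real i / 2 ^ q" "real i / 2 ^ q \<le> (real l + 1) / 2 ^ p"
     "real l / 2 ^ p \<le> (real i + 1) / 2 ^ q" "(real i + 1) / 2 ^ q \<le> (real l + 1) / 2 ^ p" by linarith+
  then have "dyadic_incr q (polygon p f) i =
      ((real i + 1) / 2 ^ r - real l) *\<^sub>R dyadic_incr p f l - (real i / 2 ^ r - real l) *\<^sub>R dyadic_incr p f l"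
    unfolding dyadic_incr_def[of q] by (simp add: polygon_on_cell[OF l] eq)
  also have "\<dots> = (1 / 2 ^ r) *\<^sub>R dyadic_incr p f l"
    by (simp add: scaleR_diff_left[symmetric] add_divide_distrib)
  finally show ?thesis by (simp add: r_def l_def)
qed

text \<open>
  A polygon is affine on the cells of its own grid, so refining the grid adds no energy.
\<close>
lemma polygon_second_difference:
  fixes f :: "real \<Rightarrow> 'a::real_normed_vector"
  assumes "p \<le> q" "i < 2 ^ q"
  shows "dyadic_incr (Suc q) (polygon p f) (2 * i) = dyadic_incr (Suc q) (polygon p f) (2 * i + 1)"
proof -
  have "2 * i div 2 ^ (Suc q - p) = (2 * i + 1) div 2 ^ (Suc q - p)"
    using assms by (simp add: Suc_diff_le div_mult2_eq)
  then show ?thesis using assms by (simp add: dyadic_incr_polygon)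
qed

lemma dyadic_energy_polygon:
  fixes f :: "real \<Rightarrow> 'a::real_inner"
  assumes "p \<le> q"
  shows "dyadic_energy q (polygon p f) = dyadic_energy p f"
  using assms
proof (induction rule: dec_induct)
  case base
  then show ?case unfolding dyadic_energy_def by (simp add: dyadic_incr_polygon)
next
  case (step q)
  then show ?case unfolding dyadic_energy_Suc by (simp add: polygon_second_difference[simplified])
qed

lemma dyadic_energy_polygon_le:
  fixes f :: "real \<Rightarrow> 'a::real_inner"
  shows "dyadic_energy q (polygon p f) \<le> dyadic_energy p f"
  using dyadic_energy_mono[of q "max p q" "polygon p f"] dyadic_energy_polygon[of p "max p q" f] by simp

text \<open>
  Pythagoras' theorem: the polygon accounts for the energy up to level \<open>p\<close>, and it has no second
  differences at the finer levels, so the remainder carries all the later energy.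
\<close>
lemma dyadic_energy_minus_polygon:
  fixes f :: "real \<Rightarrow> 'a::real_inner"
  assumes "p \<le> q"
  shows "dyadic_energy q (\<lambda>t. f t - polygon p f t) = dyadic_energy q f - dyadic_energy p f"
  using assms
proof (induction rule: dec_induct)
  case base
  show ?case unfolding dyadic_energy_def by (simp add: dyadic_incr_diff dyadic_incr_polygon)
next
  case (step q)
  have "(\<Sum>i<2 ^ q. (norm (dyadic_incr (Suc q) (\<lambda>t. f t - polygon p f t) (2 * i) -
             dyadic_incr (Suc q) (\<lambda>t. f t - polygon p f t) (2 * i + 1)))\<^sup>2)
      = (\<Sum>i<2 ^ q. (norm (dyadic_incr (Suc q) f (2 * i) - dyadic_incr (Suc q) f (2 * i + 1)))\<^sup>2)"
    using step polygon_second_difference[of p q _ f] by (intro sum.cong refl) (simp add: dyadic_incr_diff)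
  then show ?case using step.IH unfolding dyadic_energy_Suc by simp
qed

section \<open>Almost everywhere differentiability of paths of finite energy\<close>
text \<open>
  A weak type inequality. Each \<open>t\<close> in the set spans an interval \<open>[t, s]\<close> on which the squared
  increment exceeds \<open>k\<^sup>2\<close> times the squared length. Vitali's lemma selects disjoint ones whose fivefold
  enlargements cover the set, and disjoint ones have total length at most \<open>c / k\<^sup>2\<close>.
\<close>
lemma steep_set_measure:
  fixes h :: "real \<Rightarrow> 'a::real_inner"
  assumes cont: "continuous_on {0..1} h" and c: "\<And>p. dyadic_energy p h \<le> c" and k: "k > 0"
  obtains T where "T \<in> lmeasurable" "measure lebesgue T \<le> 5 * c / k\<^sup>2"
    "{t\<in>{0..1}. \<exists>s\<in>{0..1}. norm (h s - h t) > k * \<bar>s - t\<bar>} \<subseteq> T"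
proof -
  define S where "S = {t\<in>{0..1}. \<exists>s\<in>{0..1}. norm (h s - h t) > k * \<bar>s - t\<bar>}"
  define s where "s t = (SOME s. s \<in> {0..1} \<and> norm (h s - h t) > k * \<bar>s - t\<bar>)" for t
  have s: "s t \<in> {0..1}" "norm (h (s t) - h t) > k * \<bar>s t - t\<bar>" "t \<in> {0..1}" if "t \<in> S" for t
    using someI_ex[of "\<lambda>s. s \<in> {0..1} \<and> norm (h s - h t) > k * \<bar>s - t\<bar>"] that
    unfolding S_def s_def by blast+
  have neq: "s t \<noteq> t" if "t \<in> S" for t using s(2)[OF that] by auto
  define a where "a t = (t + s t) / 2" for t
  define r where "r t = \<bar>t - s t\<bar> / 2" for t
  define u where "u t = min t (s t)" for t
  define v where "v t = max t (s t)" for t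
  have cb: "cball (a t) (r t) = {u t..v t}" for t
    unfolding a_def r_def u_def v_def cball_eq_atLeastAtMost
    by (cases "t \<le> s t") (auto simp: field_simps)
  have "S \<subseteq> (\<Union>i\<in>S. cball (a i) (r i))" unfolding cb by (auto simp: u_def v_def)
  moreover have "0 < r i \<and> r i \<le> 1" if "i \<in> S" for i
    using s[OF that] neq[OF that] by (auto simp: r_def)
  ultimately obtain C where C: "countable C" "C \<subseteq> S"
     "pairwise (\<lambda>i j. disjnt (cball (a i) (r i)) (cball (a j) (r j))) C"
     "S \<subseteq> (\<Union>i\<in>C. cball (a i) (5 * r i))"
    by (rule Vitali_covering_lemma_cballs)
  have bound: "measure lebesgue (\<Union>i\<in>F. cball (a i) (5 * r i)) \<le> 5 * c / k\<^sup>2" if F: "F \<subseteq> C" "finite F" for F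
  proof -
    have FS: "i \<in> S" if "i \<in> F" for i using F C(2) that by auto
    have "(\<Sum>i\<in>F. k\<^sup>2 * (v i - u i)) \<le> (\<Sum>i\<in>F. (norm (h (v i) - h (u i)))\<^sup>2 / (v i - u i))"
    proof (rule sum_mono)
      fix i assume "i \<in> F"
      note i = FS[OF this]
      have l: "v i - u i = \<bar>s i - i\<bar>" "v i - u i > 0" using neq[OF i] by (auto simp: u_def v_def)
      have n: "norm (h (v i) - h (u i)) = norm (h (s i) - h i)"
        by (auto simp: u_def v_def max_def min_def norm_minus_commute)
      have "(k * (v i - u i))\<^sup>2 \<le> (norm (h (v i) - h (u i)))\<^sup>2"
        using s(2)[OF i] k l by (intro power_mono) (auto simp: n)
      then show "k\<^sup>2 * (v i - u i) \<le> (norm (h (v i) - h (u i)))\<^sup>2 / (v i - u i)"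
        using l by (simp add: power2_eq_square field_simps)
    qed
    also have "\<dots> \<le> c"
    proof (rule energy_intervals[OF cont c F(2)])
      show "0 \<le> u i \<and> u i \<le> v i \<and> v i \<le> 1" if "i \<in> F" for i
        using s[OF FS[OF that]] by (auto simp: u_def v_def)
      show "disjoint_family_on (\<lambda>i. {u i<..<v i}) F"
        unfolding disjoint_family_on_def
      proof (intro ballI impI)
        fix i j assume "i \<in> F" "j \<in> F" "i \<noteq> j"
        then have "{u i..v i} \<inter> {u j..v j} = {}"
          using C(3) F(1) unfolding cb pairwise_def disjnt_def by blast
        then show "{u i<..<v i} \<inter> {u j<..<v j} = {}"
          using greaterThanLessThan_subseteq_atLeastAtMost_iff[of "u i" "v i" "u i" "v i"]
            greaterThanLessThan_subseteq_atLeastAtMost_iff[of "u j" "v j" "u j" "v j"] by blast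
      qed
    qed
    finally have "k\<^sup>2 * (\<Sum>i\<in>F. v i - u i) \<le> c"
      by (simp only: sum_distrib_left)
    then have *: "(\<Sum>i\<in>F. v i - u i) \<le> c / k\<^sup>2"
      using k by (simp add: pos_le_divide_eq mult.commute)
    have "measure lebesgue (\<Union>i\<in>F. cball (a i) (5 * r i)) \<le> (\<Sum>i\<in>F. measure lebesgue (cball (a i) (5 * r i)))"
      by (rule measure_UNION_le[OF F(2)]) simp
    also have "\<dots> = (\<Sum>i\<in>F. 5 * (v i - u i))"
      by (intro sum.cong refl) (auto simp: cball_eq_atLeastAtMost r_def u_def v_def max_def min_def)
    also have "\<dots> \<le> 5 * c / k\<^sup>2" using * by (simp only: sum_distrib_left[symmetric])
    finally show ?thesis .
  qed
  show thesis
  proof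
    show "(\<Union>i\<in>C. cball (a i) (5 * r i)) \<in> lmeasurable"
      by (rule fmeasurable_UN_bound[OF C(1) _ bound]) auto
    show "measure lebesgue (\<Union>i\<in>C. cball (a i) (5 * r i)) \<le> 5 * c / k\<^sup>2"
      by (rule measure_UN_bound[OF C(1) _ bound]) auto
  qed (use C(4) in \<open>simp add: S_def\<close>)
qed

lemma has_vector_derivative_within_epsilon:
  "(f has_vector_derivative D) (at t within S) \<longleftrightarrow>
     (\<forall>e>0. \<exists>d>0. \<forall>s\<in>S. \<bar>s - t\<bar> < d \<longrightarrow> norm (f s - f t - (s - t) *\<^sub>R D) \<le> e * \<bar>s - t\<bar>)"
  unfolding has_vector_derivative_def has_derivative_within_alt
  by (simp add: bounded_linear_scaleR_left)

text \<open>
  The approximate slopes for ever smaller errors form a Cauchy sequence; its limit is the derivative.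
\<close>
lemma differentiable_if_approximable:
  fixes f :: "real \<Rightarrow> 'a::banach"
  assumes t: "t islimpt S"
    and approx: "\<And>e. e > 0 \<Longrightarrow> \<exists>v. \<exists>d>0. \<forall>s\<in>S. \<bar>s - t\<bar> < d \<longrightarrow> norm (f s - f t - (s - t) *\<^sub>R v) \<le> e * \<bar>s - t\<bar>"
  shows "f differentiable (at t within S)"
proof -
  have "\<exists>v. \<exists>d>0. \<forall>s\<in>S. \<bar>s - t\<bar> < d \<longrightarrow> norm (f s - f t - (s - t) *\<^sub>R v) \<le> inverse (real (Suc k)) * \<bar>s - t\<bar>" for k
    by (rule approx) simp
  then obtain v d where d: "\<And>k. d k > 0"
    and v: "\<And>k s. s \<in> S \<Longrightarrow> \<bar>s - t\<bar> < d k \<Longrightarrow> norm (f s - f t - (s - t) *\<^sub>R v k) \<le> inverse (real (Suc k)) * \<bar>s - t\<bar>"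
    by metis
  have vv: "norm (v j - v k) \<le> inverse (real (Suc j)) + inverse (real (Suc k))" for j k
  proof -
    have "min (d j) (d k) > 0" using d by simp
    then obtain s where s: "s \<in> S" "s \<noteq> t" "\<bar>s - t\<bar> < d j" "\<bar>s - t\<bar> < d k"
      using t unfolding islimpt_approachable dist_real_def by (metis min_less_iff_conj)
    have "\<bar>s - t\<bar> * norm (v j - v k) = norm ((f s - f t - (s - t) *\<^sub>R v k) - (f s - f t - (s - t) *\<^sub>R v j))"
      by (simp add: scaleR_diff_right[symmetric])
    also have "\<dots> \<le> inverse (real (Suc k)) * \<bar>s - t\<bar> + inverse (real (Suc j)) * \<bar>s - t\<bar>"
      by (rule order_trans[OF norm_triangle_ineq4]) (intro add_mono v s)
    also have "\<dots> = \<bar>s - t\<bar> * (inverse (real (Suc j)) + inverse (real (Suc k)))" by (simp add: algebra_simps)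
    finally show ?thesis using s(2) by (subst (asm) mult_le_cancel_left_pos) auto
  qed
  have "Cauchy v"
  proof (rule CauchyI)
    fix e :: real assume "e > 0"
    then obtain N where N: "inverse (real (Suc N)) < e / 2" using reals_Archimedean[of "e / 2"] by auto
    have "norm (v m - v n) < e" if "m \<ge> N" "n \<ge> N" for m n
    proof -
      have "inverse (real (Suc m)) \<le> inverse (real (Suc N))" "inverse (real (Suc n)) \<le> inverse (real (Suc N))"
        using that by (auto intro!: le_imp_inverse_le)
      then show ?thesis using vv[of m n] N by linarith
    qed
    then show "\<exists>N. \<forall>m\<ge>N. \<forall>n\<ge>N. norm (v m - v n) < e" by blast
  qed
  then obtain L where L: "v \<longlonglongrightarrow> L" using Cauchy_convergent convergent_def by blast
  have vL: "norm (v k - L) \<le> inverse (real (Suc k))" for k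
  proof (rule LIMSEQ_le[OF tendsto_norm[OF tendsto_diff[OF tendsto_const L]]])
    show "\<exists>N. \<forall>n\<ge>N. norm (v k - v n) \<le> inverse (real (Suc k)) + inverse (real (Suc n))" using vv by blast
    show "(\<lambda>n. inverse (real (Suc k)) + inverse (real (Suc n))) \<longlonglongrightarrow> inverse (real (Suc k))"
      using tendsto_add[OF tendsto_const LIMSEQ_inverse_real_of_nat, of "inverse (real (Suc k))"] by simp
  qed
  have "(f has_vector_derivative L) (at t within S)"
    unfolding has_vector_derivative_within_epsilon
  proof (intro allI impI)
    fix e :: real assume "e > 0"
    then obtain k where k: "inverse (real (Suc k)) < e / 2" using reals_Archimedean[of "e / 2"] by auto
    have "norm (f s - f t - (s - t) *\<^sub>R L) \<le> e * \<bar>s - t\<bar>" if "s \<in> S" "\<bar>s - t\<bar> < d k" for s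
    proof -
      have "f s - f t - (s - t) *\<^sub>R L = (f s - f t - (s - t) *\<^sub>R v k) + (s - t) *\<^sub>R (v k - L)"
        by (simp add: algebra_simps)
      then have "norm (f s - f t - (s - t) *\<^sub>R L) \<le> norm (f s - f t - (s - t) *\<^sub>R v k) + \<bar>s - t\<bar> * norm (v k - L)"
        by (metis norm_scaleR norm_triangle_ineq)
      also have "\<dots> \<le> inverse (real (Suc k)) * \<bar>s - t\<bar> + \<bar>s - t\<bar> * inverse (real (Suc k))"
        using v[OF that] vL[of k] by (intro add_mono mult_left_mono) auto
      also have "\<dots> = (2 * inverse (real (Suc k))) * \<bar>s - t\<bar>" by simp
      also have "\<dots> \<le> e * \<bar>s - t\<bar>" using k by (intro mult_right_mono) auto
      finally show ?thesis .
    qed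
    then show "\<exists>d>0. \<forall>s\<in>S. \<bar>s - t\<bar> < d \<longrightarrow> norm (f s - f t - (s - t) *\<^sub>R L) \<le> e * \<bar>s - t\<bar>"
      using d by blast
  qed
  then show ?thesis by (auto simp: has_vector_derivative_def differentiable_def)
qed

text \<open>
  Away from the grid points a polygon is locally affine, so its slope at \<open>t\<close> approximates the
  difference quotients of \<open>f\<close> at \<open>t\<close> wherever the remainder \<open>h p\<close> is not steep. The remainders have
  energies tending to \<open>0\<close>, so the exceptional points for a given slope form a null set.
\<close>
lemma energy_differentiable_AE:
  fixes f :: "real \<Rightarrow> 'a::euclidean_space"
  assumes cont: "continuous_on {0..1} f" and c: "\<And>p. dyadic_energy p f \<le> c"
  shows "negligible {t\<in>{0..1}. \<not> f differentiable (at t within {0..1})}"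
proof -
  \<comment> \<open>Dyadic points, where polygons have corners; they include the end points of the unit interval.\<close>
  define G where "G = (\<Union>p i. {real i / 2 ^ p :: real})"
  define h where "h p t = f t - polygon p f t" for p t
  define E where "E p k = {t\<in>{0..1}. \<exists>s\<in>{0..1}. norm (h p s - h p t) > inverse (real (Suc k)) * \<bar>s - t\<bar>}" for p k
  have "countable G" unfolding G_def by auto
  have sup: "\<exists>p. \<forall>q. dyadic_energy q (h p) \<le> e" if "e > 0" for e
  proof -
    have bdd: "bdd_above (range (\<lambda>p. dyadic_energy p f))"
      using c by (intro bdd_aboveI[of _ c]) auto
    obtain p where p: "dyadic_energy p f > (SUP p. dyadic_energy p f) - e"
      using \<open>e > 0\<close> less_cSUP_iff[OF _ bdd, of "(SUP p. dyadic_energy p f) - e"] by auto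
    have "dyadic_energy q (h p) \<le> e" for q
    proof -
      have "dyadic_energy q (h p) \<le> dyadic_energy (max p q) (h p)" by (rule dyadic_energy_mono) simp
      also have "\<dots> = dyadic_energy (max p q) f - dyadic_energy p f"
        unfolding h_def by (rule dyadic_energy_minus_polygon) simp
      also have "\<dots> \<le> e" using cSUP_upper[OF _ bdd, of "max p q"] p by simp
      finally show ?thesis .
    qed
    then show ?thesis by blast
  qed
  have neg: "negligible (\<Inter>p. E p k)" for k
    unfolding negligible_outer_le
  proof (intro allI impI)
    fix e :: real assume "e > 0"
    define k' where "k' = inverse (real (Suc k))"
    have "k' > 0" by (simp add: k'_def)
    obtain p where p: "\<And>q. dyadic_energy q (h p) \<le> e * k'\<^sup>2 / 5"
      using sup[of "e * k'\<^sup>2 / 5"] \<open>e > 0\<close> \<open>k' > 0\<close> by auto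
    have "continuous_on {0..1} (h p)" unfolding h_def by (intro continuous_intros cont continuous_on_polygon)
    from steep_set_measure[OF this p \<open>k' > 0\<close>] obtain T where "T \<in> lmeasurable"
      "measure lebesgue T \<le> 5 * (e * k'\<^sup>2 / 5) / k'\<^sup>2" "E p k \<subseteq> T"
      unfolding E_def k'_def by blast
    then show "\<exists>T. (\<Inter>p. E p k) \<subseteq> T \<and> T \<in> lmeasurable \<and> measure lebesgue T \<le> e"
      using \<open>k' > 0\<close> by (intro exI[of _ T]) auto
  qed
  have "negligible (G \<union> (\<Union>k. \<Inter>p. E p k))"
    using \<open>countable G\<close> neg
    by (intro negligible_Un negligible_countable_Union)
       (auto simp: negligible_iff_null_sets intro: null_sets_completionI countable_imp_null_set_lborel)
  moreover have "{t\<in>{0..1}. \<not> f differentiable (at t within {0..1})} \<subseteq> G \<union> (\<Union>k. \<Inter>p. E p k)"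
  proof (rule subsetI, rule ccontr)
    fix t assume t: "t \<in> {t\<in>{0..1}. \<not> f differentiable (at t within {0..1})}" and nt: "t \<notin> G \<union> (\<Union>k. \<Inter>p. E p k)"
    have notgrid: "t \<noteq> real i / 2 ^ p" for i p using nt by (auto simp: G_def)
    have t01: "0 < t" "t < 1" using t notgrid[of 0 0] notgrid[of 1 0] by auto
    have "f differentiable (at t within {0..1})"
    proof (rule differentiable_if_approximable)
      show "t islimpt {0..1}" using t01 by (simp add: islimpt_Icc)
      fix e :: real assume "e > 0"
      then obtain k where k: "inverse (real (Suc k)) < e" using reals_Archimedean by auto
      \<comment> \<open>A level at which the remainder is not steep at t.\<close>
      obtain p where p: "t \<notin> E p k" using nt by auto
      define l where "l = dyadic_floor p t"
      have l: "l < 2 ^ p" using t01 by (simp add: l_def dyadic_floor_less)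
      have tl: "real l / 2 ^ p < t" "t < (real l + 1) / 2 ^ p"
        using dyadic_floor_bounds[of t p] t01 notgrid[of l p] by (auto simp: l_def)
      define d where "d = min (t - real l / 2 ^ p) ((real l + 1) / 2 ^ p - t)"
      define v where "v = 2 ^ p *\<^sub>R dyadic_incr p f l"
      have "norm (f s - f t - (s - t) *\<^sub>R v) \<le> e * \<bar>s - t\<bar>" if s: "s \<in> {0..1}" "\<bar>s - t\<bar> < d" for s
      proof -
        have "real l / 2 ^ p \<le> s" "s \<le> (real l + 1) / 2 ^ p" using s tl by (auto simp: d_def)
        then have "polygon p f s - polygon p f t = (s - t) *\<^sub>R v"
          using tl by (simp add: polygon_on_cell[OF l] v_def algebra_simps)
        then have "f s - f t - (s - t) *\<^sub>R v = h p s - h p t" by (simp add: h_def algebra_simps)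
        moreover have "norm (h p s - h p t) \<le> inverse (real (Suc k)) * \<bar>s - t\<bar>"
          using p s t01 unfolding E_def by (auto simp: not_less simp del: of_nat_Suc)
        moreover have "inverse (real (Suc k)) * \<bar>s - t\<bar> \<le> e * \<bar>s - t\<bar>" using k by (intro mult_right_mono) auto
        ultimately show ?thesis by simp
      qed
      moreover have "d > 0" using tl by (simp add: d_def)
      ultimately show "\<exists>v. \<exists>d>0. \<forall>s\<in>{0..1}. \<bar>s - t\<bar> < d \<longrightarrow> norm (f s - f t - (s - t) *\<^sub>R v) \<le> e * \<bar>s - t\<bar>"
        by blast
    qed
    then show False using t by simp
  qed
  ultimately show ?thesis by (rule negligible_subset)
qed

section \<open>The action as a supremum of dyadic energies\<close>
text \<open>
  The cells straddle \<open>t\<close>, which is enough for their difference quotients to converge to the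
  derivative.
\<close>
lemma dyadic_quotient_tendsto:
  fixes f :: "real \<Rightarrow> 'a::real_normed_vector"
  assumes t: "0 \<le> t" "t < 1" and D: "(f has_vector_derivative D) (at t within {0..1})"
  shows "(\<lambda>p. 2 ^ p *\<^sub>R dyadic_incr p f (dyadic_floor p t)) \<longlonglongrightarrow> D"
proof (rule LIMSEQ_I)
  fix r :: real assume "r > 0"
  then obtain d where d: "d > 0" "\<And>s. s \<in> {0..1} \<Longrightarrow> \<bar>s - t\<bar> < d \<Longrightarrow> norm (f s - f t - (s - t) *\<^sub>R D) \<le> (r / 2) * \<bar>s - t\<bar>"
    using D[unfolded has_vector_derivative_within_epsilon, rule_format, of "r / 2"] by auto
  obtain N where N: "(1 / 2) ^ N < d" using real_arch_pow_inv[of d "1/2"] d(1) by auto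
  have "norm (2 ^ p *\<^sub>R dyadic_incr p f (dyadic_floor p t) - D) < r" if "p \<ge> N" for p
  proof -
    define l where "l = dyadic_floor p t"
    define u where "u = real l / 2 ^ p"
    define v where "v = (real l + 1) / 2 ^ p"
    have l: "l < 2 ^ p" using t by (simp add: l_def dyadic_floor_less)
    then have "real l + 1 \<le> 2 ^ p"
      by (metis Suc_leI of_nat_Suc of_nat_le_iff of_nat_numeral of_nat_power add.commute)
    then have v1: "v \<le> 1" by (simp add: v_def)
    have uv: "u \<le> t" "t < v" "0 \<le> u"
      using dyadic_floor_bounds[of t p] t by (auto simp: u_def v_def l_def)
    have vu: "v - u = (1/2) ^ p" by (simp add: u_def v_def field_simps)
    also have "\<dots> \<le> (1/2) ^ N" using that by (intro power_decreasing) auto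
    finally have "v - u < d" using N by simp
    then have "norm (f v - f t - (v - t) *\<^sub>R D) \<le> (r / 2) * \<bar>v - t\<bar>" "norm (f u - f t - (u - t) *\<^sub>R D) \<le> (r / 2) * \<bar>u - t\<bar>"
      using d(2)[of v] d(2)[of u] uv v1 by auto
    note n = this
    have eq: "(f v - f u) - (v - u) *\<^sub>R D = (f v - f t - (v - t) *\<^sub>R D) - (f u - f t - (u - t) *\<^sub>R D)"
      by (simp add: algebra_simps)
    have "norm ((f v - f u) - (v - u) *\<^sub>R D) \<le> (r / 2) * \<bar>v - t\<bar> + (r / 2) * \<bar>u - t\<bar>"
      unfolding eq by (rule order_trans[OF norm_triangle_ineq4]) (intro add_mono n)
    also have "\<bar>v - t\<bar> = v - t" using uv by simp
    also have "\<bar>u - t\<bar> = t - u" using uv by simp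
    also have "(r / 2) * (v - t) + (r / 2) * (t - u) = (r / 2) * (v - u)"
      unfolding distrib_left[symmetric] by simp
    finally have "2 ^ p * norm ((f v - f u) - (v - u) *\<^sub>R D) \<le> 2 ^ p * ((r / 2) * (v - u))"
      by (rule mult_left_mono) simp
    also have "\<dots> = r / 2" by (simp add: vu power_one_over)
    also have "2 ^ p * norm ((f v - f u) - (v - u) *\<^sub>R D) = norm (2 ^ p *\<^sub>R ((f v - f u) - (v - u) *\<^sub>R D))"
      by simp
    also have "2 ^ p *\<^sub>R ((f v - f u) - (v - u) *\<^sub>R D) = 2 ^ p *\<^sub>R dyadic_incr p f l - D"
    proof -
      have "2 ^ p * (v - u) = 1" by (simp add: vu power_one_over)
      moreover have "dyadic_incr p f l = f v - f u" by (simp add: dyadic_incr_def u_def v_def)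
      ultimately show ?thesis by (simp add: scaleR_diff_right[of "2 ^ p" "f v - f u"])
    qed
    finally show ?thesis using \<open>r > 0\<close> by (simp add: l_def)
  qed
  then show "\<exists>N. \<forall>p\<ge>N. norm (2 ^ p *\<^sub>R dyadic_incr p f (dyadic_floor p t) - D) < r" by blast
qed

lemma dyadic_cell_iff:
  "real i / 2 ^ p \<le> t \<and> t < (real i + 1) / 2 ^ p \<longleftrightarrow> 0 \<le> t \<and> dyadic_floor p t = i"
proof
  assume a: "real i / 2 ^ p \<le> t \<and> t < (real i + 1) / 2 ^ p"
  then have "0 \<le> t" by (meson divide_nonneg_pos of_nat_0_le_iff order_trans zero_less_numeral zero_less_power)
  moreover have "\<lfloor>2 ^ p * t\<rfloor> = int i"
    using a by (intro floor_unique) (simp_all add: field_simps)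
  ultimately show "0 \<le> t \<and> dyadic_floor p t = i" by (simp add: dyadic_floor_def)
qed (use dyadic_floor_bounds in auto)

text \<open>
  Fatou's lemma for the squared slopes of the polygons: their integrals are the dyadic energies, and
  they converge almost everywhere to the squared derivative.
\<close>
lemma energy_derivative_integral:
  fixes f :: "real \<Rightarrow> 'a::euclidean_space"
  assumes cont: "continuous_on {0..1} f" and c: "\<And>p. dyadic_energy p f \<le> c"
  defines "g \<equiv> \<lambda>t. vector_derivative f (at t within {0..1})"
  shows "integrable (lebesgue_on {0..1}) (\<lambda>t. (norm (g t))\<^sup>2)"
    and "(LINT t|lebesgue_on {0..1}. (norm (g t))\<^sup>2) \<le> c"
proof -
  have c0: "c \<ge> 0" using c[of 0] dyadic_energy_nonneg[of 0 f] by linarith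
  define a where "a p i = (2 ^ p * norm (dyadic_incr p f i))\<^sup>2" for p i
  \<comment> \<open>The squared slope of the level-p polygon, as a step function.\<close>
  define s where "s p t = (\<Sum>i<2 ^ p. a p i * indicator {real i / 2 ^ p..<(real i + 1) / 2 ^ p} t)" for p and t :: real
  \<comment> \<open>The integrand on the whole line, so that its measurability can be decided up to null sets.\<close>
  define u where "u t = indicator {0..1} t * (norm (g t))\<^sup>2" for t :: real
  have a_nn: "a p i \<ge> 0" for p i by (simp add: a_def)
  have s_nn: "s p t \<ge> 0" for p t unfolding s_def a_def by (intro sum_nonneg) auto
  have s_meas[measurable]: "s p \<in> borel_measurable lebesgue" for p
    unfolding s_def by (intro borel_measurable_sum borel_measurable_times borel_measurable_indicator) auto
  have s_eq: "s p t = (if 0 \<le> t \<and> t < 1 then a p (dyadic_floor p t) else 0)" for p t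
  proof (cases "0 \<le> t")
    case True
    have ind: "indicator {real i / 2 ^ p..<(real i + 1) / 2 ^ p} t = (if i = dyadic_floor p t then 1 else (0::real))" for i
      using dyadic_cell_iff[of i p t] True by (auto simp: indicator_def)
    have "dyadic_floor p t < 2 ^ p \<longleftrightarrow> t < 1"
      using dyadic_floor_less[of t p] dyadic_floor_mono[of 1 t p] True by fastforce
    moreover have "s p t = (\<Sum>i<2 ^ p. if i = dyadic_floor p t then a p i else 0)"
      unfolding s_def ind by (intro sum.cong) auto
    ultimately show ?thesis using True by (simp add: sum.delta)
  next
    case False
    then have ind: "indicator {real i / 2 ^ p..<(real i + 1) / 2 ^ p} t = (0::real)" for i
      using dyadic_cell_iff[of i p t] by (auto simp: indicator_def)
    show ?thesis using False unfolding s_def ind by simp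
  qed
  have s_int: "(\<integral>\<^sup>+t. ennreal (s p t) \<partial>lebesgue) \<le> ennreal c" for p
  proof -
    have "ennreal (s p t) = (\<Sum>i<2 ^ p. ennreal (a p i) * indicator {real i / 2 ^ p..<(real i + 1) / 2 ^ p} t)" for t
      unfolding s_def by (subst sum_ennreal[symmetric]) (auto simp: a_nn ennreal_mult ennreal_indicator)
    then have "(\<integral>\<^sup>+t. ennreal (s p t) \<partial>lebesgue) = (\<integral>\<^sup>+t. (\<Sum>i<2 ^ p. ennreal (a p i) * indicator {real i / 2 ^ p..<(real i + 1) / 2 ^ p} t) \<partial>lebesgue)"
      by simp
    also have "\<dots> = (\<Sum>i<2 ^ p. \<integral>\<^sup>+t. ennreal (a p i) * indicator {real i / 2 ^ p..<(real i + 1) / 2 ^ p} t \<partial>lebesgue)"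
      by (intro nn_integral_sum borel_measurable_times_ennreal borel_measurable_const borel_measurable_indicator) auto
    also have "\<dots> = (\<Sum>i<2 ^ p. ennreal (a p i * (1 / 2 ^ p)))"
    proof (intro sum.cong refl)
      fix i
      have le: "real i / 2 ^ p \<le> (real i + 1) / 2 ^ p" by (simp add: divide_right_mono)
      have "emeasure lebesgue {real i / 2 ^ p..<(real i + 1) / 2 ^ p} = ennreal (1 / 2 ^ p)"
        using emeasure_lborel_Ico[OF le] by (simp add: diff_divide_distrib[symmetric])
      then show "(\<integral>\<^sup>+t. ennreal (a p i) * indicator {real i / 2 ^ p..<(real i + 1) / 2 ^ p} t \<partial>lebesgue) = ennreal (a p i * (1 / 2 ^ p))"
        by (subst nn_integral_cmult_indicator) (auto simp: ennreal_mult[symmetric] a_nn)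
    qed
    also have "\<dots> = ennreal (\<Sum>i<2 ^ p. a p i * (1 / 2 ^ p))" by (intro sum_ennreal) (simp add: a_nn)
    also have "(\<Sum>i<2 ^ p. a p i * (1 / 2 ^ p)) = dyadic_energy p f"
      unfolding dyadic_energy_def sum_distrib_left by (intro sum.cong) (auto simp: a_def power_mult_distrib power2_eq_square)
    also have "ennreal \<dots> \<le> ennreal c" using c by (rule ennreal_leI)
    finally show ?thesis .
  qed
  define N where "N = {t\<in>{0..1}. \<not> f differentiable (at t within {0..1})} \<union> {1}"
  have "negligible N" unfolding N_def
    using energy_differentiable_AE[OF cont c] by (intro negligible_Un) auto
  then have "N \<in> null_sets lebesgue" by (simp add: negligible_iff_null_sets)
  then have lim: "AE t in lebesgue. (\<lambda>p. s p t) \<longlonglongrightarrow> u t"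
  proof (rule AE_I')
    show "{t \<in> space lebesgue. \<not> (\<lambda>p. s p t) \<longlonglongrightarrow> u t} \<subseteq> N"
    proof (rule subsetI, rule ccontr)
      fix t assume t: "t \<in> {t \<in> space lebesgue. \<not> (\<lambda>p. s p t) \<longlonglongrightarrow> u t}" and nN: "t \<notin> N"
      have "(\<lambda>p. s p t) \<longlonglongrightarrow> u t"
      proof (cases "0 \<le> t \<and> t < 1")
        case True
        then have "(f has_vector_derivative g t) (at t within {0..1})"
          using nN unfolding g_def N_def by (auto simp: vector_derivative_works[symmetric])
        from tendsto_power[OF tendsto_norm[OF dyadic_quotient_tendsto[OF _ _ this]], of 2]
        show ?thesis using True by (simp add: s_eq a_def u_def)
      next
        case False
        then have "u t = 0" using nN by (auto simp: u_def N_def indicator_def)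
        then show ?thesis using False by (simp add: s_eq del: de_Morgan_conj)
      qed
      then show False using t by simp
    qed
  qed
  have u_meas: "u \<in> borel_measurable lebesgue"
  proof (rule borel_measurable_AE)
    show "(\<lambda>t. lim (\<lambda>p. s p t)) \<in> borel_measurable lebesgue" by measurable
    show "AE t in lebesgue. lim (\<lambda>p. s p t) = u t" using lim by eventually_elim (rule limI)
  qed
  have u_nn: "u t \<ge> 0" for t by (simp add: u_def)
  have "(\<integral>\<^sup>+t. ennreal (u t) \<partial>lebesgue) = (\<integral>\<^sup>+t. liminf (\<lambda>p. ennreal (s p t)) \<partial>lebesgue)"
    using lim by (intro nn_integral_cong_AE, eventually_elim) (auto intro!: lim_imp_Liminf[symmetric] tendsto_ennrealI)
  also have "\<dots> \<le> liminf (\<lambda>p. \<integral>\<^sup>+t. ennreal (s p t) \<partial>lebesgue)"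
    by (rule nn_integral_liminf) simp
  also have "\<dots> \<le> liminf (\<lambda>p. ennreal c)"
    by (intro Liminf_mono always_eventually allI s_int)
  also have "\<dots> = ennreal c" by (simp add: Liminf_const)
  finally have u_int: "(\<integral>\<^sup>+t. ennreal (u t) \<partial>lebesgue) \<le> ennreal c" .
  then have iu: "integrable lebesgue u"
    using u_meas u_nn le_less_trans[OF u_int ennreal_less_top] by (intro integrableI_nonneg) auto
  then have "ennreal (integral\<^sup>L lebesgue u) \<le> ennreal c"
    using u_int nn_integral_eq_integral[OF iu] u_nn by simp
  then have "integral\<^sup>L lebesgue u \<le> c" using c0 by simp
  moreover have "(LINT t|lebesgue_on {0..1}. (norm (g t))\<^sup>2) = integral\<^sup>L lebesgue u"
    by (subst integral_restrict_space) (auto simp: u_def[abs_def])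
  ultimately show "(LINT t|lebesgue_on {0..1}. (norm (g t))\<^sup>2) \<le> c" by simp
  show "integrable (lebesgue_on {0..1}) (\<lambda>t. (norm (g t))\<^sup>2)"
    using iu by (subst integrable_restrict_space) (auto simp: u_def[abs_def])
qed

text \<open>
  The definition speaks of families indexed by an initial segment of the naturals; a tagged division
  is a family indexed by a finite set.
\<close>
lemma absolutely_continuous_on_finite:
  assumes "absolutely_continuous_on a b f" "e > 0"
  shows "\<exists>d>0. \<forall>(A :: 'i set) u v. finite A \<and> (\<forall>i\<in>A. a \<le> u i \<and> u i \<le> v i \<and> v i \<le> b) \<and>
     disjoint_family_on (\<lambda>i. {u i<..<v i}) A \<and> (\<Sum>i\<in>A. v i - u i) < d \<longrightarrow> (\<Sum>i\<in>A. norm (f (v i) - f (u i))) < e"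
proof -
  obtain d where d: "d > 0" "\<And>(m::nat) u v. (\<forall>i<m. a \<le> u i \<and> u i \<le> v i \<and> v i \<le> b) \<and>
        disjoint_family_on (\<lambda>i. {u i<..<v i}) {..<m} \<and> (\<Sum>i<m. v i - u i) < d \<Longrightarrow>
        (\<Sum>i<m. norm (f (v i) - f (u i))) < e"
    using assms unfolding absolutely_continuous_on_def by meson
  show ?thesis
  proof (intro exI[of _ d] conjI allI impI)
    fix A :: "'i set" and u v
    assume "finite A \<and> (\<forall>i\<in>A. a \<le> u i \<and> u i \<le> v i \<and> v i \<le> b) \<and>
      disjoint_family_on (\<lambda>i. {u i<..<v i}) A \<and> (\<Sum>i\<in>A. v i - u i) < d"
    then have A: "finite A" "\<And>i. i \<in> A \<Longrightarrow> a \<le> u i \<and> u i \<le> v i \<and> v i \<le> b"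
     "disjoint_family_on (\<lambda>i. {u i<..<v i}) A" "(\<Sum>i\<in>A. v i - u i) < d" by auto
    obtain h where h: "bij_betw h {0..<card A} A" using ex_bij_betw_nat_finite[OF A(1)] by blast
    then have hA: "h i \<in> A" if "i < card A" for i using that by (auto simp: bij_betw_def)
    have inj: "inj_on h {..<card A}" using h by (auto simp: bij_betw_def atLeast0LessThan)
    have "(\<Sum>i<card A. norm (f (v (h i)) - f (u (h i)))) < e"
    proof (rule d(2), intro conjI allI impI)
      show "disjoint_family_on (\<lambda>i. {u (h i)<..<v (h i)}) {..<card A}"
        unfolding disjoint_family_on_def
      proof (intro ballI impI)
        fix i j assume "i \<in> {..<card A}" "j \<in> {..<card A}" "i \<noteq> j"
        then have "h i \<in> A" "h j \<in> A" "h i \<noteq> h j" using hA inj by (auto simp: inj_on_def)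
        then show "{u (h i)<..<v (h i)} \<inter> {u (h j)<..<v (h j)} = {}"
          using A(3) by (simp add: disjoint_family_on_def)
      qed
      show "(\<Sum>i<card A. v (h i) - u (h i)) < d"
        using A(4) sum.reindex_bij_betw[OF h, of "\<lambda>i. v i - u i"] by (simp add: atLeast0LessThan)
    qed (use A(2) hA in auto)
    then show "(\<Sum>i\<in>A. norm (f (v i) - f (u i))) < e"
      using sum.reindex_bij_betw[OF h, of "\<lambda>i. norm (f (v i) - f (u i))"] by (simp add: atLeast0LessThan)
  qed (rule d(1))
qed

text \<open>
  A Henstock argument. At tags where \<open>f\<close> is differentiable the gauge comes from the derivative; at
  tags in the null set \<open>N\<close> it keeps the intervals inside an open set so small that by absolute
  continuity the increments of \<open>f\<close> over them are negligible in total.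
\<close>
lemma absolutely_continuous_FTC:
  fixes f :: "real \<Rightarrow> 'a::euclidean_space"
  assumes ac: "absolutely_continuous_on 0 1 f" and neg: "negligible N"
    and der: "\<And>t. t \<in> {0..1} - N \<Longrightarrow> (f has_vector_derivative g t) (at t within {0..1})"
    and g0: "\<And>t. t \<in> N \<Longrightarrow> g t = 0"
    and ab: "0 \<le> a" "a \<le> b" "b \<le> 1"
  shows "(g has_integral (f b - f a)) {a..b}"
  unfolding has_integral_real
proof (intro allI impI)
  fix e :: real assume "e > 0"
  have "e / 2 > 0" using \<open>e > 0\<close> by simp
  then obtain \<delta> where \<delta>: "\<delta> > 0" and ac': "\<forall>(A :: (real \<times> real set) set) u v. finite A \<and> (\<forall>i\<in>A. 0 \<le> u i \<and> u i \<le> v i \<and> v i \<le> 1) \<and>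
     disjoint_family_on (\<lambda>i. {u i<..<v i}) A \<and> (\<Sum>i\<in>A. v i - u i) < \<delta> \<longrightarrow> (\<Sum>i\<in>A. norm (f (v i) - f (u i))) < e / 2"
    using absolutely_continuous_on_finite[OF ac] by blast
  obtain U where U: "open U" "N \<subseteq> U" "U \<in> lmeasurable" "measure lebesgue U < \<delta>"
  proof -
    have N: "N \<in> null_sets lebesgue" using neg by (simp add: negligible_iff_null_sets)
    then have "N \<in> sets lebesgue" by auto
    from sets_lebesgue_outer_open[OF this \<delta>] obtain T where T: "open T" "N \<subseteq> T" "T - N \<in> lmeasurable"
      "emeasure lebesgue (T - N) < ennreal \<delta>" by blast
    have "T = (T - N) \<union> N" using T(2) by auto
    then have e: "emeasure lebesgue T = emeasure lebesgue (T - N)"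
      using emeasure_Un_null_set[OF _ N, of "T - N"] T(3) by auto
    have "T \<in> lmeasurable"
      using T e by (intro fmeasurableI) (auto simp: less_top[symmetric] fmeasurable_def)
    moreover have "measure lebesgue T < \<delta>"
      using T(4) e \<delta> \<open>T \<in> lmeasurable\<close> by (simp add: measure_def enn2real_less_iff)
         (metis enn2real_less_iff ennreal_less_top order.strict_trans)
    ultimately show thesis using that T by blast
  qed
  have "\<exists>d>0. \<forall>s\<in>{0..1}. \<bar>s - t\<bar> < d \<longrightarrow> norm (f s - f t - (s - t) *\<^sub>R g t) \<le> e / 2 * \<bar>s - t\<bar>" if "t \<in> {0..1} - N" for t
    using der[OF that] \<open>e > 0\<close> unfolding has_vector_derivative_within_epsilon by (metis half_gt_zero)
  then obtain d where d: "\<And>t. t \<in> {0..1} - N \<Longrightarrow> d t > 0"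
    "\<And>t s. t \<in> {0..1} - N \<Longrightarrow> s \<in> {0..1} \<Longrightarrow> \<bar>s - t\<bar> < d t \<Longrightarrow> norm (f s - f t - (s - t) *\<^sub>R g t) \<le> e / 2 * \<bar>s - t\<bar>"
    by metis
  \<comment> \<open>A gauge must be defined on the whole line, hence the third case for points outside the unit interval.\<close>
  define \<gamma> where "\<gamma> t = (if t \<in> N then U else if t \<in> {0..1} then ball t (d t) else ball t 1)" for t
  have g: "gauge \<gamma>" unfolding gauge_def \<gamma>_def using U(1,2) d(1) by auto
  have main: "norm ((\<Sum>(x, K)\<in>D. measure lborel K *\<^sub>R g x) - (f b - f a)) < e"
    if D: "D tagged_division_of {a..b}" and fine: "\<gamma> fine D" for D
  proof -
    define u where "u z = Inf (snd z)" for z :: "real \<times> real set"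
    define v where "v z = Sup (snd z)" for z :: "real \<times> real set"
    have fin: "finite D" using D by blast
    have K: "snd z = {u z..v z}" "u z \<le> fst z" "fst z \<le> v z" "a \<le> u z" "v z \<le> b" "u z \<le> v z" "measure lborel (snd z) = v z - u z"
      if z: "z \<in> D" for z
    proof -
      have z': "(fst z, snd z) \<in> D" using z by simp
      obtain x y where xy: "snd z = cbox x y" using tagged_division_ofD(4)[OF D z'] by blast
      have "fst z \<in> snd z" using tagged_division_ofD(2)[OF D z'] .
      then have le: "x \<le> fst z" "fst z \<le> y" by (auto simp: xy)
      then have uv: "u z = x" "v z = y" by (auto simp: u_def v_def xy)
      show s: "snd z = {u z..v z}" by (simp add: xy uv)
      show "u z \<le> fst z" "fst z \<le> v z" "u z \<le> v z" using le by (auto simp: uv)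
      have "snd z \<subseteq> {a..b}" using tagged_division_ofD(3)[OF D z'] .
      then show "a \<le> u z" "v z \<le> b" using le unfolding s uv by auto
      show "measure lborel (snd z) = v z - u z" using le by (simp add: s uv)
    qed
    have disj: "disjoint_family_on (\<lambda>z. {u z<..<v z}) D"
      unfolding disjoint_family_on_def
    proof (intro ballI impI)
      fix z w assume zw: "z \<in> D" "w \<in> D" "z \<noteq> w"
      then have "interior (snd z) \<inter> interior (snd w) = {}"
        using tagged_division_ofD(5)[OF D, of "fst z" "snd z" "fst w" "snd w"] by (auto simp: prod_eq_iff)
      then show "{u z<..<v z} \<inter> {u w<..<v w} = {}" using zw by (simp add: K(1) interior_atLeastAtMost_real)
    qed
    have tel: "(\<Sum>z\<in>D. f (v z) - f (u z)) = f b - f a" "(\<Sum>z\<in>D. v z - u z) = b - a"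
      using additive_tagged_division_1[OF ab(2) D, of f] additive_tagged_division_1[OF ab(2) D, of "\<lambda>x. x"]
      by (simp_all add: u_def v_def case_prod_unfold)
    define DN where "DN = {z\<in>D. fst z \<in> N}"
    have near: "(\<Sum>z\<in>DN. norm (f (v z) - f (u z))) < e / 2"
    proof (rule ac'[rule_format], intro conjI ballI)
      show "finite DN" using fin by (simp add: DN_def)
      show "0 \<le> u i" "u i \<le> v i" "v i \<le> 1" if "i \<in> DN" for i
        using K[of i] that ab by (auto simp: DN_def)
      show dj: "disjoint_family_on (\<lambda>i. {u i<..<v i}) DN"
        using disj by (rule disjoint_family_on_mono[rotated]) (auto simp: DN_def)
      have "(\<Sum>i\<in>DN. v i - u i) = (\<Sum>i\<in>DN. measure lebesgue {u i<..<v i})"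
        using K by (intro sum.cong) (auto simp: DN_def)
      also have "\<dots> = measure lebesgue (\<Union>i\<in>DN. {u i<..<v i})"
        using fin dj K(6) by (intro measure_finite_Union[symmetric]) (auto simp: DN_def)
      also have "\<dots> \<le> measure lebesgue U"
      proof (rule measure_mono_fmeasurable)
        show "(\<Union>i\<in>DN. {u i<..<v i}) \<subseteq> U"
        proof (rule UN_least)
          fix z assume z: "z \<in> DN"
          then have "snd z \<subseteq> \<gamma> (fst z)" using fineD[OF fine, of "fst z" "snd z"] by (simp add: DN_def)
          then have "{u z..v z} \<subseteq> U" using z K(1)[of z] by (auto simp: DN_def \<gamma>_def)
          then show "{u z<..<v z} \<subseteq> U" by (meson greaterThanLessThan_subseteq_atLeastAtMost_iff order_trans order_refl)
        qed
      qed (use U fin in \<open>auto simp: DN_def\<close>)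
      also note U(4)
      finally show "(\<Sum>i\<in>DN. v i - u i) < \<delta>" .
    qed
    have far: "norm (measure lborel (snd z) *\<^sub>R g (fst z) - (f (v z) - f (u z))) \<le> e / 2 * (v z - u z)" if z: "z \<in> D - DN" for z
    proof -
      define x where "x = fst z"
      have zD: "z \<in> D" and xN: "x \<notin> N" using z by (auto simp: DN_def x_def)
      note Kz = K[OF zD]
      have x: "x \<in> {0..1} - N" using Kz ab xN by (auto simp: x_def)
      have "snd z \<subseteq> \<gamma> x" using fineD[OF fine, of "fst z" "snd z"] zD by (simp add: x_def)
      then have "{u z..v z} \<subseteq> ball x (d x)" using x Kz(1) by (auto simp: \<gamma>_def)
      then have "u z \<in> ball x (d x)" "v z \<in> ball x (d x)" using Kz(6) by auto
      then have "\<bar>u z - x\<bar> < d x" "\<bar>v z - x\<bar> < d x" by (auto simp: dist_real_def)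
      moreover have "u z \<in> {0..1}" "v z \<in> {0..1}" using Kz ab by auto
      ultimately have n: "norm (f (u z) - f x - (u z - x) *\<^sub>R g x) \<le> e / 2 * \<bar>u z - x\<bar>"
        "norm (f (v z) - f x - (v z - x) *\<^sub>R g x) \<le> e / 2 * \<bar>v z - x\<bar>"
        using d(2)[OF x, of "u z"] d(2)[OF x, of "v z"] by blast+
      have eq: "(v z - u z) *\<^sub>R g x - (f (v z) - f (u z)) = (f (u z) - f x - (u z - x) *\<^sub>R g x) - (f (v z) - f x - (v z - x) *\<^sub>R g x)"
        by (simp add: algebra_simps)
      have "norm ((v z - u z) *\<^sub>R g x - (f (v z) - f (u z))) \<le> e / 2 * \<bar>u z - x\<bar> + e / 2 * \<bar>v z - x\<bar>"
        unfolding eq by (rule order_trans[OF norm_triangle_ineq4]) (intro add_mono n)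
      also have "\<bar>u z - x\<bar> = x - u z" using Kz(2) by (simp add: x_def)
      also have "\<bar>v z - x\<bar> = v z - x" using Kz(3) by (simp add: x_def)
      also have "e / 2 * (x - u z) + e / 2 * (v z - x) = e / 2 * (v z - u z)"
        unfolding distrib_left[symmetric] by simp
      finally show ?thesis by (simp add: Kz(7) x_def)
    qed
    have "(\<Sum>z\<in>DN. norm (measure lborel (snd z) *\<^sub>R g (fst z) - (f (v z) - f (u z)))) = (\<Sum>z\<in>DN. norm (f (v z) - f (u z)))"
      by (rule sum.cong) (auto simp: DN_def g0 norm_minus_commute)
    then have 1: "(\<Sum>z\<in>DN. norm (measure lborel (snd z) *\<^sub>R g (fst z) - (f (v z) - f (u z)))) < e / 2"
      using near by (rule ssubst)
    have 2: "(\<Sum>z\<in>D - DN. norm (measure lborel (snd z) *\<^sub>R g (fst z) - (f (v z) - f (u z)))) \<le> (\<Sum>z\<in>D - DN. e / 2 * (v z - u z))"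
      by (rule sum_mono) (rule far)
    have "(\<Sum>z\<in>D - DN. e / 2 * (v z - u z)) \<le> (\<Sum>z\<in>D. e / 2 * (v z - u z))"
      using fin K \<open>e > 0\<close> by (intro sum_mono2) (auto simp: DN_def)
    also have "\<dots> = e / 2 * (b - a)" unfolding tel(2)[symmetric] by (rule sum_distrib_left[symmetric])
    also have "\<dots> \<le> e / 2" using ab \<open>e > 0\<close> by simp
    finally have 3: "(\<Sum>z\<in>D - DN. e / 2 * (v z - u z)) \<le> e / 2" .
    have "(\<Sum>(x, K)\<in>D. measure lborel K *\<^sub>R g x) - (f b - f a) = (\<Sum>z\<in>D. measure lborel (snd z) *\<^sub>R g (fst z) - (f (v z) - f (u z)))"
      unfolding tel(1)[symmetric] by (simp add: sum_subtractf case_prod_unfold)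
    also have "norm \<dots> \<le> (\<Sum>z\<in>D. norm (measure lborel (snd z) *\<^sub>R g (fst z) - (f (v z) - f (u z))))" by (rule norm_sum)
    also have "\<dots> = (\<Sum>z\<in>D - DN. norm (measure lborel (snd z) *\<^sub>R g (fst z) - (f (v z) - f (u z)))) + (\<Sum>z\<in>DN. norm (measure lborel (snd z) *\<^sub>R g (fst z) - (f (v z) - f (u z))))"
      using fin by (intro sum.subset_diff) (auto simp: DN_def)
    also have "\<dots> < e" using 1 2 3 by linarith
    finally show ?thesis .
  qed
  show "\<exists>\<gamma>. gauge \<gamma> \<and> (\<forall>D. D tagged_division_of {a..b} \<and> \<gamma> fine D \<longrightarrow>
        norm ((\<Sum>(x, K)\<in>D. measure lborel K *\<^sub>R g x) - (f b - f a)) < e)"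
  proof (intro exI[of _ \<gamma>] conjI allI impI g)
    fix D assume "D tagged_division_of {a..b} \<and> \<gamma> fine D"
    then show "norm ((\<Sum>(x, K)\<in>D. measure lborel K *\<^sub>R g x) - (f b - f a)) < e"
      using main[of D] by blast
  qed
qed

text \<open>
  Over a cell with mean slope \<open>c\<close>, integrating \<open>2 (c \<bullet> f') \<le> \<bar>f'\<bar>\<^sup>2 + \<bar>c\<bar>\<^sup>2\<close> gives the Cauchy-Schwarz
  inequality from the fundamental theorem alone, without integrability of the product.
\<close>
lemma energy_le_derivative_integral:
  fixes f :: "real \<Rightarrow> 'a::euclidean_space"
  assumes ac: "absolutely_continuous_on 0 1 f"
    and diff: "AE t in lebesgue_on {0..1}. f differentiable (at t within {0..1})"
    and int: "integrable (lebesgue_on {0..1}) (\<lambda>t. (norm (vector_derivative f (at t within {0..1})))\<^sup>2)"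
  shows "dyadic_energy p f \<le> (LINT t|lebesgue_on {0..1}. (norm (vector_derivative f (at t within {0..1})))\<^sup>2)"
proof -
  define h where "h t = (norm (vector_derivative f (at t within {0..1})))\<^sup>2" for t
  define N where "N = {t\<in>{0..1}. \<not> f differentiable (at t within {0..1})}"
  define g where "g t = (if t \<in> N then 0 else vector_derivative f (at t within {0..1}))" for t
  have "AE t in lebesgue. t \<in> {0..1} \<longrightarrow> f differentiable (at t within {0..1})"
    using diff by (simp add: AE_restrict_space_iff)
  then have "negligible N"
    unfolding eventually_ae_filter_negligible by (auto simp: N_def intro: negligible_subset)
  have ftc: "(g has_integral (f b - f a)) {a..b}" if "0 \<le> a" "a \<le> b" "b \<le> 1" for a b
    using ac \<open>negligible N\<close> _ _ that
    by (rule absolutely_continuous_FTC) (auto simp: g_def N_def vector_derivative_works)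
  have hint: "(h has_integral (LINT t|lebesgue_on {0..1}. h t)) {0..1}"
    using int by (intro has_integral_integral_lebesgue_on) (auto simp: h_def[abs_def])
  have hi: "h integrable_on {a..b}" if "0 \<le> a" "b \<le> 1" for a b
    using integrable_on_subinterval[of h "{0..1}" a b] hint that by auto
  have CS: "(norm (f b - f a))\<^sup>2 / (b - a) \<le> integral {a..b} h" if ab: "0 \<le> a" "a < b" "b \<le> 1" for a b
  proof -
    \<comment> \<open>The mean slope is the vector for which the inequality below is sharpest.\<close>
    define c where "c = (f b - f a) /\<^sub>R (b - a)"
    have 1: "((\<lambda>t. 2 * (c \<bullet> g t)) has_integral 2 * (c \<bullet> (f b - f a))) {a..b}"
      using has_integral_mult_right[OF has_integral_linear[OF ftc bounded_linear_inner_right[of c]]] ab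
      by (simp add: o_def)
    have 2: "((\<lambda>t. h t + (norm c)\<^sup>2) has_integral (integral {a..b} h + (norm c)\<^sup>2 * (b - a))) {a..b}"
      using has_integral_add[OF integrable_integral[OF hi[of a b]] has_integral_const_real[of "(norm c)\<^sup>2" a b]] ab
      by (simp add: mult.commute)
    have "2 * (c \<bullet> (f b - f a)) \<le> integral {a..b} h + (norm c)\<^sup>2 * (b - a)"
    proof (rule has_integral_le[OF 1 2])
      fix t assume "t \<in> {a..b}"
      have "0 \<le> (norm (g t - c))\<^sup>2" by simp
      also have "\<dots> = (norm (g t))\<^sup>2 + (norm c)\<^sup>2 - 2 * (c \<bullet> g t)"
        by (simp add: power2_norm_eq_inner inner_diff inner_commute)
      finally have "2 * (c \<bullet> g t) \<le> (norm (g t))\<^sup>2 + (norm c)\<^sup>2" by simp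
      also have "(norm (g t))\<^sup>2 \<le> h t" by (simp add: g_def h_def)
      finally show "2 * (c \<bullet> g t) \<le> h t + (norm c)\<^sup>2" by simp
    qed
    moreover have "c \<bullet> (f b - f a) = (norm (f b - f a))\<^sup>2 / (b - a)"
      by (simp add: c_def power2_norm_eq_inner divide_inverse mult.commute)
    moreover have "norm c = norm (f b - f a) / (b - a)"
      using ab by (simp add: c_def divide_inverse mult.commute)
    then have "(norm c)\<^sup>2 * (b - a) = (norm (f b - f a))\<^sup>2 / (b - a)"
      using ab by (simp add: power_divide power2_eq_square)
    ultimately show ?thesis by linarith
  qed
  have sumint: "(\<Sum>i<m. integral {real i / 2 ^ p..(real i + 1) / 2 ^ p} h) = integral {0..real m / 2 ^ p} h" if "m \<le> 2 ^ p" for m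
    using that
  proof (induction m)
    case (Suc m)
    have "real (Suc m) \<le> 2 ^ p" using Suc.prems by (metis of_nat_le_iff of_nat_numeral of_nat_power)
    then have "h integrable_on {0..(real m + 1) / 2 ^ p}" by (intro hi) (auto simp: divide_le_eq)
    then have "integral {0..real m / 2 ^ p} h + integral {real m / 2 ^ p..(real m + 1) / 2 ^ p} h = integral {0..(real m + 1) / 2 ^ p} h"
      by (intro Henstock_Kurzweil_Integration.integral_combine) (auto simp: divide_right_mono)
    then show ?case using Suc by (simp add: add.commute)
  qed simp
  have "dyadic_energy p f = (\<Sum>i<2 ^ p. (norm (f ((real i + 1) / 2 ^ p) - f (real i / 2 ^ p)))\<^sup>2 / ((real i + 1) / 2 ^ p - real i / 2 ^ p))"
    unfolding dyadic_energy_def sum_distrib_left dyadic_incr_def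
    by (intro sum.cong) (auto simp: diff_divide_distrib[symmetric])
  also have "\<dots> \<le> (\<Sum>i<2 ^ p. integral {real i / 2 ^ p..(real i + 1) / 2 ^ p} h)"
  proof (intro sum_mono CS)
    fix i :: nat assume "i \<in> {..<2 ^ p}"
    then have "Suc i \<le> 2 ^ p" by simp
    then have "real (Suc i) \<le> 2 ^ p" by (metis of_nat_le_iff of_nat_numeral of_nat_power)
    then show "(real i + 1) / 2 ^ p \<le> 1" by simp
  qed (auto simp: divide_strict_right_mono)
  also have "\<dots> = integral {0..1} h" using sumint[of "2 ^ p"] by simp
  also have "\<dots> = (LINT t|lebesgue_on {0..1}. h t)" using hint by (rule integral_unique)
  finally show ?thesis by (simp add: h_def)
qed

text \<open>
  The form in which the action is used from here on: its level sets are defined by countably many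
  conditions, each on finitely many values of the path.
\<close>
lemma action_le_iff:
  assumes \<phi>: "\<phi> \<in> mspace (C0 :: (real \<Rightarrow> real ^ 'd) metric)"
  shows "action \<phi> \<le> ereal a \<longleftrightarrow> (\<forall>p. dyadic_energy p \<phi> \<le> 2 * a)"
proof
  assume "action \<phi> \<le> ereal a"
  then have H1: "\<phi> \<in> H1" and a: "(LINT t|lebesgue_on {0..1}. (norm (path_deriv \<phi> t))\<^sup>2) \<le> 2 * a"
    by (auto simp: action_def split: if_splits)
  then show "\<forall>p. dyadic_energy p \<phi> \<le> 2 * a"
    unfolding H1_def path_deriv_def by (auto intro: order_trans[OF energy_le_derivative_integral])
next
  assume c: "\<forall>p. dyadic_energy p \<phi> \<le> 2 * a"
  have cont: "continuous_on {0..1} \<phi>" using \<phi> by (simp add: mspace_C0)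
  have i: "integrable (lebesgue_on {0..1}) (\<lambda>t. (norm (path_deriv \<phi> t))\<^sup>2)"
    and a: "(LINT t|lebesgue_on {0..1}. (norm (path_deriv \<phi> t))\<^sup>2) \<le> 2 * a"
    unfolding path_deriv_def using energy_derivative_integral[OF cont] c by blast+
  have "negligible {t\<in>{0..1}. \<not> \<phi> differentiable (at t within {0..1})}"
    by (rule energy_differentiable_AE[OF cont]) (use c in blast)
  then have "AE t in lebesgue. t \<in> {0..1} \<longrightarrow> \<phi> differentiable (at t within {0..1})"
    unfolding eventually_ae_filter_negligible by (intro exI conjI) auto
  then have "\<phi> \<in> H1"
    unfolding H1_def using \<phi> i energy_absolutely_continuous[OF cont] c by (auto simp: AE_restrict_space_iff)
  then show "action \<phi> \<le> ereal a" using a by (simp add: action_def)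
qed

section \<open>Compactness of the level sets of the action\<close>
lemma dyadic_in_unit:
  assumes "i \<le> 2 ^ p" shows "real i / 2 ^ p \<in> {0..1}"
proof -
  have "real i \<le> 2 ^ p" using assms by (metis of_nat_le_iff of_nat_numeral of_nat_power)
  then show ?thesis by simp
qed

lemma dyadic_incr_cong:
  assumes "\<And>t. t \<in> {0..1} \<Longrightarrow> f t = g t" "i < 2 ^ p"
  shows "dyadic_incr p f i = dyadic_incr p g i"
  unfolding dyadic_incr_def
  using assms dyadic_in_unit[of i p] dyadic_in_unit[of "Suc i" p] by (simp add: add.commute)

lemma dyadic_energy_cong:
  assumes "\<And>t. t \<in> {0..1} \<Longrightarrow> f t = g t"
  shows "dyadic_energy p f = dyadic_energy p g"
  unfolding dyadic_energy_def using dyadic_incr_cong[OF assms] by (intro arg_cong2[where f="(*)"] sum.cong refl) auto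

lemma dyadic_energy_tendsto:
  assumes "\<And>t. t \<in> {0..1} \<Longrightarrow> (\<lambda>n. f n t) \<longlonglongrightarrow> g t"
  shows "(\<lambda>n. dyadic_energy p (f n)) \<longlonglongrightarrow> dyadic_energy p g"
  unfolding dyadic_energy_def dyadic_incr_def
proof (intro tendsto_intros assms)
  fix i :: nat assume "i \<in> {..<2 ^ p}"
  then show "(real i + 1) / 2 ^ p \<in> {0..1}" "real i / 2 ^ p \<in> {0..1}"
    using dyadic_in_unit[of i p] dyadic_in_unit[of "Suc i" p] by (simp_all add: add.commute)
qed

lemma mdist_C0_le:
  assumes "\<phi> \<in> mspace C0" "\<psi> \<in> mspace C0" "\<And>t. t \<in> {0..1} \<Longrightarrow> norm (\<phi> t - \<psi> t) \<le> r"
  shows "mdist C0 \<phi> \<psi> \<le> r"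
  unfolding mdist_C0[OF assms(1,2)] using assms(3) by (intro cSUP_least) auto

text \<open>
  The energy bound is a common Hoelder modulus of exponent one half, so the Arzela-Ascoli theorem
  yields uniform limits; the bound passes to them because each dyadic energy depends continuously on
  finitely many values.
\<close>
lemma compactin_action_level:
  "compactin (mtopology_of C0) {\<phi> \<in> mspace (C0 :: (real \<Rightarrow> real ^ 'd) metric). action \<phi> \<le> ereal a}"
    (is "compactin _ ?K")
proof -
  interpret Metric_space "mspace (C0 :: (real \<Rightarrow> real ^ 'd) metric)" "mdist C0" by (rule Metric_space_mspace_mdist)
  have "\<exists>l r. l \<in> ?K \<and> strict_mono r \<and> limitin mtopology (\<sigma> \<circ> r) l sequentially" if \<sigma>: "range \<sigma> \<subseteq> ?K" for \<sigma> :: "nat \<Rightarrow> real \<Rightarrow> real ^ 'd"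
  proof -
    have \<sigma>C: "\<sigma> n \<in> mspace C0" and E: "dyadic_energy p (\<sigma> n) \<le> 2 * a" for n p
      using \<sigma> action_le_iff[of "\<sigma> n" a] by auto
    then have cont: "continuous_on {0..1} (\<sigma> n)" and \<sigma>0: "\<sigma> n 0 = 0" for n by (auto simp: mspace_C0)
    have a: "0 \<le> 2 * a" using E[of 0 0] dyadic_energy_nonneg[of 0 "\<sigma> 0"] by linarith
    have H: "(norm (\<sigma> n t - \<sigma> n s))\<^sup>2 \<le> 2 * a * \<bar>t - s\<bar>" if "s \<in> {0..1}" "t \<in> {0..1}" for n s t
      using energy_Holder[OF cont E that] .
    obtain g k where g: "continuous_on {0..1} g" "strict_mono (k :: nat \<Rightarrow> nat)"
      and lim: "\<And>e. 0 < e \<Longrightarrow> \<exists>N. \<forall>n x. n \<ge> N \<and> x \<in> {0..1} \<longrightarrow> norm (\<sigma> (k n) x - g x) < e"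
    proof (rule Arzela_Ascoli[of "{0..1::real}" \<sigma> "sqrt (2 * a)"])
      show "norm (\<sigma> n x) \<le> sqrt (2 * a)" if "x \<in> {0..1}" for n x
      proof (rule real_le_rsqrt)
        have "(norm (\<sigma> n x))\<^sup>2 \<le> 2 * a * x" using H[of 0 x n] that \<sigma>0 by simp
        also have "\<dots> \<le> 2 * a" using a that by (simp add: mult_left_le)
        finally show "(norm (\<sigma> n x))\<^sup>2 \<le> 2 * a" .
      qed
      show "\<exists>d>0. \<forall>n y. y \<in> {0..1} \<and> norm (x - y) < d \<longrightarrow> norm (\<sigma> n x - \<sigma> n y) < e" if "x \<in> {0..1}" "0 < e" for x e
      proof (intro exI[of _ "e\<^sup>2 / (2 * a + 1)"] conjI allI impI)
        fix n y assume y: "y \<in> {0..1} \<and> norm (x - y) < e\<^sup>2 / (2 * a + 1)"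
        have "(norm (\<sigma> n x - \<sigma> n y))\<^sup>2 \<le> 2 * a * \<bar>x - y\<bar>" using H[of y x n] y that by simp
        also have "\<dots> \<le> (2 * a + 1) * \<bar>x - y\<bar>" by (intro mult_right_mono) auto
        also have "\<dots> < e\<^sup>2" using y a by (simp add: pos_less_divide_eq mult.commute)
        finally show "norm (\<sigma> n x - \<sigma> n y) < e" using that by (simp add: power2_less_imp_less)
      qed (use that a in auto)
    qed auto
    \<comment> \<open>Elements of the path space are undefined outside the unit interval by convention.\<close>
    define l where "l = restrict g {0..1}"
    have lim': "(\<lambda>n. \<sigma> (k n) t) \<longlonglongrightarrow> l t" if "t \<in> {0..1}" for t
      using lim that by (intro LIMSEQ_I) (fastforce simp: l_def)
    have "l 0 = 0" using LIMSEQ_unique[OF lim'[of 0]] by (simp add: \<sigma>0)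
    moreover have "continuous_on {0..1} l" using g(1) by (subst continuous_on_cong[of _ "{0..1}" _ g]) (auto simp: l_def)
    ultimately have lC: "l \<in> mspace C0" by (simp add: mspace_C0 l_def)
    have "dyadic_energy p l \<le> 2 * a" for p
      by (rule LIMSEQ_le_const2[OF dyadic_energy_tendsto[OF lim']]) (auto simp: E)
    then have lK: "l \<in> ?K" using lC action_le_iff by auto
    have "limitin mtopology (\<sigma> \<circ> k) l sequentially"
      unfolding limit_metric_sequentially
    proof (intro conjI allI impI lC)
      fix e :: real assume "e > 0"
      then obtain N where N: "\<And>n x. n \<ge> N \<Longrightarrow> x \<in> {0..1} \<Longrightarrow> norm (\<sigma> (k n) x - g x) < e / 2"
        using lim[of "e / 2"] by auto
      have "mdist C0 (\<sigma> (k n)) l \<le> e / 2" if "n \<ge> N" for n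
        using N[OF that] by (intro mdist_C0_le[OF \<sigma>C lC]) (simp add: l_def less_imp_le)
      then show "\<exists>N. \<forall>n\<ge>N. (\<sigma> \<circ> k) n \<in> mspace C0 \<and> mdist C0 ((\<sigma> \<circ> k) n) l < e"
        using \<sigma>C \<open>e > 0\<close> by (intro exI[of _ N]) (force simp: o_def)
    qed
    then show ?thesis using lK g(2) by blast
  qed
  then show ?thesis unfolding mtopology_of_def compactin_sequentially by blast
qed

lemma action_nonneg: "0 \<le> action \<phi>"
  by (auto simp: action_def intro!: integral_nonneg_AE)

lemma good_rate_function_action:
  "good_rate_function (mtopology_of C0) (action :: (real \<Rightarrow> real ^ 'd) \<Rightarrow> ereal)"
proof -
  have "Hausdorff_space (mtopology_of (C0 :: (real \<Rightarrow> real ^ 'd) metric))"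
    unfolding mtopology_of_def by (rule Metric_space.Hausdorff_space_mtopology) (rule Metric_space_mspace_mdist)
  then show ?thesis
    unfolding good_rate_function_def rate_function_def
    using compactin_imp_closedin compactin_action_level action_nonneg by auto
qed

lemma (in Metric_space) compactin_closedin_separated:
  assumes K: "compactin mtopology K" and F: "closedin mtopology F" and disj: "K \<inter> F = {}"
  obtains \<delta> where "\<delta> > 0" "\<And>x y. x \<in> K \<Longrightarrow> y \<in> F \<Longrightarrow> \<delta> \<le> d x y"
proof (rule ccontr)
  assume "\<not> thesis"
  then have "\<exists>x\<in>K. \<exists>y\<in>F. d x y < inverse (real (Suc n))" for n
    using that[of "inverse (real (Suc n))"] by (force simp: not_less)
  then obtain x y where xy: "\<And>n. x n \<in> K" "\<And>n. y n \<in> F" "\<And>n. d (x n) (y n) < inverse (real (Suc n))"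
    by metis
  have KM: "K \<subseteq> M" "F \<subseteq> M" using K F compactin_subset_topspace closedin_subset by fastforce+
  obtain l r where l: "l \<in> K" "strict_mono r" "limitin mtopology (x \<circ> r) l sequentially"
    using K xy(1) unfolding compactin_sequentially by (metis image_subsetI)
  have "limitin mtopology (y \<circ> r) l sequentially"
    unfolding limit_metric_sequentially
  proof (intro conjI allI impI)
    show "l \<in> M" using l KM by blast
    fix e :: real assume "e > 0"
    have "\<exists>N. \<forall>n\<ge>N. (x \<circ> r) n \<in> M \<and> d ((x \<circ> r) n) l < e / 2"
      using l(3) half_gt_zero[OF \<open>e > 0\<close>] unfolding limit_metric_sequentially by blast
    then obtain N1 where N1: "\<And>n. n \<ge> N1 \<Longrightarrow> d (x (r n)) l < e / 2"
      unfolding o_def by blast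
    obtain N2 where N2: "inverse (real (Suc N2)) < e / 2" using reals_Archimedean[of "e / 2"] \<open>e > 0\<close> by auto
    have "y (r n) \<in> M \<and> d (y (r n)) l < e" if n: "n \<ge> max N1 N2" for n
    proof -
      have "N2 \<le> r n" using n seq_suble[OF l(2), of n] by linarith
      then have "inverse (real (Suc (r n))) \<le> inverse (real (Suc N2))" by (intro le_imp_inverse_le) auto
      then have "d (x (r n)) (y (r n)) < e / 2" using xy(3)[of "r n"] N2 by linarith
      moreover have "d (y (r n)) l \<le> d (y (r n)) (x (r n)) + d (x (r n)) l"
        using xy KM l by (intro triangle) auto
      ultimately show ?thesis using N1[of n] n xy KM commute[of "y (r n)" "x (r n)"] by auto
    qed
    then show "\<exists>N. \<forall>n\<ge>N. (y \<circ> r) n \<in> M \<and> d ((y \<circ> r) n) l < e"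
      unfolding o_def by blast
  qed
  then have "l \<in> F"
    using F xy(2) unfolding metric_closedin_iff_sequentially_closed by (metis comp_apply image_subsetI)
  then show False using l disj by blast
qed

section \<open>Chaining\<close>
text \<open>
  The ratio \<open>7/8\<close> lies between \<open>sqrt (1/2)\<close> and \<open>1\<close>. Being below \<open>1\<close> makes the bounds summable; being
  above \<open>sqrt (1/2)\<close>, the decay of the standard deviation of Brownian increments, makes violations at
  finer levels ever less likely.
\<close>
definition chained :: "nat \<Rightarrow> real \<Rightarrow> (real \<Rightarrow> 'a::real_normed_vector) \<Rightarrow> bool" where
  "chained m \<eta> f \<longleftrightarrow> (\<forall>p\<ge>m. \<forall>i<2 ^ p. norm (dyadic_incr p f i) \<le> \<eta> * (7 / 8) ^ (p - m))"

lemma dyadic_floor_Suc: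
  assumes "0 \<le> t"
  shows "dyadic_floor (Suc p) t = 2 * dyadic_floor p t \<or> dyadic_floor (Suc p) t = 2 * dyadic_floor p t + 1"
proof -
  define l where "l = dyadic_floor p t"
  have b: "real l / 2 ^ p \<le> t" "t < (real l + 1) / 2 ^ p"
    using dyadic_floor_bounds[OF assms, of p] by (simp_all add: l_def)
  define c where "c = (real l + 1 / 2) / 2 ^ p"
  have eq: "real (2 * l) / 2 ^ Suc p = real l / 2 ^ p" "(real (2 * l) + 1) / 2 ^ Suc p = c"
    "real (2 * l + 1) / 2 ^ Suc p = c" "(real (2 * l + 1) + 1) / 2 ^ Suc p = (real l + 1) / 2 ^ p"
    by (simp_all add: c_def field_simps)
  show ?thesis
  proof (cases "t < c")
    case True
    then have "dyadic_floor (Suc p) t = 2 * l"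
      using dyadic_cell_iff[of "2 * l" "Suc p" t] b unfolding eq by blast
    then show ?thesis by (simp add: l_def)
  next
    case False
    then have "dyadic_floor (Suc p) t = 2 * l + 1"
      using dyadic_cell_iff[of "2 * l + 1" "Suc p" t] b unfolding eq by auto
    then show ?thesis by (simp add: l_def)
  qed
qed

text \<open>
  Passing from one level to the next moves the grid point below \<open>t\<close> by at most one step, and the
  steps sum to \<open>\<eta> (7/8 + (7/8)\<^sup>2 + \<dots>) = 7 \<eta>\<close>.
\<close>
lemma chained_norm_diff_le:
  fixes f :: "real \<Rightarrow> 'a::real_normed_vector"
  assumes cont: "continuous_on {0..1} f" and ch: "chained m \<eta> f" and t: "t \<in> {0..1}"
  shows "norm (f t - f (real (dyadic_floor m t) / 2 ^ m)) \<le> 7 * \<eta>"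
proof -
  define s where "s p = real (dyadic_floor p t) / 2 ^ p" for p
  have "norm (dyadic_incr m f 0) \<le> \<eta> * (7 / 8) ^ (m - m)"
    using ch unfolding chained_def by (metis order_refl zero_less_numeral zero_less_power)
  then have eta: "\<eta> \<ge> 0" by (intro order_trans[OF norm_ge_zero]) simp
  have step: "norm (f (s (Suc p)) - f (s p)) \<le> \<eta> * (7 / 8) ^ (Suc p - m)" if "p \<ge> m" for p
  proof -
    consider "dyadic_floor (Suc p) t = 2 * dyadic_floor p t" | "dyadic_floor (Suc p) t = 2 * dyadic_floor p t + 1"
      using dyadic_floor_Suc[of t p] t by auto
    then show ?thesis
    proof cases
      case 1
      then have "s (Suc p) = s p" by (simp add: s_def)
      then show ?thesis using eta by simp
    next
      case 2
      have "2 * dyadic_floor p t + 1 \<le> 2 ^ Suc p" using dyadic_floor_le[of t "Suc p"] t 2 by simp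
      then have "norm (dyadic_incr (Suc p) f (2 * dyadic_floor p t)) \<le> \<eta> * (7 / 8) ^ (Suc p - m)"
        using ch that unfolding chained_def by auto
      moreover have "dyadic_incr (Suc p) f (2 * dyadic_floor p t) = f (s (Suc p)) - f (s p)"
        by (simp add: dyadic_incr_def s_def 2 add.commute)
      ultimately show ?thesis by simp
    qed
  qed
  have "norm (f (s p) - f (s m)) \<le> 7 * \<eta> * (1 - (7 / 8) ^ (p - m))" if "p \<ge> m" for p
    using that
  proof (induction rule: dec_induct)
    case (step p)
    have "norm (f (s (Suc p)) - f (s m)) \<le> norm (f (s (Suc p)) - f (s p)) + norm (f (s p) - f (s m))"
      using norm_triangle_ineq[of "f (s (Suc p)) - f (s p)" "f (s p) - f (s m)"] by simp
    also have "\<dots> \<le> \<eta> * (7 / 8) ^ (Suc p - m) + 7 * \<eta> * (1 - (7 / 8) ^ (p - m))"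
      using step \<open>\<And>p. p \<ge> m \<Longrightarrow> norm (f (s (Suc p)) - f (s p)) \<le> \<eta> * (7 / 8) ^ (Suc p - m)\<close> by (intro add_mono) auto
    also have "\<dots> = 7 * \<eta> * (1 - (7 / 8) ^ (Suc p - m))"
      using step by (simp add: Suc_diff_le algebra_simps)
    finally show ?case .
  qed simp
  moreover have "7 * \<eta> * (1 - (7 / 8) ^ (p - m)) \<le> 7 * \<eta>" for p
    using eta by (intro mult_left_le) auto
  ultimately have "norm (f (s p) - f (s m)) \<le> 7 * \<eta>" if "p \<ge> m" for p
    using that by (meson order.trans)
  moreover have "(\<lambda>p. norm (f (s p) - f (s m))) \<longlonglongrightarrow> norm (f t - f (s m))"
    unfolding s_def by (intro tendsto_intros tendsto_dyadic_floor[OF cont t])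
  ultimately show ?thesis unfolding s_def[symmetric] by (intro LIMSEQ_le_const2) blast+
qed

lemma polygon_near_grid_value:
  fixes f :: "real \<Rightarrow> 'a::real_normed_vector"
  assumes t: "t \<in> {0..1}" and b: "\<And>i. i < 2 ^ m \<Longrightarrow> norm (dyadic_incr m f i) \<le> \<eta>" and eta: "0 \<le> \<eta>"
  shows "norm (polygon m f t - f (real (dyadic_floor m t) / 2 ^ m)) \<le> \<eta>"
proof (cases "t = 1")
  case True
  then show ?thesis using polygon_grid[of "2 ^ m" m f] eta by simp
next
  case False
  define l where "l = dyadic_floor m t"
  have l: "l < 2 ^ m" using t False by (simp add: l_def dyadic_floor_less)
  have bd: "real l / 2 ^ m \<le> t" "t < (real l + 1) / 2 ^ m"
    using dyadic_floor_bounds[of t m] t by (simp_all add: l_def)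
  then have "\<bar>2 ^ m * t - real l\<bar> \<le> 1" by (simp add: field_simps)
  then have "\<bar>2 ^ m * t - real l\<bar> * norm (dyadic_incr m f l) \<le> 1 * \<eta>"
    using b[OF l] by (intro mult_mono) auto
  moreover have "polygon m f t - f (real l / 2 ^ m) = (2 ^ m * t - real l) *\<^sub>R dyadic_incr m f l"
    using polygon_on_cell[OF l bd(1) less_imp_le[OF bd(2)], of f] by simp
  ultimately show ?thesis by (simp add: l_def[symmetric])
qed

lemma polygon_in_C0:
  fixes f :: "real \<Rightarrow> real ^ 'd"
  assumes "f 0 = 0"
  shows "restrict (polygon m f) {0..1} \<in> mspace C0"
    and "action (restrict (polygon m f) {0..1}) \<le> ereal (dyadic_energy m f / 2)"
proof -
  have "continuous_on {0..1} (restrict (polygon m f) {0..1})"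
    using continuous_on_polygon[of "{0..1}" m f] by (subst continuous_on_cong[of _ "{0..1}" _ "polygon m f"]) auto
  then show C: "restrict (polygon m f) {0..1} \<in> mspace C0"
    using assms by (auto simp: mspace_C0)
  have "dyadic_energy p (restrict (polygon m f) {0..1}) \<le> dyadic_energy m f" for p
    using dyadic_energy_cong[of "restrict (polygon m f) {0..1}" "polygon m f" p] dyadic_energy_polygon_le[of p m f] by simp
  then show "action (restrict (polygon m f) {0..1}) \<le> ereal (dyadic_energy m f / 2)"
    unfolding action_le_iff[OF C] by simp
qed

lemma chained_near_its_polygon:
  fixes f :: "real \<Rightarrow> real ^ 'd"
  assumes f: "f \<in> mspace C0" and ch: "chained m \<eta> f"
  shows "mdist C0 (restrict (polygon m f) {0..1}) f \<le> 8 * \<eta>"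
proof (rule mdist_C0_le)
  have f0: "f 0 = 0" and cont: "continuous_on {0..1} f" using f by (auto simp: mspace_C0)
  show "restrict (polygon m f) {0..1} \<in> mspace C0" using f0 by (rule polygon_in_C0)
  show "f \<in> mspace C0" by (rule f)
  fix t :: real assume t: "t \<in> {0..1}"
  have b: "norm (dyadic_incr m f i) \<le> \<eta>" if "i < 2 ^ m" for i
    using ch that unfolding chained_def by fastforce
  have "0 \<le> \<eta>" using order_trans[OF norm_ge_zero b[of 0]] by simp
  have "norm (polygon m f t - f t) = norm ((polygon m f t - f (real (dyadic_floor m t) / 2 ^ m)) - (f t - f (real (dyadic_floor m t) / 2 ^ m)))"
    by simp
  also have "\<dots> \<le> \<eta> + 7 * \<eta>"
    by (rule order_trans[OF norm_triangle_ineq4 add_mono[OF polygon_near_grid_value[OF t b \<open>0 \<le> \<eta>\<close>] chained_norm_diff_le[OF cont ch t]]])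
  finally show "norm (restrict (polygon m f) {0..1} t - f t) \<le> 8 * \<eta>" using t by simp
qed

text \<open>
  This is the deterministic core of the upper bound. If the path had energy at most \<open>2 a\<close>, its polygon
  would lie in the compact level set, which has positive distance from \<open>F\<close>; but a chained path is
  within \<open>8 \<eta>\<close> of its polygon.
\<close>
lemma closed_set_separation:
  fixes F :: "(real \<Rightarrow> real ^ 'd) set"
  assumes F: "closedin (mtopology_of C0) F" and a: "\<And>\<phi>. \<phi> \<in> F \<Longrightarrow> ereal a < action \<phi>"
  shows "\<exists>\<delta>>0. \<forall>f\<in>F. \<forall>m \<eta>. chained m \<eta> f \<and> 8 * \<eta> < \<delta> \<longrightarrow> 2 * a < dyadic_energy m f"
proof -
  let ?K = "{\<phi> \<in> mspace (C0 :: (real \<Rightarrow> real ^ 'd) metric). action \<phi> \<le> ereal a}"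
  interpret Metric_space "mspace (C0 :: (real \<Rightarrow> real ^ 'd) metric)" "mdist C0" by (rule Metric_space_mspace_mdist)
  have disj: "?K \<inter> F = {}" using a by (auto simp: not_le[symmetric])
  have KF: "compactin mtopology ?K" "closedin mtopology F"
    using compactin_action_level[of a, where 'd='d] F unfolding mtopology_of_def by auto
  obtain \<delta> where \<delta>: "\<delta> > 0" "\<And>x y. x \<in> ?K \<Longrightarrow> y \<in> F \<Longrightarrow> \<delta> \<le> mdist C0 x y"
    using compactin_closedin_separated[OF KF disj] by blast
  show ?thesis
  proof (intro exI[of _ \<delta>] conjI ballI allI impI \<delta>(1))
    fix f m \<eta> assume "f \<in> F" "chained m \<eta> f \<and> 8 * \<eta> < \<delta>"
    then have f: "f \<in> F" "chained m \<eta> f" "8 * \<eta> < \<delta>" by auto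
    have fC: "f \<in> mspace C0" using closedin_subset[OF F] f by auto
    then have f0: "f 0 = 0" by (simp add: mspace_C0)
    show "2 * a < dyadic_energy m f"
    proof (rule ccontr)
      assume "\<not> 2 * a < dyadic_energy m f"
      then have "ereal (dyadic_energy m f / 2) \<le> ereal a" by simp
      then have "restrict (polygon m f) {0..1} \<in> ?K"
        using polygon_in_C0(1)[of f m, OF f0] order_trans[OF polygon_in_C0(2)[of f m, OF f0]] by blast
      from \<delta>(2)[OF this f(1)] chained_near_its_polygon[OF fC f(2)] f(3) show False by linarith
    qed
  qed
qed

text \<open>
  This is the deterministic core of the lower bound. The distance is split at the grid point below
  \<open>t\<close>: chaining controls \<open>f\<close> there, the Hoelder modulus controls \<open>\<psi>\<close>, and the at most \<open>2 ^ m\<close> increments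
  up to that point contribute \<open>\<eta> / 2 ^ m\<close> each.
\<close>
lemma chained_in_tube_near:
  fixes f \<psi> :: "real \<Rightarrow> real ^ 'd"
  assumes f: "f \<in> mspace C0" and \<psi>: "\<psi> \<in> mspace C0" and ch: "chained m \<eta> f"
    and E: "\<And>p. dyadic_energy p \<psi> \<le> c" and c: "c / 2 ^ m \<le> \<eta>\<^sup>2"
    and near: "\<And>i. i < 2 ^ m \<Longrightarrow> norm (dyadic_incr m f i - dyadic_incr m \<psi> i) \<le> \<eta> / 2 ^ m"
  shows "mdist C0 \<psi> f \<le> 9 * \<eta>"
proof (rule mdist_C0_le[OF \<psi> f])
  have f0: "f 0 = 0" and cont: "continuous_on {0..1} f" using f by (auto simp: mspace_C0)
  have \<psi>0: "\<psi> 0 = 0" and cont': "continuous_on {0..1} \<psi>" using \<psi> by (auto simp: mspace_C0)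
  have eta: "\<eta> \<ge> 0" 
  proof -
    have "0 \<le> \<eta> / 2 ^ m" by (rule order_trans[OF norm_ge_zero near[of 0]]) simp
    from mult_right_mono[OF this, of "2 ^ m"] show ?thesis by simp
  qed
  fix t :: real assume t: "t \<in> {0..1}"
  define l where "l = dyadic_floor m t"
  define s where "s = real l / 2 ^ m"
  have l: "l \<le> 2 ^ m" using t by (simp add: l_def dyadic_floor_le)
  have s: "s \<in> {0..1}" unfolding s_def l_def by (rule dyadic_floor_in_unit[OF t])
  have st: "\<bar>t - s\<bar> \<le> 1 / 2 ^ m"
    using dyadic_floor_bounds[of t m] t by (simp add: s_def l_def add_divide_distrib)
  have 1: "norm (f t - f s) \<le> 7 * \<eta>"
    unfolding s_def l_def by (rule chained_norm_diff_le[OF cont ch t])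
  have "c \<ge> 0" using E[of 0] dyadic_energy_nonneg[of 0 \<psi>] by linarith
  have "(norm (\<psi> t - \<psi> s))\<^sup>2 \<le> c * \<bar>t - s\<bar>" by (rule energy_Holder[OF cont' E s t])
  also have "\<dots> \<le> c * (1 / 2 ^ m)" using st \<open>c \<ge> 0\<close> by (intro mult_left_mono) auto
  also have "\<dots> \<le> \<eta>\<^sup>2" using c by simp
  finally have 2: "norm (\<psi> t - \<psi> s) \<le> \<eta>" using eta by (rule power2_le_imp_le)
  have "f s - \<psi> s = (\<Sum>i\<in>{0..<l}. dyadic_incr m f i - dyadic_incr m \<psi> i)"
    using sum_dyadic_incr[of 0 l m f] sum_dyadic_incr[of 0 l m \<psi>] by (simp add: sum_subtractf s_def f0 \<psi>0)
  also have "norm \<dots> \<le> (\<Sum>i\<in>{0..<l}. \<eta> / 2 ^ m)"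
    using l by (intro sum_norm_le near) auto
  also have "\<dots> = \<eta> * s" by (simp add: s_def)
  also have "\<dots> \<le> \<eta>" using s eta by (simp add: mult_left_le)
  finally have 3: "norm (f s - \<psi> s) \<le> \<eta>" .
  have eq: "\<psi> t - f t = ((\<psi> t - \<psi> s) - (f s - \<psi> s)) - (f t - f s)" by simp
  have "norm (\<psi> t - f t) \<le> norm ((\<psi> t - \<psi> s) - (f s - \<psi> s)) + norm (f t - f s)"
    by (subst eq) (rule norm_triangle_ineq4)
  also have "\<dots> \<le> (norm (\<psi> t - \<psi> s) + norm (f s - \<psi> s)) + norm (f t - f s)"
    by (intro add_right_mono norm_triangle_ineq4)
  finally show "norm (\<psi> t - f t) \<le> 9 * \<eta>" using 1 2 3 by linarith
qed

text \<open>
  Density with control of the action: near a path in a level set there is an element of \<open>D\<close> in the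
  same level set. Finite nets of the compact level sets, for rational levels and radii \<open>1/(n+1)\<close>, provide it.
\<close>
lemma countable_action_dense:
  obtains D :: "(real \<Rightarrow> real ^ 'd) set" where "countable D" "D \<subseteq> mspace C0"
    "\<And>\<phi> a r. \<phi> \<in> mspace C0 \<Longrightarrow> a \<in> \<rat> \<Longrightarrow> action \<phi> \<le> ereal a \<Longrightarrow> r > 0 \<Longrightarrow>
       \<exists>\<psi>\<in>D. action \<psi> \<le> ereal a \<and> mdist C0 \<psi> \<phi> < r"
proof -
  interpret Metric_space "mspace (C0 :: (real \<Rightarrow> real ^ 'd) metric)" "mdist C0" by (rule Metric_space_mspace_mdist)
  define K where "K a = {\<phi> \<in> mspace (C0 :: (real \<Rightarrow> real ^ 'd) metric). action \<phi> \<le> ereal a}" for a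
  have "mtotally_bounded (K a)" for a
    using compactin_action_level[of a, where 'd='d] compactin_imp_mtotally_bounded unfolding mtopology_of_def K_def by blast
  then have "\<exists>S. finite S \<and> S \<subseteq> K a \<and> K a \<subseteq> (\<Union>x\<in>S. mball x (inverse (real (Suc n))))" for a n
    unfolding mtotally_bounded_def by simp
  then obtain S where S: "\<And>a n. finite (S a n)" "\<And>a n. S a n \<subseteq> K a" "\<And>a n. K a \<subseteq> (\<Union>x\<in>S a n. mball x (inverse (real (Suc n))))"
    by metis
  show thesis
  proof
    show "countable (\<Union>a\<in>\<rat>. \<Union>n. S a n)"
      using S(1) by (intro countable_UN countable_rat) (auto intro: countable_finite)
    show "(\<Union>a\<in>\<rat>. \<Union>n. S a n) \<subseteq> mspace C0" using S(2) by (fastforce simp: K_def)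
    fix \<phi> :: "real \<Rightarrow> real ^ 'd" and a r :: real
    assume h: "\<phi> \<in> mspace C0" "a \<in> \<rat>" "action \<phi> \<le> ereal a" "r > 0"
    obtain n where n: "inverse (real (Suc n)) < r" using reals_Archimedean h by blast
    have "\<phi> \<in> K a" using h by (simp add: K_def)
    then obtain \<psi> where "\<psi> \<in> S a n" "\<phi> \<in> mball \<psi> (inverse (real (Suc n)))" using S(3)[of a n] by blast
    then show "\<exists>\<psi>\<in>(\<Union>a\<in>\<rat>. \<Union>n. S a n). action \<psi> \<le> ereal a \<and> mdist C0 \<psi> \<phi> < r"
      using h n S(2)[of a n] by (intro bexI[of _ \<psi>]) (auto simp: K_def)
  qed
qed

section \<open>Gaussian vectors\<close>
lemma prod_vec_eq_prod_Basis:
  fixes x :: "real ^ 'd"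
  shows "(\<Prod>i\<in>UNIV. g (x $ i)) = (\<Prod>b\<in>Basis. g (x \<bullet> b))"
proof -
  have B: "(Basis :: (real ^ 'd) set) = (\<lambda>i. axis i 1) ` UNIV"
    by (auto simp: Basis_vec_def)
  have "inj (\<lambda>i :: 'd. axis i (1 :: real))" by (auto simp: inj_def axis_eq_axis)
  then show ?thesis unfolding B by (simp add: prod.reindex o_def inner_axis)
qed

lemma gaussian_vec_nn_integral:
  assumes "\<sigma> > 0"
  shows "(\<integral>\<^sup>+x. ennreal (\<Prod>i\<in>UNIV. normal_density 0 \<sigma> ((x :: real ^ 'd) $ i)) \<partial>lborel) = 1"
proof -
  have "(\<integral>\<^sup>+x. ennreal (\<Prod>i\<in>UNIV. normal_density 0 \<sigma> ((x :: real ^ 'd) $ i)) \<partial>lborel)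
      = (\<integral>\<^sup>+x. (\<Prod>b\<in>Basis. ennreal (normal_density 0 \<sigma> ((x :: real ^ 'd) \<bullet> b))) \<partial>lborel)"
    unfolding prod_vec_eq_prod_Basis by (simp add: prod_ennreal)
  also have "\<dots> = (\<Prod>b\<in>(Basis :: (real ^ 'd) set). \<integral>\<^sup>+y. ennreal (normal_density 0 \<sigma> y) \<partial>lborel)"
    by (rule nn_integral_lborel_prod) auto
  also have "(\<integral>\<^sup>+y. ennreal (normal_density 0 \<sigma> y) \<partial>lborel) = 1"
    using assms by (subst nn_integral_eq_integral) (auto intro: integrable_normal_density)
  finally show ?thesis by simp
qed

lemma sum_vec_squares: "(\<Sum>i\<in>UNIV. (x $ i)\<^sup>2) = (norm x)\<^sup>2" for x :: "real ^ 'd"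
  unfolding power2_norm_eq_inner inner_vec_def by (simp add: power2_eq_square)

text \<open>
  Multiplying the density by \<open>exp (l x\<^sup>2 / (2 \<sigma>\<^sup>2))\<close> gives, up to a constant factor, the Gaussian
  density with variance \<open>\<sigma>\<^sup>2 / (1 - l)\<close>.
\<close>
lemma gaussian_exp_moment:
  fixes X :: "'w \<Rightarrow> real ^ 'd"
  assumes X: "distributed M lborel X (\<lambda>x. ennreal (\<Prod>i\<in>UNIV. normal_density 0 \<sigma> (x $ i)))"
    and s: "\<sigma> > 0" and l: "l < 1"
  shows "(\<integral>\<^sup>+\<omega>. ennreal (exp (l * ((norm (X \<omega>))\<^sup>2 / \<sigma>\<^sup>2) / 2)) \<partial>M) = ennreal ((1 / sqrt (1 - l)) ^ CARD('d))"
proof -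
  \<comment> \<open>The standard deviation of the tilted Gaussian.\<close>
  define t where "t = \<sigma> / sqrt (1 - l)"
  have t: "t > 0" using s l by (simp add: t_def)
  have t2: "t\<^sup>2 = \<sigma>\<^sup>2 / (1 - l)" using l by (simp add: t_def power_divide)
  have one: "normal_density 0 \<sigma> y * exp (l * (y\<^sup>2 / \<sigma>\<^sup>2) / 2) = (1 / sqrt (1 - l)) * normal_density 0 t y" for y
  proof -
    have "- y\<^sup>2 / (2 * \<sigma>\<^sup>2) + l * (y\<^sup>2 / \<sigma>\<^sup>2) / 2 = - y\<^sup>2 / (2 * t\<^sup>2)"
      using s l by (simp add: t2 field_simps)
    then have e: "exp (- y\<^sup>2 / (2 * \<sigma>\<^sup>2)) * exp (l * (y\<^sup>2 / \<sigma>\<^sup>2) / 2) = exp (- y\<^sup>2 / (2 * t\<^sup>2))"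
      by (simp add: mult_exp_exp)
    have "sqrt (2 * pi * t\<^sup>2) = sqrt (2 * pi * \<sigma>\<^sup>2) / sqrt (1 - l)"
      by (simp add: t2 real_sqrt_divide[symmetric])
    then have "1 / sqrt (2 * pi * \<sigma>\<^sup>2) = (1 / sqrt (1 - l)) * (1 / sqrt (2 * pi * t\<^sup>2))"
      using l by simp
    then show ?thesis unfolding normal_density_def using e by (simp add: mult.assoc)
  qed
  have pt: "ennreal (\<Prod>i\<in>UNIV. normal_density 0 \<sigma> (x $ i)) * ennreal (exp (l * ((norm x)\<^sup>2 / \<sigma>\<^sup>2) / 2))
      = ennreal ((1 / sqrt (1 - l)) ^ CARD('d)) * ennreal (\<Prod>i\<in>UNIV. normal_density 0 t (x $ i))" for x :: "real ^ 'd"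
  proof -
    have "exp (l * ((norm x)\<^sup>2 / \<sigma>\<^sup>2) / 2) = (\<Prod>i\<in>UNIV. exp (l * ((x $ i)\<^sup>2 / \<sigma>\<^sup>2) / 2))"
      unfolding sum_vec_squares[symmetric] by (simp add: exp_sum[symmetric] sum_distrib_left sum_divide_distrib)
    then have "(\<Prod>i\<in>UNIV. normal_density 0 \<sigma> (x $ i)) * exp (l * ((norm x)\<^sup>2 / \<sigma>\<^sup>2) / 2)
       = (\<Prod>i\<in>UNIV. (1 / sqrt (1 - l)) * normal_density 0 t (x $ i))"
      by (simp only: one prod.distrib[symmetric])
    also have "\<dots> = (1 / sqrt (1 - l)) ^ CARD('d) * (\<Prod>i\<in>UNIV. normal_density 0 t (x $ i))"
      unfolding prod.distrib by simp
    finally show ?thesis using l by (simp add: ennreal_mult[symmetric] prod_nonneg)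
  qed
  have "(\<integral>\<^sup>+\<omega>. ennreal (exp (l * ((norm (X \<omega>))\<^sup>2 / \<sigma>\<^sup>2) / 2)) \<partial>M)
     = (\<integral>\<^sup>+x. ennreal (\<Prod>i\<in>UNIV. normal_density 0 \<sigma> ((x :: real ^ 'd) $ i)) * ennreal (exp (l * ((norm x)\<^sup>2 / \<sigma>\<^sup>2) / 2)) \<partial>lborel)"
    by (rule distributed_nn_integral[OF X, where g = "\<lambda>x. ennreal (exp (l * ((norm x)\<^sup>2 / \<sigma>\<^sup>2) / 2))", symmetric]) measurable
  also have "\<dots> = ennreal ((1 / sqrt (1 - l)) ^ CARD('d)) * (\<integral>\<^sup>+x. ennreal (\<Prod>i\<in>UNIV. normal_density 0 t ((x :: real ^ 'd) $ i)) \<partial>lborel)"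
    unfolding pt by (rule nn_integral_cmult) measurable
  also have "\<dots> = ennreal ((1 / sqrt (1 - l)) ^ CARD('d))"
    by (simp add: gaussian_vec_nn_integral[OF t])
  finally show ?thesis .
qed

text \<open>
  The volume of the ball times the least value of the density on it.
\<close>
lemma gaussian_ball_lower:
  fixes X :: "'w \<Rightarrow> real ^ 'd"
  assumes X: "distributed M lborel X (\<lambda>x. ennreal (\<Prod>i\<in>UNIV. normal_density 0 \<sigma> (x $ i)))"
    and s: "\<sigma> > 0" and r: "r \<ge> 0" and M: "prob_space M"
  shows "(1 / sqrt (2 * pi * \<sigma>\<^sup>2)) ^ CARD('d) * exp (- (norm y + r)\<^sup>2 / (2 * \<sigma>\<^sup>2)) *
     (unit_ball_vol CARD('d) * r ^ CARD('d)) \<le> measure M (X -` cball y r \<inter> space M)"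
proof -
  interpret prob_space M by (rule M)
  define c where "c = (1 / sqrt (2 * pi * \<sigma>\<^sup>2)) ^ CARD('d) * exp (- (norm y + r)\<^sup>2 / (2 * \<sigma>\<^sup>2))"
  have c: "c \<ge> 0" by (simp add: c_def)
  have dens: "(\<Prod>i\<in>UNIV. normal_density 0 \<sigma> (x $ i)) = (1 / sqrt (2 * pi * \<sigma>\<^sup>2)) ^ CARD('d) * exp (- (norm x)\<^sup>2 / (2 * \<sigma>\<^sup>2))"
    for x :: "real ^ 'd"
    unfolding normal_density_def prod.distrib sum_vec_squares[symmetric]
    by (simp add: exp_sum[symmetric] sum_negf sum_divide_distrib)
  have le: "c \<le> (\<Prod>i\<in>UNIV. normal_density 0 \<sigma> (x $ i))" if "x \<in> cball y r" for x
  proof -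
    have "norm x \<le> norm y + norm (x - y)" using norm_triangle_ineq[of y "x - y"] by simp
    then have "norm x \<le> norm y + r" using that by (simp add: dist_norm norm_minus_commute)
    then have "(norm x)\<^sup>2 / (2 * \<sigma>\<^sup>2) \<le> (norm y + r)\<^sup>2 / (2 * \<sigma>\<^sup>2)"
      by (intro divide_right_mono power_mono) auto
    then show ?thesis unfolding dens c_def by (intro mult_left_mono) auto
  qed
  have "ennreal (c * (unit_ball_vol CARD('d) * r ^ CARD('d))) = ennreal c * emeasure lborel (cball y r)"
    using c r by (simp add: emeasure_cball ennreal_mult)
  also have "\<dots> = (\<integral>\<^sup>+x. ennreal c * indicator (cball y r) x \<partial>lborel)"
    by (simp add: nn_integral_cmult_indicator)
  also have "\<dots> \<le> (\<integral>\<^sup>+x. ennreal (\<Prod>i\<in>UNIV. normal_density 0 \<sigma> (x $ i)) * indicator (cball y r) x \<partial>lborel)"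
    using le by (intro nn_integral_mono) (auto simp: indicator_def intro: ennreal_leI)
  also have "\<dots> = emeasure M (X -` cball y r \<inter> space M)"
    by (rule distributed_emeasure[OF X, symmetric]) simp
  finally show ?thesis by (simp add: c_def emeasure_eq_measure)
qed

section \<open>Counting events that occur\<close>
lemma card_eq_sum_indicator:
  assumes "finite J"
  shows "real (card {j \<in> J. \<omega> \<in> A j}) = (\<Sum>j\<in>J. indicator (A j) \<omega>)"
proof -
  have "(\<Sum>j\<in>J. indicator (A j) \<omega>) = (\<Sum>j\<in>{j \<in> J. \<omega> \<in> A j}. 1 :: real)"
    using assms by (intro sum.mono_neutral_cong_right) auto
  then show ?thesis by simp
qed

context prob_space begin

lemma prob_card_ge:
  assumes "finite J" "\<And>j. j \<in> J \<Longrightarrow> A j \<in> events" "c > 0"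
  shows "prob {\<omega> \<in> space M. c \<le> real (card {j \<in> J. \<omega> \<in> A j})} \<le> (\<Sum>j\<in>J. prob (A j)) / c"
proof -
  have "prob {\<omega> \<in> space M. c \<le> (\<Sum>j\<in>J. indicator (A j) \<omega>)} \<le> expectation (\<lambda>\<omega>. \<Sum>j\<in>J. indicator (A j) \<omega>) / c"
    using assms by (intro integral_Markov_inequality_measure[where A = "{}"])
      (auto intro!: Bochner_Integration.integrable_sum sum_nonneg simp: less_top[symmetric])
  also have "expectation (\<lambda>\<omega>. \<Sum>j\<in>J. indicator (A j) \<omega>) = (\<Sum>j\<in>J. prob (A j))"
    using assms by (subst Bochner_Integration.integral_sum) (auto simp: less_top[symmetric] sets.Int_space_eq2)
  finally show ?thesis unfolding card_eq_sum_indicator[OF assms(1)] .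
qed

text \<open>
  Chebyshev's inequality. Pairwise independence makes the variance of the count at most its mean.
\<close>
lemma prob_card_le_half_mean:
  assumes J: "finite J" and A: "\<And>j. j \<in> J \<Longrightarrow> A j \<in> events"
    and indep: "\<And>i j. i \<in> J \<Longrightarrow> j \<in> J \<Longrightarrow> i \<noteq> j \<Longrightarrow> prob (A i \<inter> A j) = prob (A i) * prob (A j)"
    and S: "(\<Sum>j\<in>J. prob (A j)) > 0"
  shows "prob {\<omega> \<in> space M. real (card {j \<in> J. \<omega> \<in> A j}) \<le> (\<Sum>j\<in>J. prob (A j)) / 2} \<le> 4 / (\<Sum>j\<in>J. prob (A j))"
proof -
  define S where "S = (\<Sum>j\<in>J. prob (A j))"
  define X where "X \<omega> = (\<Sum>j\<in>J. indicator (A j) \<omega> :: real)" for \<omega>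
  have int: "integrable M (\<lambda>\<omega>. indicator (A j) \<omega> :: real)" if "j \<in> J" for j
    using A[OF that] by (simp add: less_top[symmetric])
  have int2: "integrable M (\<lambda>\<omega>. indicator (A i \<inter> A j) \<omega> :: real)" if "i \<in> J" "j \<in> J" for i j
    using A that by (simp add: less_top[symmetric])
  have X2: "(X \<omega>)\<^sup>2 = (\<Sum>i\<in>J. \<Sum>j\<in>J. indicator (A i \<inter> A j) \<omega>)" for \<omega>
    unfolding X_def power2_eq_square sum_product by (simp add: indicator_inter_arith)
  have iX: "integrable M X" unfolding X_def using int by (intro Bochner_Integration.integrable_sum)
  have iX2: "integrable M (\<lambda>\<omega>. (X \<omega>)\<^sup>2)"
    unfolding X2 using int2 by (intro Bochner_Integration.integrable_sum)
  have EX: "expectation X = S"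
    unfolding X_def S_def using int A by (subst Bochner_Integration.integral_sum) (auto simp: sets.Int_space_eq2)
  have "expectation (\<lambda>\<omega>. (X \<omega>)\<^sup>2) = (\<Sum>i\<in>J. expectation (\<lambda>\<omega>. \<Sum>j\<in>J. indicator (A i \<inter> A j) \<omega> :: real))"
    unfolding X2 using int2 by (intro Bochner_Integration.integral_sum Bochner_Integration.integrable_sum)
  also have "\<dots> = (\<Sum>i\<in>J. \<Sum>j\<in>J. prob (A i \<inter> A j))"
  proof (rule sum.cong[OF refl])
    fix i assume i: "i \<in> J"
    have "expectation (\<lambda>\<omega>. \<Sum>j\<in>J. indicator (A i \<inter> A j) \<omega> :: real) = (\<Sum>j\<in>J. expectation (\<lambda>\<omega>. indicator (A i \<inter> A j) \<omega> :: real))"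
      using int2 i by (intro Bochner_Integration.integral_sum)
    then show "expectation (\<lambda>\<omega>. \<Sum>j\<in>J. indicator (A i \<inter> A j) \<omega> :: real) = (\<Sum>j\<in>J. prob (A i \<inter> A j))"
      using A i by (simp add: sets.Int_space_eq2)
  qed
  also have "\<dots> \<le> (\<Sum>i\<in>J. \<Sum>j\<in>J. prob (A i) * prob (A j) + (if i = j then prob (A i) else 0))"
  proof (intro sum_mono)
    fix i j assume "i \<in> J" "j \<in> J"
    then show "prob (A i \<inter> A j) \<le> prob (A i) * prob (A j) + (if i = j then prob (A i) else 0)"
      using indep[of i j] by (cases "i = j") auto
  qed
  also have "\<dots> = S\<^sup>2 + S"
    using J by (simp add: sum.distrib S_def power2_eq_square sum_product)
  finally have var: "variance X \<le> S"
    using variance_eq[OF iX iX2] EX by simp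
  have S0: "S > 0" using S by (simp add: S_def)
  have "prob {\<omega> \<in> space M. real (card {j \<in> J. \<omega> \<in> A j}) \<le> S / 2} \<le> prob {\<omega> \<in> space M. S / 2 \<le> \<bar>X \<omega> - expectation X\<bar>}"
  proof (rule finite_measure_mono)
    show "{\<omega> \<in> space M. real (card {j \<in> J. \<omega> \<in> A j}) \<le> S / 2} \<subseteq> {\<omega> \<in> space M. S / 2 \<le> \<bar>X \<omega> - expectation X\<bar>}"
    proof -
      have "S / 2 \<le> \<bar>x - S\<bar>" if "x \<le> S / 2" for x
        using that abs_ge_minus_self[of "x - S"] by linarith
      then show ?thesis unfolding EX card_eq_sum_indicator[OF J] X_def by blast
    qed
    have "X \<in> borel_measurable M" using iX by simp
    then show "{\<omega> \<in> space M. S / 2 \<le> \<bar>X \<omega> - expectation X\<bar>} \<in> events" by measurable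
  qed
  also have "\<dots> \<le> variance X / (S / 2)\<^sup>2"
    using S0 iX iX2 by (intro Chebyshev_inequality) auto
  also have "\<dots> \<le> S / (S / 2)\<^sup>2" using var by (intro divide_right_mono) auto
  also have "\<dots> = 4 / S" using S0 by (simp add: power2_eq_square)
  finally show ?thesis by (simp add: S_def)
qed

lemma measurable_card_events:
  assumes "finite J" "\<And>j. j \<in> J \<Longrightarrow> A j \<in> events"
  shows "(\<lambda>\<omega>. real (card {j \<in> J. \<omega> \<in> A j})) \<in> borel_measurable M"
  unfolding card_eq_sum_indicator[OF assms(1)] using assms(2) by (intro borel_measurable_sum borel_measurable_indicator)

text \<open>
  The loss from rate \<open>a\<close> to rate \<open>b\<close> makes the probabilities in Markov's inequality summable.
\<close>
lemma eventually_few_events: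
  fixes B :: "nat \<Rightarrow> nat \<Rightarrow> 'a set"
  assumes k: "\<And>n. n \<ge> 1 \<Longrightarrow> k n \<ge> 1"
    and B: "\<And>n j. n \<ge> 1 \<Longrightarrow> j \<in> {1..k n} \<Longrightarrow> B n j \<in> events"
    and p: "\<And>n j. n \<ge> 1 \<Longrightarrow> j \<in> {1..k n} \<Longrightarrow> prob (B n j) \<le> C * exp (- a * real n)"
    and ba: "b < a"
  shows "AE \<omega> in M. \<forall>\<^sub>F n in sequentially. real (card {j \<in> {1..k n}. \<omega> \<in> B n j}) \<le> real (k n) * exp (- b * real n)"
proof -
  define A where "A n = (if n \<ge> 1 then {\<omega> \<in> space M. real (k n) * exp (- b * real n) \<le> real (card {j \<in> {1..k n}. \<omega> \<in> B n j})} else {})" for n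
  have Am: "A n \<in> events" for n
    unfolding A_def using measurable_card_events[of "{1..k n}" "B n"] B by auto
  have C: "C \<ge> 0"
  proof -
    have "0 \<le> C * exp (- a * real 1)" using p[of 1 1] k[of 1] by (intro order_trans[OF measure_nonneg]) auto
    then show ?thesis by (simp add: zero_le_mult_iff)
  qed
  have le: "prob (A n) \<le> C * exp (- (a - b)) ^ n" for n
  proof (cases "n \<ge> 1")
    case True
    then have kn: "real (k n) > 0" using k[of n] by simp
    have "prob (A n) \<le> (\<Sum>j\<in>{1..k n}. prob (B n j)) / (real (k n) * exp (- b * real n))"
      unfolding A_def if_P[OF True] by (rule prob_card_ge) (use True kn B in auto)
    also have "\<dots> \<le> (real (k n) * (C * exp (- a * real n))) / (real (k n) * exp (- b * real n))"
      using kn p[OF True] sum_bounded_above[of "{1..k n}" "\<lambda>j. prob (B n j)" "C * exp (- a * real n)"]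
      by (intro divide_right_mono) auto
    also have "\<dots> = C * (exp (- a * real n) / exp (- b * real n))" using kn by simp
    also have "exp (- a * real n) / exp (- b * real n) = exp (- (a - b)) ^ n"
      by (simp add: exp_diff[symmetric] exp_of_nat_mult[symmetric] algebra_simps)
    finally show ?thesis .
  next
    case False
    then show ?thesis using C by (simp add: A_def)
  qed
  have "summable (\<lambda>n. C * exp (- (a - b)) ^ n)"
    using ba by (intro summable_mult summable_geometric) simp
  then have "summable (\<lambda>n. prob (A n))"
    by (rule summable_comparison_test_ev[rotated]) (use le in auto)
  then have "AE \<omega> in M. \<forall>\<^sub>F n in sequentially. \<omega> \<in> space M - A n"
    using Am by (intro borel_cantelli_AE1) (auto simp: less_top[symmetric])
  then show ?thesis
  proof eventually_elim
    case (elim \<omega>)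
    then show ?case
      using eventually_ge_at_top[of 1] by eventually_elim (auto simp: A_def)
  qed
qed

text \<open>
  The mean count is at least \<open>c k(n) exp (- a n)\<close>, which exceeds \<open>c exp n\<close> eventually because \<open>k(n)\<close>
  grows faster than \<open>exp ((a + 1) n)\<close>; so the probabilities in Chebyshev's inequality are summable.
\<close>
lemma eventually_many_events:
  fixes A :: "nat \<Rightarrow> nat \<Rightarrow> 'a set"
  assumes k: "\<And>n. n \<ge> 1 \<Longrightarrow> k n \<ge> 1" and lim: "filterlim (\<lambda>n. ln (real (k n)) / real n) at_top sequentially"
    and A: "\<And>n j. n \<ge> 1 \<Longrightarrow> j \<in> {1..k n} \<Longrightarrow> A n j \<in> events"
    and indep: "\<And>n i j. n \<ge> 1 \<Longrightarrow> i \<in> {1..k n} \<Longrightarrow> j \<in> {1..k n} \<Longrightarrow> i \<noteq> j \<Longrightarrow> prob (A n i \<inter> A n j) = prob (A n i) * prob (A n j)"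
    and p: "\<And>n j. n \<ge> 1 \<Longrightarrow> j \<in> {1..k n} \<Longrightarrow> c * exp (- a * real n) \<le> prob (A n j)"
    and c: "c > 0"
  shows "AE \<omega> in M. \<forall>\<^sub>F n in sequentially. real (k n) * (c / 2 * exp (- a * real n)) \<le> real (card {j \<in> {1..k n}. \<omega> \<in> A n j})"
proof -
  define S where "S n = (\<Sum>j\<in>{1..k n}. prob (A n j))" for n
  define B where "B n = (if n \<ge> 1 then {\<omega> \<in> space M. real (card {j \<in> {1..k n}. \<omega> \<in> A n j}) \<le> S n / 2} else {})" for n
  have Bm: "B n \<in> events" for n
    unfolding B_def using measurable_card_events[of "{1..k n}" "A n"] A by auto
  have S: "real (k n) * (c * exp (- a * real n)) \<le> S n" if "n \<ge> 1" for n
    using sum_bounded_below[of "{1..k n}" "c * exp (- a * real n)" "\<lambda>j. prob (A n j)"] p[OF that] by (simp add: S_def)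
  have S0: "S n > 0" if "n \<ge> 1" for n
  proof -
    have "0 < real (k n) * (c * exp (- a * real n))" using k[OF that] c by simp
    then show ?thesis using S[OF that] by linarith
  qed
  have ev: "\<forall>\<^sub>F n in sequentially. norm (prob (B n)) \<le> (4 / c) * exp (- 1) ^ n"
  proof -
    have "\<forall>\<^sub>F n in sequentially. a + 1 \<le> ln (real (k n)) / real n"
      using lim by (simp add: filterlim_at_top)
    then show ?thesis using eventually_ge_at_top[of 1]
    proof eventually_elim
      case (elim n)
      note n1 = \<open>1 \<le> n\<close>
      have "(a + 1) * real n \<le> ln (real (k n))" using elim by (simp add: pos_le_divide_eq)
      then have kn: "exp ((a + 1) * real n) \<le> real (k n)"
        using k[of n] elim by (simp add: ln_ge_iff)
      have "c * exp (real n) = exp ((a + 1) * real n) * (c * exp (- a * real n))"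
        by (simp add: exp_add[symmetric] algebra_simps mult_exp_exp)
      also have "\<dots> \<le> real (k n) * (c * exp (- a * real n))" using kn c by (intro mult_right_mono) auto
      also have "\<dots> \<le> S n" using S elim by simp
      finally have Sn: "c * exp (real n) \<le> S n" .
      have "prob (B n) \<le> 4 / S n"
        unfolding B_def if_P[OF n1] S_def
        by (rule prob_card_le_half_mean) (use n1 A indep S0[OF n1] in \<open>auto simp: S_def\<close>)
      also have "\<dots> \<le> 4 / (c * exp (real n))" using Sn c by (intro frac_le) auto
      also have "\<dots> = (4 / c) * exp (- 1) ^ n"
        by (simp add: exp_of_nat_mult[symmetric] exp_minus field_simps)
      finally show ?case by simp
    qed
  qed
  have "summable (\<lambda>n. (4 / c) * exp (- 1 :: real) ^ n)"
    by (intro summable_mult summable_geometric) simp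
  then have "summable (\<lambda>n. prob (B n))"
    by (rule summable_comparison_test_ev[OF ev])
  then have "AE \<omega> in M. \<forall>\<^sub>F n in sequentially. \<omega> \<in> space M - B n"
    using Bm by (intro borel_cantelli_AE1) (auto simp: less_top[symmetric])
  then show ?thesis
  proof eventually_elim
    case (elim \<omega>)
    then show ?case
      using eventually_ge_at_top[of 1]
    proof eventually_elim
      case (elim n)
      then have "S n / 2 \<le> real (card {j \<in> {1..k n}. \<omega> \<in> A n j})" by (auto simp: B_def)
      moreover have "real (k n) * (c / 2 * exp (- a * real n)) \<le> S n / 2" using S[of n] elim by simp
      ultimately show ?case by linarith
    qed
  qed
qed

end

section \<open>Increments of Brownian motion over a grid\<close>
text \<open>
  Sample paths at dyadic times involve only increments of \<open>W\<close> between neighbouring points of the grid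
  of mesh \<open>1/(k 2 ^ q)\<close>, which are jointly independent over all blocks.
\<close>
definition grid_incr :: "(real \<Rightarrow> 'w \<Rightarrow> real ^ 'd) \<Rightarrow> nat \<Rightarrow> nat \<Rightarrow> 'w \<Rightarrow> real ^ 'd" where
  "grid_incr W N l \<omega> = W ((real l + 1) / real N) \<omega> - W (real l / real N) \<omega>"

lemma dyadic_incr_sample_path:
  assumes "n \<ge> 1" "k \<ge> 1" "j \<in> {1..k}" "i < 2 ^ q"
  shows "dyadic_incr q (sample_path W n k j \<omega>) i =
    sqrt (real k / real n) *\<^sub>R grid_incr W (k * 2 ^ q) ((j - 1) * 2 ^ q + i) \<omega>"
proof -
  have t: "(real i + 1) / 2 ^ q \<in> {0..1}" "real i / 2 ^ q \<in> {0..1}"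
    using dyadic_in_unit[of i q] dyadic_in_unit[of "Suc i" q] assms by (simp_all add: add.commute)
  have j: "real (j - 1) = real j - 1" using assms by (simp add: of_nat_diff)
  have e: "((real i + 1) / 2 ^ q + (real j - 1)) / real k = (real ((j - 1) * 2 ^ q + i) + 1) / real (k * 2 ^ q)"
    "(real i / 2 ^ q + (real j - 1)) / real k = real ((j - 1) * 2 ^ q + i) / real (k * 2 ^ q)"
    using assms by (simp_all add: j divide_simps)
  show ?thesis
    unfolding dyadic_incr_def sample_path_def restrict_apply'[OF t(1)] restrict_apply'[OF t(2)] rescaled_block_def e
      grid_incr_def
    by (simp add: scaleR_diff_right[symmetric] divide_inverse real_sqrt_mult real_sqrt_inverse mult.commute)
qed

lemma norm_dyadic_incr_sample_path:
  assumes "n \<ge> 1" "k \<ge> 1" "j \<in> {1..k}" "i < 2 ^ q"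
  shows "2 ^ q * (norm (dyadic_incr q (sample_path W n k j \<omega>) i))\<^sup>2 =
    real (k * 2 ^ q) * (norm (grid_incr W (k * 2 ^ q) ((j - 1) * 2 ^ q + i) \<omega>))\<^sup>2 / real n"
  unfolding dyadic_incr_sample_path[OF assms] using assms by (simp add: power_mult_distrib)

lemma block_index_less:
  assumes "j \<in> {1..k}" "i < 2 ^ q"
  shows "(j - 1) * 2 ^ q + i < k * (2::nat) ^ q"
proof -
  have "(j - 1) * 2 ^ q + i < (j - 1) * 2 ^ q + 2 ^ q" using assms by simp
  also have "\<dots> = j * 2 ^ q" using assms(1) by (cases j) auto
  also have "\<dots> \<le> k * 2 ^ q" using assms(1) by simp
  finally show ?thesis .
qed

lemma sample_path_in_C0:
  assumes "n \<ge> 1" "k \<ge> 1" "j \<in> {1..k}" and c: "continuous_on {0..1} (\<lambda>t. W t \<omega>)"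
  shows "sample_path W n k j \<omega> \<in> mspace C0"
proof -
  have "continuous_on {0..1} (\<lambda>t. W ((t + (real j - 1)) / real k) \<omega>)"
  proof (rule continuous_on_compose2[OF c])
    show "(\<lambda>t. (t + (real j - 1)) / real k) ` {0..1} \<subseteq> {0..1}"
      using assms by (auto simp: divide_le_eq)
  qed (use assms in \<open>auto intro!: continuous_intros\<close>)
  then have "continuous_on {0..1} (\<lambda>t. rescaled_block W k j \<omega> t /\<^sub>R sqrt (real n))"
    unfolding rescaled_block_def by (intro continuous_intros)
  then have "continuous_on {0..1} (sample_path W n k j \<omega>)"
    unfolding sample_path_def by (subst continuous_on_cong[OF refl, of _ _ "\<lambda>t. rescaled_block W k j \<omega> t /\<^sub>R sqrt (real n)"]) auto
  moreover have "sample_path W n k j \<omega> 0 = 0" by (simp add: sample_path_def rescaled_block_def)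
  moreover have "sample_path W n k j \<omega> \<in> extensional {0..1}" by (simp add: sample_path_def)
  ultimately show ?thesis by (simp add: mspace_C0)
qed

locale brownian_motion = prob_space M for M :: "'w measure" +
  fixes W :: "real \<Rightarrow> 'w \<Rightarrow> real ^ 'd"
  assumes bm: "std_brownian_motion M W"
begin

lemma grid_incr_distributed:
  assumes "l < N"
  shows "distributed M lborel (grid_incr W N l) (\<lambda>x. ennreal (\<Prod>i\<in>UNIV. normal_density 0 (sqrt (1 / real N)) (x $ i)))"
proof -
  have N: "real N > 0" using assms by simp
  have "0 \<le> real l / real N" "real l / real N < (real l + 1) / real N" "(real l + 1) / real N \<le> 1"
    using assms N by (auto simp: divide_strict_right_mono divide_le_eq)
  then have "distributed M lborel (\<lambda>\<omega>. W ((real l + 1) / real N) \<omega> - W (real l / real N) \<omega>)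
          (\<lambda>x. ennreal (\<Prod>i\<in>UNIV. normal_density 0 (sqrt ((real l + 1) / real N - real l / real N)) (x $ i)))"
    using bm unfolding std_brownian_motion_def by blast
  moreover have "(real l + 1) / real N - real l / real N = 1 / real N" by (simp add: diff_divide_distrib[symmetric])
  ultimately show ?thesis by (simp add: grid_incr_def[abs_def])
qed

lemma grid_incr_measurable: "l < N \<Longrightarrow> grid_incr W N l \<in> borel_measurable M"
  using distributed_measurable[OF grid_incr_distributed] by simp

lemma grid_incr_indep: "indep_vars (\<lambda>_. borel) (grid_incr W N) {..<N}"
proof -
  define \<tau> where "\<tau> i = real i / real N" for i
  have "(\<forall>i\<le>N. \<tau> i \<in> {0..1}) \<and> (\<forall>i<N. \<tau> i < \<tau> (Suc i))"
    by (auto simp: \<tau>_def divide_strict_right_mono divide_le_eq)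
  then have "indep_vars (\<lambda>_. borel) (\<lambda>i \<omega>. W (\<tau> (Suc i)) \<omega> - W (\<tau> i) \<omega>) {..<N}"
    using bm unfolding std_brownian_motion_def by blast
  then show ?thesis by (simp add: \<tau>_def grid_incr_def[abs_def] add.commute)
qed

lemma grid_incr_exp_moment:
  assumes "l < N" "c < 1"
  shows "(\<integral>\<^sup>+\<omega>. ennreal (exp (c * (real N * (norm (grid_incr W N l \<omega>))\<^sup>2) / 2)) \<partial>M) = ennreal ((1 / sqrt (1 - c)) ^ CARD('d))"
proof -
  have "sqrt (1 / real N) > 0" using assms by simp
  from gaussian_exp_moment[OF grid_incr_distributed[OF assms(1)] this assms(2)]
  show ?thesis by (simp add: mult.commute)
qed

lemma sample_energy_eq:
  assumes "n \<ge> 1" "k \<ge> 1" "j \<in> {1..k}"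
  shows "dyadic_energy q (sample_path W n k j \<omega>) =
    (\<Sum>i<2 ^ q. real (k * 2 ^ q) * (norm (grid_incr W (k * 2 ^ q) ((j - 1) * 2 ^ q + i) \<omega>))\<^sup>2) / real n"
  unfolding dyadic_energy_def sum_distrib_left sum_divide_distrib
  using norm_dyadic_incr_sample_path[OF assms] by (intro sum.cong) auto

lemma dyadic_incr_sample_measurable:
  assumes "n \<ge> 1" "k \<ge> 1" "j \<in> {1..k}" "i < 2 ^ q"
  shows "(\<lambda>\<omega>. dyadic_incr q (sample_path W n k j \<omega>) i) \<in> borel_measurable M"
  unfolding dyadic_incr_sample_path[OF assms]
  using grid_incr_measurable[OF block_index_less[OF assms(3,4)]] by measurable

section \<open>Exponential bounds for one sample path\<close>
text \<open>
  Exponential Markov inequality for a sum of independent squares. The parameter \<open>c\<close> may be taken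
  arbitrarily close to \<open>1\<close>, which makes the exponential rate in \<open>n\<close> arbitrarily close to \<open>a\<close>.
\<close>
lemma sample_energy_tail:
  assumes nk: "n \<ge> 1" "k \<ge> 1" "j \<in> {1..k}" and c: "0 \<le> c" "c < 1"
  shows "{\<omega> \<in> space M. 2 * a < dyadic_energy q (sample_path W n k j \<omega>)} \<in> events"
    and "prob {\<omega> \<in> space M. 2 * a < dyadic_energy q (sample_path W n k j \<omega>)}
      \<le> ((1 / sqrt (1 - c)) ^ CARD('d)) ^ 2 ^ q * exp (- (c * a) * real n)"
proof -
  define N where "N = k * 2 ^ q"
  define f where "f i = (j - 1) * 2 ^ q + i" for i :: nat
  define Z where "Z i \<omega> = real N * (norm (grid_incr W N (f i) \<omega>))\<^sup>2" for i \<omega>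
  have E: "dyadic_energy q (sample_path W n k j \<omega>) = (\<Sum>i<2 ^ q. Z i \<omega>) / real n" for \<omega>
    unfolding sample_energy_eq[OF nk] by (simp add: Z_def N_def f_def)
  have fN: "f i < N" if "i < 2 ^ q" for i unfolding f_def N_def using block_index_less[OF nk(3) that] .
  have Zm: "Z i \<in> borel_measurable M" if "i < 2 ^ q" for i
    unfolding Z_def using grid_incr_measurable[OF fN[OF that]] by measurable
  have Sm: "(\<lambda>\<omega>. \<Sum>i<2 ^ q. Z i \<omega>) \<in> borel_measurable M"
    using Zm by (intro borel_measurable_sum) auto
  then show ev: "{\<omega> \<in> space M. 2 * a < dyadic_energy q (sample_path W n k j \<omega>)} \<in> events"
    unfolding E by measurable
  define C where "C = (1 / sqrt (1 - c)) ^ CARD('d)"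
  define U where "U i \<omega> = ennreal (exp (c * Z i \<omega> / 2))" for i \<omega>
  have inj: "inj_on f {..<2 ^ q}" by (auto simp: inj_on_def f_def)
  \<comment> \<open>The factors indexed by grid position rather than by position in the block, to match the form of independence.\<close>
  define V where "V l \<omega> = ennreal (exp (c * (real N * (norm (grid_incr W N l \<omega>))\<^sup>2) / 2))" for l \<omega>
  have UV: "U i \<omega> = V (f i) \<omega>" for i \<omega> by (simp add: U_def V_def Z_def)
  have "indep_vars (\<lambda>_. borel) (grid_incr W N) (f ` {..<2 ^ q})"
    using fN by (intro indep_vars_subset[OF grid_incr_indep]) auto
  then have "indep_vars (\<lambda>_. borel) V (f ` {..<2 ^ q})"
    unfolding V_def by (rule indep_vars_compose2) measurable
  then have "(\<integral>\<^sup>+\<omega>. (\<Prod>l\<in>f ` {..<2 ^ q}. V l \<omega>) \<partial>M) = (\<Prod>l\<in>f ` {..<2 ^ q}. \<integral>\<^sup>+\<omega>. V l \<omega> \<partial>M)"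
    by (intro indep_vars_nn_integral) auto
  then have "(\<integral>\<^sup>+\<omega>. (\<Prod>i<2 ^ q. U i \<omega>) \<partial>M) = (\<Prod>i<2 ^ q. \<integral>\<^sup>+\<omega>. U i \<omega> \<partial>M)"
    by (simp add: prod.reindex[OF inj] UV)
  also have "\<dots> = (\<Prod>i<(2::nat) ^ q. ennreal C)"
    unfolding U_def Z_def C_def using grid_incr_exp_moment[OF fN c(2)] by (intro prod.cong) auto
  also have "\<dots> = ennreal (C ^ 2 ^ q)" using c by (simp add: ennreal_power C_def)
  finally have int: "(\<integral>\<^sup>+\<omega>. (\<Prod>i<2 ^ q. U i \<omega>) \<partial>M) = ennreal (C ^ 2 ^ q)" .
  have Uprod: "(\<Prod>i<2 ^ q. U i \<omega>) = ennreal (exp (c * (\<Sum>i<2 ^ q. Z i \<omega>) / 2))" for \<omega>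
    unfolding U_def by (subst prod_ennreal) (auto simp: exp_sum sum_distrib_left sum_divide_distrib)
  have "{\<omega> \<in> space M. 2 * a < dyadic_energy q (sample_path W n k j \<omega>)}
     \<subseteq> {\<omega> \<in> space M. 1 \<le> ennreal (exp (- (c * a) * real n)) * (\<Prod>i<2 ^ q. U i \<omega>)}"
  proof (rule Collect_mono, intro impI conjI)
    fix \<omega> assume "\<omega> \<in> space M \<and> 2 * a < dyadic_energy q (sample_path W n k j \<omega>)"
    then have "2 * a * real n < (\<Sum>i<2 ^ q. Z i \<omega>)" unfolding E using nk by (simp add: pos_less_divide_eq)
    then have "c * (2 * a * real n) \<le> c * (\<Sum>i<2 ^ q. Z i \<omega>)" using c by (intro mult_left_mono) auto
    then have "1 \<le> exp (- (c * a) * real n) * exp (c * (\<Sum>i<2 ^ q. Z i \<omega>) / 2)"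
      by (simp add: mult_exp_exp algebra_simps)
    then show "1 \<le> ennreal (exp (- (c * a) * real n)) * (\<Prod>i<2 ^ q. U i \<omega>)"
      unfolding Uprod by (simp add: ennreal_mult[symmetric])
  qed auto
  then have "emeasure M {\<omega> \<in> space M. 2 * a < dyadic_energy q (sample_path W n k j \<omega>)}
     \<le> emeasure M {\<omega> \<in> space M. 1 \<le> ennreal (exp (- (c * a) * real n)) * (\<Prod>i<2 ^ q. U i \<omega>)}"
    by (rule emeasure_mono) (unfold Uprod, use Sm in measurable)
  also have "\<dots> \<le> ennreal (exp (- (c * a) * real n)) * (\<integral>\<^sup>+\<omega>. (\<Prod>i<2 ^ q. U i \<omega>) * indicator (space M) \<omega> \<partial>M)"
    by (rule nn_integral_Markov_inequality) (unfold Uprod, use Sm in measurable)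
  also have "(\<integral>\<^sup>+\<omega>. (\<Prod>i<2 ^ q. U i \<omega>) * indicator (space M) \<omega> \<partial>M) = (\<integral>\<^sup>+\<omega>. (\<Prod>i<2 ^ q. U i \<omega>) \<partial>M)"
    by (intro nn_integral_cong) (auto simp: indicator_def)
  also note int
  also have "ennreal (exp (- (c * a) * real n)) * ennreal (C ^ 2 ^ q) = ennreal (C ^ 2 ^ q * exp (- (c * a) * real n))"
    using c by (simp add: ennreal_mult C_def mult.commute)
  finally show "prob {\<omega> \<in> space M. 2 * a < dyadic_energy q (sample_path W n k j \<omega>)}
      \<le> ((1 / sqrt (1 - c)) ^ CARD('d)) ^ 2 ^ q * exp (- (c * a) * real n)"
    using c unfolding C_def[symmetric] by (subst (asm) emeasure_eq_measure) (simp add: C_def)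
qed

text \<open>
  The same inequality for a single increment; the exponent \<open>1/4\<close> instead of nearly \<open>1/2\<close> comes from
  the choice \<open>c = 1/2\<close> and costs nothing, because \<open>m\<close> is still free when the bound is applied.
\<close>
lemma dyadic_incr_tail:
  assumes nk: "n \<ge> 1" "k \<ge> 1" "j \<in> {1..k}" "i < 2 ^ q" and r: "r \<ge> 0"
  shows "prob {\<omega> \<in> space M. r < norm (dyadic_incr q (sample_path W n k j \<omega>) i)}
      \<le> (sqrt 2) ^ CARD('d) * exp (- (real n * r\<^sup>2 * 2 ^ q / 4))"
proof -
  define N where "N = k * 2 ^ q"
  define l where "l = (j - 1) * 2 ^ q + i"
  have l: "l < N" unfolding l_def N_def using block_index_less[OF nk(3,4)] .
  define Z where "Z \<omega> = real N * (norm (grid_incr W N l \<omega>))\<^sup>2" for \<omega>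
  have Zm: "Z \<in> borel_measurable M" unfolding Z_def using grid_incr_measurable[OF l] by measurable
  define U where "U \<omega> = ennreal (exp (Z \<omega> / 4))" for \<omega>
  have Um: "U \<in> borel_measurable M" unfolding U_def using Zm by measurable
  have int: "(\<integral>\<^sup>+\<omega>. U \<omega> \<partial>M) = ennreal ((sqrt 2) ^ CARD('d))"
    using grid_incr_exp_moment[OF l, of "1/2"] by (simp add: U_def Z_def real_sqrt_divide)
  have "{\<omega> \<in> space M. r < norm (dyadic_incr q (sample_path W n k j \<omega>) i)}
     \<subseteq> {\<omega> \<in> space M. 1 \<le> ennreal (exp (- (real n * r\<^sup>2 * 2 ^ q / 4))) * U \<omega>}"
  proof (rule Collect_mono, intro impI conjI)
    fix \<omega> assume "\<omega> \<in> space M \<and> r < norm (dyadic_incr q (sample_path W n k j \<omega>) i)"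
    then have "2 ^ q * r\<^sup>2 \<le> 2 ^ q * (norm (dyadic_incr q (sample_path W n k j \<omega>) i))\<^sup>2"
      using r by (intro mult_left_mono power_mono) auto
    also have "\<dots> = Z \<omega> / real n"
      unfolding norm_dyadic_incr_sample_path[OF nk] by (simp add: Z_def N_def l_def)
    finally have "real n * r\<^sup>2 * 2 ^ q \<le> Z \<omega>" using nk by (simp add: pos_le_divide_eq mult_ac)
    then have "1 \<le> exp (- (real n * r\<^sup>2 * 2 ^ q / 4)) * exp (Z \<omega> / 4)" by (simp add: mult_exp_exp)
    then show "1 \<le> ennreal (exp (- (real n * r\<^sup>2 * 2 ^ q / 4))) * U \<omega>"
      unfolding U_def by (simp add: ennreal_mult[symmetric])
  qed auto
  then have "emeasure M {\<omega> \<in> space M. r < norm (dyadic_incr q (sample_path W n k j \<omega>) i)}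
     \<le> emeasure M {\<omega> \<in> space M. 1 \<le> ennreal (exp (- (real n * r\<^sup>2 * 2 ^ q / 4))) * U \<omega>}"
    by (rule emeasure_mono) (use Um in measurable)
  also have "\<dots> \<le> ennreal (exp (- (real n * r\<^sup>2 * 2 ^ q / 4))) * (\<integral>\<^sup>+\<omega>. U \<omega> * indicator (space M) \<omega> \<partial>M)"
    by (rule nn_integral_Markov_inequality) (use Um in measurable)
  also have "(\<integral>\<^sup>+\<omega>. U \<omega> * indicator (space M) \<omega> \<partial>M) = (\<integral>\<^sup>+\<omega>. U \<omega> \<partial>M)"
    by (intro nn_integral_cong) (auto simp: indicator_def)
  also note int
  also have "ennreal (exp (- (real n * r\<^sup>2 * 2 ^ q / 4))) * ennreal ((sqrt 2) ^ CARD('d))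
      = ennreal ((sqrt 2) ^ CARD('d) * exp (- (real n * r\<^sup>2 * 2 ^ q / 4)))"
    by (simp add: ennreal_mult mult.commute)
  finally show ?thesis by (subst (asm) emeasure_eq_measure) simp
qed

text \<open>
  A union bound over all levels. At level \<open>m + u\<close> there are \<open>2 ^ (m + u)\<close> increments, and the exponent
  in the tail bound of each grows with \<open>u\<close> like \<open>(2 (7/8)\<^sup>2) ^ u\<close>. The hypothesis \<open>16 \<le> \<eta>\<^sup>2 2 ^ m\<close>
  makes this growth beat the number of increments by a factor \<open>2 ^ u\<close> already for \<open>n = 1\<close>.
\<close>
lemma not_chained_tail:
  assumes nk: "n \<ge> 1" "k \<ge> 1" "j \<in> {1..k}" and eta: "\<eta> \<ge> 0" "16 \<le> \<eta>\<^sup>2 * 2 ^ m"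
  shows "{\<omega> \<in> space M. \<not> chained m \<eta> (sample_path W n k j \<omega>)} \<in> events"
    and "prob {\<omega> \<in> space M. \<not> chained m \<eta> (sample_path W n k j \<omega>)}
      \<le> 2 ^ Suc m * (sqrt 2) ^ CARD('d) * exp (- (\<eta>\<^sup>2 * 2 ^ m / 4) * real n)"
proof -
  define D where "D u i = {\<omega> \<in> space M. \<eta> * (7 / 8) ^ u < norm (dyadic_incr (m + u) (sample_path W n k j \<omega>) i)}" for u i
  define B where "B u = (\<Union>i<2 ^ (m + u). D u i)" for u
  define A where "A = \<eta>\<^sup>2 * 2 ^ m / 4"
  define C where "C = (sqrt 2) ^ CARD('d)"
  have Dev: "D u i \<in> events" if "i < 2 ^ (m + u)" for u i
    unfolding D_def using dyadic_incr_sample_measurable[OF nk that] by measurable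
  then have Bev: "B u \<in> events" for u unfolding B_def by auto
  have eq: "{\<omega> \<in> space M. \<not> chained m \<eta> (sample_path W n k j \<omega>)} = (\<Union>u. B u)"
  proof (intro equalityI subsetI)
    fix \<omega> assume "\<omega> \<in> {\<omega> \<in> space M. \<not> chained m \<eta> (sample_path W n k j \<omega>)}"
    then obtain p i where *: "\<omega> \<in> space M" "p \<ge> m" "i < 2 ^ p"
      "\<eta> * (7 / 8) ^ (p - m) < norm (dyadic_incr p (sample_path W n k j \<omega>) i)"
      unfolding chained_def by (auto simp: not_le)
    then have "\<omega> \<in> B (p - m)" unfolding B_def D_def by auto
    then show "\<omega> \<in> (\<Union>u. B u)" by blast
  next
    fix \<omega> assume "\<omega> \<in> (\<Union>u. B u)"
    then obtain u i where *: "\<omega> \<in> space M" "i < 2 ^ (m + u)"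
      "\<eta> * (7 / 8) ^ u < norm (dyadic_incr (m + u) (sample_path W n k j \<omega>) i)"
      unfolding B_def D_def by auto
    then have "\<not> chained m \<eta> (sample_path W n k j \<omega>)"
      unfolding chained_def not_all not_imp by (intro exI[of _ "m + u"] exI[of _ i] conjI) auto
    then show "\<omega> \<in> {\<omega> \<in> space M. \<not> chained m \<eta> (sample_path W n k j \<omega>)}" using * by simp
  qed
  then show "{\<omega> \<in> space M. \<not> chained m \<eta> (sample_path W n k j \<omega>)} \<in> events" using Bev by auto
  \<comment> \<open>The rate satisfies n A >= 4, hence n A u / 2 >= 2 u, which beats the 2 ^ u increments at level m + u.\<close>
  have n1: "real n \<ge> 1" using nk by simp
  have A4: "A \<ge> 4" using eta by (simp add: A_def)
  have nA: "real n * A \<ge> 4" using mult_mono[of 1 "real n" 4 A] n1 A4 by simp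
  have Dp: "prob (D u i) \<le> C * (exp (- A * real n) * (1 / 4) ^ u)" if "i < 2 ^ (m + u)" for u i
  proof -
    have "prob (D u i) \<le> C * exp (- (real n * (\<eta> * (7 / 8) ^ u)\<^sup>2 * 2 ^ (m + u) / 4))"
      unfolding D_def C_def using eta by (intro dyadic_incr_tail[OF nk that]) auto
    also have "real n * (\<eta> * (7 / 8) ^ u)\<^sup>2 * 2 ^ (m + u) / 4 = real n * A * (49 / 32) ^ u"
    proof -
      have "(49 / 32 :: real) ^ u = ((7 / 8) ^ u)\<^sup>2 * 2 ^ u"
        by (simp add: power_mult_distrib[symmetric] power2_eq_square)
      then show ?thesis by (simp add: A_def power_mult_distrib power_add)
    qed
    also have "C * exp (- (real n * A * (49 / 32) ^ u)) \<le> C * (exp (- A * real n) * (1 / 4) ^ u)"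
    proof (rule mult_left_mono)
      \<comment> \<open>49/32 = 2 (7/8)^2 exceeds 1, so the exponent grows at least linearly in u.\<close>
      have "1 + real u * (17 / 32) \<le> (1 + 17 / 32 :: real) ^ u" by (rule Bernoulli_inequality) simp
      then have "real n * A * (1 + real u / 2) \<le> real n * A * (49 / 32) ^ u"
        using n1 A4 by (intro mult_left_mono) auto
      moreover have "real n * A + 2 * real u \<le> real n * A * (1 + real u / 2)"
        using mult_right_mono[OF nA, of "real u / 2"] by (simp add: algebra_simps)
      ultimately have "exp (- (real n * A * (49 / 32) ^ u)) \<le> exp (- (real n * A) - 2 * real u)" by simp
      also have "\<dots> = exp (- (real n * A)) * exp (- 2) ^ u"
        by (simp add: exp_diff exp_minus exp_of_nat_mult[symmetric] field_simps)
      also have "\<dots> \<le> exp (- (real n * A)) * (1 / 4) ^ u"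
      proof (intro mult_left_mono power_mono)
        have "(2 :: real) \<le> exp 1" using exp_ge_add_one_self[of 1] by simp
        then have "(2 :: real) * 2 \<le> exp 1 * exp 1" by (intro mult_mono) auto
        then have "4 \<le> exp (2 :: real)" by (simp add: mult_exp_exp)
        then show "exp (- 2 :: real) \<le> 1 / 4" by (simp add: exp_minus field_simps)
      qed auto
      finally show "exp (- (real n * A * (49 / 32) ^ u)) \<le> exp (- A * real n) * (1 / 4) ^ u" by (simp add: mult.commute)
    qed (simp add: C_def)
    finally show ?thesis .
  qed
  define K where "K = 2 ^ m * C * exp (- A * real n)"
  have Bp: "prob (B u) \<le> K * (1 / 2) ^ u" for u
  proof -
    have "prob (B u) \<le> (\<Sum>i<2 ^ (m + u). prob (D u i))"
      unfolding B_def using Dev by (intro finite_measure_subadditive_finite) auto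
    also have "\<dots> \<le> (\<Sum>i<(2::nat) ^ (m + u). C * (exp (- A * real n) * (1 / 4) ^ u))"
      using Dp by (intro sum_mono) auto
    also have "\<dots> = K * (2 ^ u * (1 / 4) ^ u)" by (simp add: K_def power_add)
    also have "(2 :: real) ^ u * (1 / 4) ^ u = (1 / 2) ^ u" by (simp add: power_mult_distrib[symmetric])
    finally show ?thesis .
  qed
  have sK: "summable (\<lambda>u. K * (1 / 2 :: real) ^ u)" by (intro summable_mult summable_geometric) simp
  have sB: "summable (\<lambda>u. prob (B u))"
    by (rule summable_comparison_test_ev[OF _ sK]) (use Bp in auto)
  have "prob (\<Union>u. B u) \<le> (\<Sum>u. prob (B u))"
    using Bev sB by (intro finite_measure_subadditive_countably) auto
  also have "\<dots> \<le> (\<Sum>u. K * (1 / 2) ^ u)" using Bp sB sK by (intro suminf_le)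
  also have "\<dots> = K * 2" using suminf_geometric[of "1 / 2 :: real"] by (subst suminf_mult) (auto intro: summable_geometric)
  finally show "prob {\<omega> \<in> space M. \<not> chained m \<eta> (sample_path W n k j \<omega>)}
      \<le> 2 ^ Suc m * (sqrt 2) ^ CARD('d) * exp (- (\<eta>\<^sup>2 * 2 ^ m / 4) * real n)"
    unfolding eq by (simp add: K_def C_def A_def mult_ac)
qed

end

text \<open>
  The exponential rate at which a sample path has level \<open>q\<close> increments within \<open>\<delta>\<close> of those of \<open>\<psi>\<close>,
  as far as the minimum of the Gaussian density on the balls can tell. At \<open>\<delta> = 0\<close> it is half the energy.
\<close>
definition tube_rate :: "nat \<Rightarrow> (real \<Rightarrow> 'a::real_normed_vector) \<Rightarrow> real \<Rightarrow> real" where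
  "tube_rate q \<psi> \<delta> = 2 ^ q / 2 * (\<Sum>i<2 ^ q. (norm (dyadic_incr q \<psi> i) + \<delta>)\<^sup>2)"

lemma tube_rate_less:
  assumes "dyadic_energy q \<psi> / 2 < b" "e > 0"
  obtains \<delta> where "\<delta> \<in> \<rat>" "0 < \<delta>" "\<delta> < e" "tube_rate q \<psi> \<delta> < b"
proof -
  have "((\<lambda>\<delta>. tube_rate q \<psi> \<delta>) \<longlongrightarrow> tube_rate q \<psi> 0) (at_right 0)"
    unfolding tube_rate_def by (intro tendsto_intros)
  moreover have "tube_rate q \<psi> 0 < b" using assms(1) by (simp add: tube_rate_def dyadic_energy_def)
  ultimately have "\<forall>\<^sub>F \<delta> in at_right 0. tube_rate q \<psi> \<delta> < b" by (rule order_tendstoD)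
  then obtain d where d: "d > 0" "\<And>\<delta>. 0 < \<delta> \<Longrightarrow> \<delta> < d \<Longrightarrow> tube_rate q \<psi> \<delta> < b"
    unfolding eventually_at_right_field by auto
  obtain \<delta> where "\<delta> \<in> \<rat>" "0 < \<delta>" "\<delta> < min d e" using Rats_dense_in_real[of 0 "min d e"] d assms(2) by auto
  then show thesis using d(2)[of \<delta>] by (intro that) auto
qed

context brownian_motion begin

lemma grid_incr_ball_lower:
  assumes n: "n \<ge> 1" and l: "l < k * 2 ^ q" and d: "\<delta> \<ge> 0"
  shows "unit_ball_vol CARD('d) * (\<delta> / sqrt (2 * pi)) ^ CARD('d) * exp (- (2 ^ q / 2 * (norm y + \<delta>)\<^sup>2) * real n)
    \<le> prob (grid_incr W (k * 2 ^ q) l -` cball (y /\<^sub>R sqrt (real k / real n)) (\<delta> / sqrt (real k / real n)) \<inter> space M)"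
proof -
  have k: "k > 0" using l by (cases k) auto
  define s where "s = sqrt (real k / real n)"
  have s: "s > 0" using k n by (simp add: s_def)
  define \<sigma> where "\<sigma> = sqrt (1 / real (k * 2 ^ q))"
  have sg: "\<sigma> > 0" "\<sigma>\<^sup>2 = 1 / real (k * 2 ^ q)" using k by (simp_all add: \<sigma>_def)
  have s2: "s\<^sup>2 = real k / real n" using k n by (simp add: s_def)
  have "norm (y /\<^sub>R s) + \<delta> / s = (norm y + \<delta>) / s"
    using s by (simp add: divide_inverse algebra_simps)
  then have "(norm (y /\<^sub>R s) + \<delta> / s)\<^sup>2 / (2 * \<sigma>\<^sup>2) = (norm y + \<delta>)\<^sup>2 / s\<^sup>2 / (2 * \<sigma>\<^sup>2)"
    by (simp only: power_divide)
  also have "\<dots> = 2 ^ q / 2 * (norm y + \<delta>)\<^sup>2 * real n"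
    using k n by (simp add: s2 sg(2) field_simps)
  finally have ex: "- (norm (y /\<^sub>R s) + \<delta> / s)\<^sup>2 / (2 * \<sigma>\<^sup>2) = - (2 ^ q / 2 * (norm y + \<delta>)\<^sup>2) * real n" by simp
  have "\<delta> / sqrt (2 * pi) \<le> (1 / sqrt (2 * pi * \<sigma>\<^sup>2)) * (\<delta> / s)"
  proof -
    have "sqrt (2 * pi * \<sigma>\<^sup>2) * s = sqrt (2 * pi * (1 / real (k * 2 ^ q)) * (real k / real n))"
      unfolding s_def sg(2) real_sqrt_mult[symmetric] ..
    also have "2 * pi * (1 / real (k * 2 ^ q)) * (real k / real n) = 2 * pi * (1 / (2 ^ q * real n))"
      using k by simp
    also have "sqrt \<dots> \<le> sqrt (2 * pi * 1)"
    proof (intro real_sqrt_le_mono mult_left_mono)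
      have "1 * 1 \<le> 2 ^ q * real n" using n by (intro mult_mono) auto
      then show "1 / (2 ^ q * real n) \<le> 1" by simp
    qed auto
    finally have le: "sqrt (2 * pi * \<sigma>\<^sup>2) * s \<le> sqrt (2 * pi)" by simp
    have "0 < sqrt (2 * pi * \<sigma>\<^sup>2) * s" using s sg(1) by simp
    then have "\<delta> / sqrt (2 * pi) \<le> \<delta> / (sqrt (2 * pi * \<sigma>\<^sup>2) * s)"
      using d le by (intro frac_le) auto
    then show ?thesis by simp
  qed
  then have "(\<delta> / sqrt (2 * pi)) ^ CARD('d) \<le> ((1 / sqrt (2 * pi * \<sigma>\<^sup>2)) * (\<delta> / s)) ^ CARD('d)"
    using d by (intro power_mono) auto
  also have "\<dots> = (1 / sqrt (2 * pi * \<sigma>\<^sup>2)) ^ CARD('d) * (\<delta> / s) ^ CARD('d)" by (rule power_mult_distrib)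
  finally have "unit_ball_vol CARD('d) * (\<delta> / sqrt (2 * pi)) ^ CARD('d) * exp (- (norm (y /\<^sub>R s) + \<delta> / s)\<^sup>2 / (2 * \<sigma>\<^sup>2))
     \<le> unit_ball_vol CARD('d) * ((1 / sqrt (2 * pi * \<sigma>\<^sup>2)) ^ CARD('d) * (\<delta> / s) ^ CARD('d)) * exp (- (norm (y /\<^sub>R s) + \<delta> / s)\<^sup>2 / (2 * \<sigma>\<^sup>2))"
    by (intro mult_right_mono mult_left_mono) (auto intro: less_imp_le)
  also have "\<dots> = (1 / sqrt (2 * pi * \<sigma>\<^sup>2)) ^ CARD('d) * exp (- (norm (y /\<^sub>R s) + \<delta> / s)\<^sup>2 / (2 * \<sigma>\<^sup>2)) *
     (unit_ball_vol CARD('d) * (\<delta> / s) ^ CARD('d))" by (simp only: mult_ac)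
  also have "\<dots> \<le> prob (grid_incr W (k * 2 ^ q) l -` cball (y /\<^sub>R s) (\<delta> / s) \<inter> space M)"
    using gaussian_ball_lower[OF grid_incr_distributed[OF l, folded \<sigma>_def] sg(1) _ prob_space_axioms, of "\<delta> / s" "y /\<^sub>R s"] d s
    by simp
  finally show ?thesis unfolding ex unfolding s_def .
qed

text \<open>
  Whether block \<open>j\<close> lies in the tube depends only on the grid increments with indices in \<open>I j\<close>. These
  index sets are disjoint, so independence of the grid increments makes both the probability of one
  event and the joint probability of two of them a product over grid increments.
\<close>
lemma tube_events:
  fixes \<psi> :: "real \<Rightarrow> real ^ 'd" and q :: nat
  assumes n: "n \<ge> 1" and k: "k \<ge> 1" and d: "\<delta> > 0"
  defines "A \<equiv> \<lambda>j. {\<omega> \<in> space M. \<forall>i<2 ^ q. norm (dyadic_incr q (sample_path W n k j \<omega>) i - dyadic_incr q \<psi> i) \<le> \<delta>}"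
  shows "\<And>j. j \<in> {1..k} \<Longrightarrow> A j \<in> events"
    and "\<And>j. j \<in> {1..k} \<Longrightarrow> (unit_ball_vol CARD('d) * (\<delta> / sqrt (2 * pi)) ^ CARD('d)) ^ 2 ^ q * exp (- tube_rate q \<psi> \<delta> * real n) \<le> prob (A j)"
    and "\<And>i j. i \<in> {1..k} \<Longrightarrow> j \<in> {1..k} \<Longrightarrow> i \<noteq> j \<Longrightarrow> prob (A i \<inter> A j) = prob (A i) * prob (A j)"
proof -
  define N where "N = k * 2 ^ q"
  define s where "s = sqrt (real k / real n)"
  have s: "s > 0" using k n by (simp add: s_def)
  \<comment> \<open>The position of a grid index within its block is its residue modulo 2 ^ q.\<close>
  define S where "S l = cball (dyadic_incr q \<psi> (l mod 2 ^ q) /\<^sub>R s) (\<delta> / s)" for l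
  define E where "E l = grid_incr W N l -` S l \<inter> space M" for l
  define f where "f j i = (j - 1) * 2 ^ q + i" for j i :: nat
  have fm: "f j i mod 2 ^ q = i" "f j i div 2 ^ q = j - 1" if "i < 2 ^ q" for i j
    using that by (simp_all add: f_def)
  define I where "I j = f j ` {..<2 ^ q}" for j
  have I: "I j \<subseteq> {..<N}" if "j \<in> {1..k}" for j
    using block_index_less[OF that, of _ q] by (auto simp: I_def N_def f_def)
  have Ifin: "finite (I j)" "I j \<noteq> {}" for j by (auto simp: I_def lessThan_empty_iff)
  have Idisj: "I i \<inter> I j = {}" if "i \<in> {1..k}" "j \<in> {1..k}" "i \<noteq> j" for i j
  proof (rule ccontr)
    assume "I i \<inter> I j \<noteq> {}"
    then obtain a b where ab: "a < 2 ^ q" "b < 2 ^ q" "f i a = f j b" by (auto simp: I_def)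
    then have "i - 1 = j - 1" using fm(2)[of a i] fm(2)[of b j] by simp
    then show False using that by auto
  qed
  have inj: "inj_on (f j) {..<2 ^ q}" for j by (auto simp: inj_on_def f_def)
  have Eev: "E l \<in> events" if "l < N" for l
    unfolding E_def using grid_incr_measurable[OF that] by (rule measurable_sets) (simp add: S_def)
  have AE: "A j = (\<Inter>l\<in>I j. E l)" if j: "j \<in> {1..k}" for j
  proof -
    have eq: "norm (dyadic_incr q (sample_path W n k j \<omega>) i - dyadic_incr q \<psi> i) \<le> \<delta> \<longleftrightarrow> grid_incr W N (f j i) \<omega> \<in> S (f j i)"
      if i: "i < 2 ^ q" for i \<omega>
    proof -
      have e: "dyadic_incr q \<psi> i /\<^sub>R s - grid_incr W N (f j i) \<omega> = (dyadic_incr q \<psi> i - s *\<^sub>R grid_incr W N (f j i) \<omega>) /\<^sub>R s"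
        using s by (simp add: scaleR_diff_right)
      have "grid_incr W N (f j i) \<omega> \<in> S (f j i) \<longleftrightarrow> norm (dyadic_incr q \<psi> i /\<^sub>R s - grid_incr W N (f j i) \<omega>) \<le> \<delta> / s"
        by (simp add: S_def fm[OF i] dist_norm)
      also have "\<dots> \<longleftrightarrow> norm (dyadic_incr q \<psi> i - s *\<^sub>R grid_incr W N (f j i) \<omega>) / s \<le> \<delta> / s"
        unfolding e using s by (simp add: divide_inverse mult.commute)
      also have "\<dots> \<longleftrightarrow> norm (dyadic_incr q \<psi> i - s *\<^sub>R grid_incr W N (f j i) \<omega>) \<le> \<delta>"
        using s by (simp add: divide_le_cancel)
      finally show ?thesis
        unfolding dyadic_incr_sample_path[OF n k j i] s_def[symmetric] N_def[symmetric] f_def[symmetric]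
        by (simp add: norm_minus_commute)
    qed
    have "A j = {\<omega> \<in> space M. \<forall>i<2 ^ q. grid_incr W N (f j i) \<omega> \<in> S (f j i)}"
      unfolding A_def using eq by blast
    also have "\<dots> = (\<Inter>i<2 ^ q. E (f j i))" unfolding E_def by (auto simp: lessThan_empty_iff)
    also have "\<dots> = (\<Inter>l\<in>I j. E l)" unfolding I_def by simp
    finally show ?thesis .
  qed
  show "A j \<in> events" if "j \<in> {1..k}" for j
    unfolding AE[OF that] using Ifin I[OF that] Eev by (intro sets.finite_INT) auto
  have prodE: "prob (\<Inter>l\<in>J. E l) = (\<Prod>l\<in>J. prob (E l))" if "J \<subseteq> {..<N}" "J \<noteq> {}" "finite J" for J
    unfolding E_def using that by (intro indep_varsD[OF grid_incr_indep]) (auto simp: S_def)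
  show "prob (A i \<inter> A j) = prob (A i) * prob (A j)" if ij: "i \<in> {1..k}" "j \<in> {1..k}" "i \<noteq> j" for i j
  proof -
    have "A i \<inter> A j = (\<Inter>l\<in>I i \<union> I j. E l)" unfolding AE[OF ij(1)] AE[OF ij(2)] by auto
    then have "prob (A i \<inter> A j) = (\<Prod>l\<in>I i \<union> I j. prob (E l))"
      using prodE[of "I i \<union> I j"] I[OF ij(1)] I[OF ij(2)] Ifin by simp
    also have "\<dots> = (\<Prod>l\<in>I i. prob (E l)) * (\<Prod>l\<in>I j. prob (E l))"
      using Ifin Idisj[OF ij] by (intro prod.union_disjoint)
    also have "\<dots> = prob (A i) * prob (A j)"
      unfolding AE[OF ij(1)] AE[OF ij(2)] using prodE[OF I[OF ij(1)] Ifin(2,1)] prodE[OF I[OF ij(2)] Ifin(2,1)] by simp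
    finally show ?thesis .
  qed
  define c where "c = unit_ball_vol CARD('d) * (\<delta> / sqrt (2 * pi)) ^ CARD('d)"
  have c: "c > 0" using d by (simp add: c_def)
  show "c ^ 2 ^ q * exp (- tube_rate q \<psi> \<delta> * real n) \<le> prob (A j)" if j: "j \<in> {1..k}" for j
  proof -
    define g where "g i = 2 ^ q / 2 * (norm (dyadic_incr q \<psi> i) + \<delta>)\<^sup>2" for i
    have "c ^ 2 ^ q * exp (- tube_rate q \<psi> \<delta> * real n) = (\<Prod>i<(2::nat) ^ q. c * exp (- g i * real n))"
    proof -
      have "tube_rate q \<psi> \<delta> = (\<Sum>i<2 ^ q. g i)" by (simp add: tube_rate_def g_def sum_distrib_left)
      moreover have "(\<Prod>i<(2::nat) ^ q. exp (- g i * real n)) = exp (- (\<Sum>i<2 ^ q. g i) * real n)"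
        by (simp add: exp_sum[symmetric] sum_negf sum_distrib_right)
      ultimately show ?thesis unfolding prod.distrib by simp
    qed
    also have "\<dots> \<le> (\<Prod>i<2 ^ q. prob (E (f j i)))"
    proof (rule prod_mono, intro conjI)
      fix i :: nat assume "i \<in> {..<2 ^ q}"
      then have i: "i < 2 ^ q" by simp
      then have l: "f j i < k * 2 ^ q" unfolding f_def by (rule block_index_less[OF j])
      show "c * exp (- g i * real n) \<le> prob (E (f j i))"
        using grid_incr_ball_lower[OF n l, of \<delta> "dyadic_incr q \<psi> i"] d
        unfolding E_def S_def fm[OF i] N_def s_def c_def g_def by simp
    qed (use c in auto)
    also have "\<dots> = (\<Prod>l\<in>I j. prob (E l))" unfolding I_def by (simp add: prod.reindex[OF inj])
    also have "\<dots> = prob (A j)" unfolding AE[OF j] using prodE[OF I[OF j] Ifin(2,1)] by simp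
    finally show ?thesis .
  qed
qed

context
  fixes k :: "nat \<Rightarrow> nat"
  assumes k: "\<And>n. n \<ge> 1 \<Longrightarrow> k n \<ge> 1"
begin

lemma AE_few_high_energy:
  assumes "b < a"
  shows "AE \<omega> in M. \<forall>\<^sub>F n in sequentially.
    real (card {j \<in> {1..k n}. 2 * a < dyadic_energy q (sample_path W n (k n) j \<omega>)}) \<le> real (k n) * exp (- b * real n)"
proof -
  \<comment> \<open>For negative b the trivial bound is enough; it also covers a \<le> 0.\<close>
  obtain c where c: "0 \<le> c" "c < 1" "b < c * a"
  proof (cases "b < 0")
    case True
    then show thesis by (intro that[of 0]) auto
  next
    case False
    then have a: "a > 0" using assms by linarith
    show thesis
    proof (rule that)
      show "0 \<le> (b + a) / (2 * a)" using a False by simp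
      show "(b + a) / (2 * a) < 1" using a assms by simp
      have "(b + a) / (2 * a) * a = (b + a) / 2" using a by simp
      then show "b < (b + a) / (2 * a) * a" using assms by simp
    qed
  qed
  define B where "B n j = {\<omega> \<in> space M. 2 * a < dyadic_energy q (sample_path W n (k n) j \<omega>)}" for n j
  have "AE \<omega> in M. \<forall>\<^sub>F n in sequentially. real (card {j \<in> {1..k n}. \<omega> \<in> B n j}) \<le> real (k n) * exp (- b * real n)"
  proof (rule eventually_few_events[OF k _ _ c(3)])
    fix n j assume nj: "n \<ge> 1" "j \<in> {1..k n}"
    show "B n j \<in> events" unfolding B_def by (rule sample_energy_tail(1)[OF nj(1) k[OF nj(1)] nj(2) c(1,2)])
    show "prob (B n j) \<le> ((1 / sqrt (1 - c)) ^ CARD('d)) ^ 2 ^ q * exp (- (c * a) * real n)"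
      unfolding B_def by (rule sample_energy_tail(2)[OF nj(1) k[OF nj(1)] nj(2) c(1,2)])
  qed
  then show ?thesis
    using AE_space by eventually_elim (simp add: B_def)
qed

lemma AE_few_not_chained:
  assumes "\<eta> \<ge> 0" "16 \<le> \<eta>\<^sup>2 * 2 ^ m" "b < \<eta>\<^sup>2 * 2 ^ m / 4"
  shows "AE \<omega> in M. \<forall>\<^sub>F n in sequentially.
    real (card {j \<in> {1..k n}. \<not> chained m \<eta> (sample_path W n (k n) j \<omega>)}) \<le> real (k n) * exp (- b * real n)"
proof -
  define B where "B n j = {\<omega> \<in> space M. \<not> chained m \<eta> (sample_path W n (k n) j \<omega>)}" for n j
  have "AE \<omega> in M. \<forall>\<^sub>F n in sequentially. real (card {j \<in> {1..k n}. \<omega> \<in> B n j}) \<le> real (k n) * exp (- b * real n)"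
  proof (rule eventually_few_events[OF k _ _ assms(3)])
    fix n j assume nj: "n \<ge> 1" "j \<in> {1..k n}"
    show "B n j \<in> events" unfolding B_def by (rule not_chained_tail(1)[OF nj(1) k[OF nj(1)] nj(2) assms(1,2)])
    show "prob (B n j) \<le> (2 ^ Suc m * (sqrt 2) ^ CARD('d)) * exp (- (\<eta>\<^sup>2 * 2 ^ m / 4) * real n)"
      unfolding B_def by (rule not_chained_tail(2)[OF nj(1) k[OF nj(1)] nj(2) assms(1,2)])
  qed
  then show ?thesis
    using AE_space by eventually_elim (simp add: B_def)
qed

lemma AE_many_in_tube:
  fixes \<psi> :: "real \<Rightarrow> real ^ 'd"
  assumes lim: "filterlim (\<lambda>n. ln (real (k n)) / real n) at_top sequentially" and d: "\<delta> > 0"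
  shows "\<exists>c>0. AE \<omega> in M. \<forall>\<^sub>F n in sequentially.
    real (k n) * (c * exp (- tube_rate q \<psi> \<delta> * real n)) \<le>
    real (card {j \<in> {1..k n}. \<forall>i<2 ^ q. norm (dyadic_incr q (sample_path W n (k n) j \<omega>) i - dyadic_incr q \<psi> i) \<le> \<delta>})"
proof -
  define c where "c = (unit_ball_vol CARD('d) * (\<delta> / sqrt (2 * pi)) ^ CARD('d)) ^ 2 ^ q"
  have c: "c > 0" using d by (simp add: c_def)
  define A where "A n j = {\<omega> \<in> space M. \<forall>i<2 ^ q. norm (dyadic_incr q (sample_path W n (k n) j \<omega>) i - dyadic_incr q \<psi> i) \<le> \<delta>}" for n j
  have "AE \<omega> in M. \<forall>\<^sub>F n in sequentially. real (k n) * (c / 2 * exp (- tube_rate q \<psi> \<delta> * real n)) \<le> real (card {j \<in> {1..k n}. \<omega> \<in> A n j})"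
  proof (rule eventually_many_events[OF k lim _ _ _ c])
    fix n i j assume n: "n \<ge> 1" and j: "j \<in> {1..k n}"
    show "A n j \<in> events" unfolding A_def by (rule tube_events(1)[OF n k[OF n] d j])
    show "c * exp (- tube_rate q \<psi> \<delta> * real n) \<le> prob (A n j)"
      unfolding A_def c_def by (rule tube_events(2)[OF n k[OF n] d j])
    assume "i \<in> {1..k n}" "i \<noteq> j"
    then show "prob (A n i \<inter> A n j) = prob (A n i) * prob (A n j)"
      unfolding A_def by (intro tube_events(3)[OF n k[OF n] d] j)
  qed
  then have "AE \<omega> in M. \<forall>\<^sub>F n in sequentially.
    real (k n) * (c / 2 * exp (- tube_rate q \<psi> \<delta> * real n)) \<le>
    real (card {j \<in> {1..k n}. \<forall>i<2 ^ q. norm (dyadic_incr q (sample_path W n (k n) j \<omega>) i - dyadic_incr q \<psi> i) \<le> \<delta>})"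
    using AE_space by eventually_elim (simp add: A_def)
  then show ?thesis using c by (intro exI[of _ "c / 2"]) auto
qed

end

end

section \<open>From block counts to the large deviation principle\<close>
lemma borel_of_simps [simp]:
  "space (borel_of Y) = topspace Y" "sets (borel_of Y) = sigma_sets (topspace Y) {U. openin Y U}"
proof -
  have "{U. openin Y U} \<subseteq> Pow (topspace Y)" using openin_subset by blast
  then show "space (borel_of Y) = topspace Y" "sets (borel_of Y) = sigma_sets (topspace Y) {U. openin Y U}"
    by (simp_all add: borel_of_def)
qed

lemma closedin_in_borel_of: "closedin Y C \<Longrightarrow> C \<in> sets (borel_of Y)"
proof -
  assume C: "closedin Y C"
  then have "topspace Y - C \<in> sets (borel_of Y)" by (auto intro: sigma_sets.Basic)
  then have "space (borel_of Y) - (topspace Y - C) \<in> sets (borel_of Y)" by (rule sets.compl_sets)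
  moreover have "space (borel_of Y) - (topspace Y - C) = C" using closedin_subset[OF C] by auto
  ultimately show ?thesis by simp
qed

text \<open>
  The measure is carried by finitely many points, and finite sets are closed. So every set differs from
  a finite one by a null set of the completion.
\<close>
lemma measure_completion_empirical_measure:
  fixes x :: "nat \<Rightarrow> 'a"
  assumes Y: "Hausdorff_space Y" and k: "k \<ge> 1" and x: "\<And>j. j \<in> {1..k} \<Longrightarrow> x j \<in> topspace Y" and G: "\<Gamma> \<subseteq> topspace Y"
  shows "measure (completion (empirical_measure (borel_of Y) k x)) \<Gamma> = real (card {j \<in> {1..k}. x j \<in> \<Gamma>}) / real k"
proof -
  let ?\<mu> = "empirical_measure (borel_of Y) k x"
  have fin: "A \<in> sets (borel_of Y)" if "finite A" "A \<subseteq> topspace Y" for A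
    using closedin_in_borel_of[OF closedin_Hausdorff_finite[OF Y that(2,1)]] .
  have em: "emeasure ?\<mu> A = ennreal (real (card {j \<in> {1..k}. x j \<in> A}) / real k)" if A: "A \<in> sets (borel_of Y)" for A
  proof -
    have "(\<Sum>j=1..k. emeasure (return (borel_of Y) (x j)) A) = (\<Sum>j=1..k. indicator A (x j))"
      using A by (intro sum.cong) auto
    also have "\<dots> = (\<Sum>j\<in>{j \<in> {1..k}. x j \<in> A}. 1)"
      by (intro sum.mono_neutral_cong_right) (auto simp: indicator_def)
    also have "\<dots> = of_nat (card {j \<in> {1..k}. x j \<in> A})" by simp
    finally show ?thesis
      unfolding emeasure_empirical_measure[OF A] using k by (simp add: divide_ennreal ennreal_of_nat_eq_real_of_nat)
  qed
  define S where "S = \<Gamma> \<inter> x ` {1..k}"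
  \<comment> \<open>The complement of the atoms, a null set.\<close>
  define R where "R = topspace Y - x ` {1..k}"
  have X: "x ` {1..k} \<in> sets (borel_of Y)" using x by (intro fin) auto
  have S: "S \<in> sets (borel_of Y)" unfolding S_def using x by (intro fin) auto
  have R: "R \<in> sets (borel_of Y)" unfolding R_def using sets.compl_sets[OF X] by simp
  have "{j \<in> {1..k}. x j \<in> R} = {}" by (auto simp: R_def)
  then have "emeasure ?\<mu> R = 0" unfolding em[OF R] by simp
  then have "R \<in> null_sets ?\<mu>" using R by (auto simp del: borel_of_simps)
  then have "R \<in> null_sets (completion ?\<mu>)" by (rule null_sets_completionI)
  then have N: "\<Gamma> - S \<in> null_sets (completion ?\<mu>)"
    using G by (intro null_sets_completion_subset[of "\<Gamma> - S" R]) (auto simp: S_def R_def)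
  have "emeasure (completion ?\<mu>) \<Gamma> = emeasure (completion ?\<mu>) (S \<union> (\<Gamma> - S))"
    by (simp add: S_def Un_absorb1 Int_Un_distrib Un_Diff_Int Int_commute)
  also have "\<dots> = emeasure (completion ?\<mu>) S"
    using S N by (intro emeasure_Un_null_set) (auto simp del: borel_of_simps)
  also have "\<dots> = emeasure ?\<mu> S" using S by (simp del: borel_of_simps)
  also have "\<dots> = ennreal (real (card {j \<in> {1..k}. x j \<in> S}) / real k)" by (rule em[OF S])
  also have "{j \<in> {1..k}. x j \<in> S} = {j \<in> {1..k}. x j \<in> \<Gamma>}" by (auto simp: S_def)
  finally show ?thesis by (simp add: measure_def)
qed

lemma elog_scaled_le:
  assumes "n \<ge> 1" "0 \<le> p" "p \<le> exp (y * real n)"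
  shows "ereal (1 / real n) * elog p \<le> ereal y"
proof (cases "p = 0")
  case True
  then show ?thesis using assms by (simp add: elog_def)
next
  case False
  then have "ln p \<le> ln (exp (y * real n))" using assms by (subst ln_le_cancel_iff) auto
  then have "ln p \<le> y * real n" by simp
  then show ?thesis using assms False by (simp add: elog_def pos_divide_le_eq mult.commute)
qed

lemma elog_scaled_ge:
  assumes "n \<ge> 1" "exp (y * real n) \<le> p"
  shows "ereal y \<le> ereal (1 / real n) * elog p"
proof -
  have p: "p > 0" using assms(2) by (rule less_le_trans[OF exp_gt_zero])
  then have "y * real n \<le> ln p" using assms by (simp add: ln_ge_iff)
  then show ?thesis using assms p by (simp add: elog_def pos_le_divide_eq)
qed

lemma eventually_mult_exp_le:
  fixes c b y :: real
  assumes "b < y"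
  shows "\<forall>\<^sub>F n in sequentially. c * exp (b * real n) \<le> exp (y * real n)"
proof -
  obtain N :: nat where N: "real N > c / (y - b)" using reals_Archimedean2 by blast
  show ?thesis using eventually_ge_at_top[of N]
  proof eventually_elim
    case (elim n)
    then have "c / (y - b) \<le> real n" using N by linarith
    then have "c \<le> (y - b) * real n" using assms by (simp add: pos_divide_le_eq mult.commute)
    also have "\<dots> \<le> exp ((y - b) * real n)" using exp_ge_add_one_self[of "(y - b) * real n"] by linarith
    finally have "c * exp (b * real n) \<le> exp ((y - b) * real n) * exp (b * real n)" by (intro mult_right_mono) auto
    also have "\<dots> = exp (y * real n)" by (simp add: mult_exp_exp algebra_simps)
    finally show ?case .
  qed
qed

lemma Rats_dense_ereal:
  fixes a :: real
  assumes "ereal a < z"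
  obtains q where "q \<in> \<rat>" "a < q" "ereal q < z"
proof -
  obtain x where x: "ereal a < ereal x" "ereal x < z" using ereal_dense2[OF assms] by blast
  then obtain q where "q \<in> \<rat>" "a < q" "q < x" using Rats_dense_in_real[of a x] by auto
  then show thesis using less_trans[of "ereal q" "ereal x" z] x(2) by (intro that[of q]) auto
qed

lemma exists_fine_level:
  fixes \<eta> c :: real
  assumes "\<eta> > 0"
  obtains m :: nat where "c \<le> \<eta>\<^sup>2 * 2 ^ m"
proof -
  obtain m where "c / \<eta>\<^sup>2 < 2 ^ m" using real_arch_pow[of 2] by auto
  then have "c \<le> \<eta>\<^sup>2 * 2 ^ m" using assms by (simp add: pos_divide_less_eq mult.commute)
  then show thesis by (rule that)
qed

text \<open>
  The deterministic part of the proof: the three families of count estimates, for rational parameters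
  and countably many \<open>\<psi>\<close>, determine the exponential order of the empirical measures of all sets.
\<close>
lemma satisfies_LDP_of_counts:
  fixes x :: "nat \<Rightarrow> nat \<Rightarrow> real \<Rightarrow> real ^ 'd" and D :: "(real \<Rightarrow> real ^ 'd) set"
  assumes k: "\<And>n. n \<ge> 1 \<Longrightarrow> k n \<ge> 1"
    and x: "\<And>n j. n \<ge> 1 \<Longrightarrow> j \<in> {1..k n} \<Longrightarrow> x n j \<in> mspace C0"
    and D: "D \<subseteq> mspace C0"
    and dense: "\<And>\<phi> a r. \<phi> \<in> mspace C0 \<Longrightarrow> a \<in> \<rat> \<Longrightarrow> action \<phi> \<le> ereal a \<Longrightarrow> r > 0 \<Longrightarrow>
       \<exists>\<psi>\<in>D. action \<psi> \<le> ereal a \<and> mdist C0 \<psi> \<phi> < r"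
    and energy: "\<And>a b q. a \<in> \<rat> \<Longrightarrow> b \<in> \<rat> \<Longrightarrow> b < a \<Longrightarrow> \<forall>\<^sub>F n in sequentially.
       real (card {j \<in> {1..k n}. 2 * a < dyadic_energy q (x n j)}) \<le> real (k n) * exp (- b * real n)"
    and chain: "\<And>\<eta> b m. \<eta> \<in> \<rat> \<Longrightarrow> b \<in> \<rat> \<Longrightarrow> 0 \<le> \<eta> \<Longrightarrow> 16 \<le> \<eta>\<^sup>2 * 2 ^ m \<Longrightarrow> b < \<eta>\<^sup>2 * 2 ^ m / 4 \<Longrightarrow> \<forall>\<^sub>F n in sequentially.
       real (card {j \<in> {1..k n}. \<not> chained m \<eta> (x n j)}) \<le> real (k n) * exp (- b * real n)"
    and tube: "\<And>\<psi> q \<delta>. \<psi> \<in> D \<Longrightarrow> \<delta> \<in> \<rat> \<Longrightarrow> 0 < \<delta> \<Longrightarrow> \<exists>c>0. \<forall>\<^sub>F n in sequentially.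
       real (k n) * (c * exp (- tube_rate q \<psi> \<delta> * real n)) \<le>
       real (card {j \<in> {1..k n}. \<forall>i<2 ^ q. norm (dyadic_incr q (x n j) i - dyadic_incr q \<psi> i) \<le> \<delta>})"
  shows "satisfies_LDP (mtopology_of C0) (\<lambda>n. empirical_measure (borel_of (mtopology_of C0)) (k n) (x n)) action"
proof -
  let ?Y = "mtopology_of (C0 :: (real \<Rightarrow> real ^ 'd) metric)"
  let ?\<mu> = "\<lambda>n. empirical_measure (borel_of ?Y) (k n) (x n)"
  interpret Metric_space "mspace (C0 :: (real \<Rightarrow> real ^ 'd) metric)" "mdist C0" by (rule Metric_space_mspace_mdist)
  have Y: "Hausdorff_space ?Y" unfolding mtopology_of_def by (rule Hausdorff_space_mtopology)
  have top: "topspace ?Y = mspace C0" by simp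
  define cnt where "cnt n G = real (card {j \<in> {1..k n}. x n j \<in> G})" for n G
  have main: "- (INF y\<in>?Y interior_of G. action y) \<le> liminf (\<lambda>n. ereal (1 / real n) * elog (measure (completion (?\<mu> n)) G))"
    "limsup (\<lambda>n. ereal (1 / real n) * elog (measure (completion (?\<mu> n)) G)) \<le> - (INF y\<in>?Y closure_of G. action y)"
    if G: "G \<subseteq> mspace C0" for G
  proof -
    define r where "r n = ereal (1 / real n) * elog (measure (completion (?\<mu> n)) G)" for n
    have r: "r n = ereal (1 / real n) * elog (cnt n G / real (k n))" if "n \<ge> 1" for n
      using measure_completion_empirical_measure[OF Y k[OF that], of "x n" G] x[OF that] G by (simp add: r_def cnt_def)
    have cnt: "0 \<le> cnt n G / real (k n)" "cnt n G / real (k n) \<le> 1" if "n \<ge> 1" for n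
    proof -
      have "card {j \<in> {1..k n}. x n j \<in> G} \<le> card {1..k n}" by (intro card_mono) auto
      then show "0 \<le> cnt n G / real (k n)" "cnt n G / real (k n) \<le> 1" using k[OF that] by (auto simp: cnt_def)
    qed
    have low: "ereal (- \<beta>) \<le> liminf r" if \<beta>: "(INF y\<in>?Y interior_of G. action y) < ereal \<beta>" for \<beta>
    proof -
      obtain \<phi> where \<phi>: "\<phi> \<in> ?Y interior_of G" "action \<phi> < ereal \<beta>" using \<beta> by (auto simp: INF_less_iff)
      have \<phi>C: "\<phi> \<in> mspace C0" using \<phi>(1) interior_of_subset_topspace[of ?Y G] by auto
      obtain a0 where a0: "action \<phi> = ereal a0" using \<phi>(2) action_nonneg[of \<phi>] by (cases "action \<phi>") auto
      then obtain a where a: "a \<in> \<rat>" "a0 < a" "a < \<beta>" using Rats_dense_in_real[of a0 \<beta>] \<phi>(2) by auto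
      obtain b where b: "b \<in> \<rat>" "a < b" "b < \<beta>" using Rats_dense_in_real[of a \<beta>] a by auto
      have "openin ?Y (?Y interior_of G)" by simp
      then obtain R where R: "R > 0" "mball \<phi> R \<subseteq> ?Y interior_of G"
        using \<phi>(1) unfolding mtopology_of_def openin_mtopology by blast
      have "action \<phi> \<le> ereal a" using a0 a by simp
      then obtain \<psi> where \<psi>: "\<psi> \<in> D" "action \<psi> \<le> ereal a" "mdist C0 \<psi> \<phi> < R / 2"
        using dense[OF \<phi>C a(1), of "R / 2"] R(1) by auto
      have \<psi>C: "\<psi> \<in> mspace C0" using \<psi>(1) D by auto
      have E: "dyadic_energy p \<psi> \<le> 2 * a" for p using \<psi>(2) action_le_iff[OF \<psi>C] by simp
      \<comment> \<open>A chained path in the tube is within 9 \<eta> < R / 2 of \<psi>, hence within R of \<phi>.\<close>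
      obtain \<eta> where \<eta>: "\<eta> \<in> \<rat>" "0 < \<eta>" "\<eta> < R / 18" using Rats_dense_in_real[of 0 "R / 18"] R(1) by auto
      \<comment> \<open>Fine enough for the tail bound, for the Hoelder modulus of \<psi> on a cell, and for the paths that
        are not chained to be rarer than exp (- \<beta> n).\<close>
      obtain m where "max 16 (max (2 * a) (4 * \<beta>)) \<le> \<eta>\<^sup>2 * 2 ^ m"
        by (rule exists_fine_level[OF \<eta>(2)])
      then have m: "16 \<le> \<eta>\<^sup>2 * 2 ^ m" "2 * a \<le> \<eta>\<^sup>2 * 2 ^ m" "4 * \<beta> \<le> \<eta>\<^sup>2 * 2 ^ m" by auto
      have "dyadic_energy m \<psi> / 2 < b" using E[of m] b by simp
      moreover have "\<eta> / 2 ^ m > 0" using \<eta> by simp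
      ultimately obtain \<delta> where \<delta>: "\<delta> \<in> \<rat>" "0 < \<delta>" "\<delta> < \<eta> / 2 ^ m" "tube_rate m \<psi> \<delta> < b" by (rule tube_rate_less)
      \<comment> \<open>Not-chained paths are removed at a rate b' strictly between the tube rate and \<beta>.\<close>
      obtain b' where b': "b' \<in> \<rat>" "b < b'" "b' < \<beta>" using Rats_dense_in_real[of b \<beta>] b by auto
      obtain c where c: "c > 0" and ct: "\<forall>\<^sub>F n in sequentially.
         real (k n) * (c * exp (- tube_rate m \<psi> \<delta> * real n)) \<le>
         real (card {j \<in> {1..k n}. \<forall>i<2 ^ m. norm (dyadic_incr m (x n j) i - dyadic_incr m \<psi> i) \<le> \<delta>})"
        using tube[OF \<psi>(1) \<delta>(1,2), of m] by auto
      have cc: "\<forall>\<^sub>F n in sequentially. real (card {j \<in> {1..k n}. \<not> chained m \<eta> (x n j)}) \<le> real (k n) * exp (- b' * real n)"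
        using m b' \<eta> by (intro chain) auto
      have "\<forall>\<^sub>F n in sequentially. (2 / c) * exp (- b' * real n) \<le> exp (- tube_rate m \<psi> \<delta> * real n)"
        using b' \<delta>(4) by (intro eventually_mult_exp_le) simp
      moreover have "\<forall>\<^sub>F n in sequentially. 1 * exp (- \<beta> * real n) \<le> exp (- b' * real n)"
        using b' by (intro eventually_mult_exp_le) simp
      ultimately have "\<forall>\<^sub>F n in sequentially. ereal (- \<beta>) \<le> r n"
        using ct cc eventually_ge_at_top[of 1]
      proof eventually_elim
        case (elim n)
        note n = \<open>1 \<le> n\<close>
        have kn: "real (k n) > 0" using k[OF n] by simp
        let ?T = "{j \<in> {1..k n}. \<forall>i<2 ^ m. norm (dyadic_incr m (x n j) i - dyadic_incr m \<psi> i) \<le> \<delta>}"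
        let ?U = "{j \<in> {1..k n}. \<not> chained m \<eta> (x n j)}"
        let ?V = "{j \<in> {1..k n}. x n j \<in> G}"
        have "?T \<subseteq> ?U \<union> ?V"
        proof (rule subsetI, rule ccontr)
          fix j assume j: "j \<in> ?T" "j \<notin> ?U \<union> ?V"
          then have j': "j \<in> {1..k n}" "chained m \<eta> (x n j)" "x n j \<notin> G" by auto
          have xC: "x n j \<in> mspace C0" using x[OF n j'(1)] .
          have "mdist C0 \<psi> (x n j) \<le> 9 * \<eta>"
          proof (rule chained_in_tube_near[OF xC \<psi>C j'(2) E])
            show "2 * a / 2 ^ m \<le> \<eta>\<^sup>2" using m(2) by (simp add: pos_divide_le_eq)
            show "norm (dyadic_incr m (x n j) i - dyadic_incr m \<psi> i) \<le> \<eta> / 2 ^ m" if "i < 2 ^ m" for i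
              using j(1) that \<delta>(3) by (auto intro: order_trans less_imp_le)
          qed
          then have "mdist C0 \<phi> (x n j) < R"
            using triangle[OF \<phi>C \<psi>C xC] commute[of \<phi> \<psi>] \<psi>(3) \<eta>(3) by linarith
          then have "x n j \<in> mball \<phi> R" using \<phi>C xC by simp
          then show False using R(2) interior_of_subset[of ?Y G] j'(3) by blast
        qed
        then have "card ?T \<le> card (?U \<union> ?V)" by (intro card_mono) auto
        also have "\<dots> \<le> card ?U + card ?V" by (rule card_Un_le)
        finally have "real (card ?T) \<le> real (card ?U) + cnt n G" unfolding cnt_def by linarith
        then have "real (k n) * (c * exp (- tube_rate m \<psi> \<delta> * real n)) \<le> real (k n) * exp (- b' * real n) + cnt n G"
          using elim by linarith
        moreover have "real (k n) * (2 * exp (- b' * real n)) \<le> real (k n) * (c * exp (- tube_rate m \<psi> \<delta> * real n))"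
          using kn c elim by (intro mult_left_mono) (auto simp: field_simps)
        ultimately have "real (k n) * exp (- b' * real n) \<le> cnt n G" by linarith
        moreover have "real (k n) * exp (- \<beta> * real n) \<le> real (k n) * exp (- b' * real n)"
          using kn elim by (intro mult_left_mono) auto
        ultimately have "real (k n) * exp (- \<beta> * real n) \<le> cnt n G" by linarith
        then have "exp (- \<beta> * real n) \<le> cnt n G / real (k n)" using kn by (simp add: pos_le_divide_eq mult.commute)
        then show ?case unfolding r[OF n] by (rule elog_scaled_ge[OF n])
      qed
      then show ?thesis by (rule Liminf_bounded)
    qed
    have "- (INF y\<in>?Y interior_of G. action y) \<le> liminf r"
    proof (rule ccontr)
      assume "\<not> ?thesis"
      then have "liminf r < - (INF y\<in>?Y interior_of G. action y)" by simp
      then obtain z where z: "liminf r < ereal z" "ereal z < - (INF y\<in>?Y interior_of G. action y)"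
        using ereal_dense2 by blast
      then have "(INF y\<in>?Y interior_of G. action y) < ereal (- z)" using iffD1[OF ereal_less_uminus_reorder z(2)] by (simp only: uminus_ereal.simps)
      from low[OF this] z(1) show False by simp
    qed
    then show "- (INF y\<in>?Y interior_of G. action y) \<le> liminf (\<lambda>n. ereal (1 / real n) * elog (measure (completion (?\<mu> n)) G))"
      unfolding r_def .
    have up: "limsup r \<le> ereal (- \<alpha>)" if \<alpha>: "ereal \<alpha> < (INF y\<in>?Y closure_of G. action y)" for \<alpha>
    proof -
      obtain a where a: "a \<in> \<rat>" "\<alpha> < a" "ereal a < (INF y\<in>?Y closure_of G. action y)" using Rats_dense_ereal[OF \<alpha>] by blast
      obtain b where b: "b \<in> \<rat>" "\<alpha> < b" "b < a" using Rats_dense_in_real[of \<alpha> a] a by auto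
      have "closedin ?Y (?Y closure_of G)" by simp
      moreover have "ereal a < action \<phi>" if "\<phi> \<in> ?Y closure_of G" for \<phi>
        using a(3) that by (auto intro: less_le_trans INF_lower)
      ultimately obtain \<rho> where \<rho>: "\<rho> > 0"
        "\<forall>f\<in>?Y closure_of G. \<forall>m \<eta>. chained m \<eta> f \<and> 8 * \<eta> < \<rho> \<longrightarrow> 2 * a < dyadic_energy m f"
        using closed_set_separation by blast
      \<comment> \<open>Rational parameters, so that the countably many almost sure estimates apply.\<close>
      obtain \<eta> where \<eta>: "\<eta> \<in> \<rat>" "0 < \<eta>" "\<eta> < \<rho> / 8" using Rats_dense_in_real[of 0 "\<rho> / 8"] \<rho>(1) by auto
      obtain m where "max 16 (4 * b + 1) \<le> \<eta>\<^sup>2 * 2 ^ m"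
        by (rule exists_fine_level[OF \<eta>(2)])
      then have m: "16 \<le> \<eta>\<^sup>2 * 2 ^ m" "4 * b + 1 \<le> \<eta>\<^sup>2 * 2 ^ m" by auto
      have "\<forall>\<^sub>F n in sequentially. real (card {j \<in> {1..k n}. \<not> chained m \<eta> (x n j)}) \<le> real (k n) * exp (- b * real n)"
        using m b \<eta> by (intro chain) auto
      moreover have "\<forall>\<^sub>F n in sequentially. real (card {j \<in> {1..k n}. 2 * a < dyadic_energy m (x n j)}) \<le> real (k n) * exp (- b * real n)"
        using a b by (intro energy) auto
      moreover have "\<forall>\<^sub>F n in sequentially. 2 * exp (- b * real n) \<le> exp (- \<alpha> * real n)"
        using b by (intro eventually_mult_exp_le) simp
      ultimately have "\<forall>\<^sub>F n in sequentially. r n \<le> ereal (- \<alpha>)"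
        using eventually_ge_at_top[of 1]
      proof eventually_elim
        case (elim n)
        note n = \<open>1 \<le> n\<close>
        have kn: "real (k n) > 0" using k[OF n] by simp
        let ?T = "{j \<in> {1..k n}. 2 * a < dyadic_energy m (x n j)}"
        let ?U = "{j \<in> {1..k n}. \<not> chained m \<eta> (x n j)}"
        let ?V = "{j \<in> {1..k n}. x n j \<in> G}"
        have "?V \<subseteq> ?U \<union> ?T"
        proof -
          have "G \<subseteq> ?Y closure_of G" using G by (intro closure_of_subset) simp
          moreover have "8 * \<eta> < \<rho>" using \<eta>(3) by simp
          ultimately show ?thesis using \<rho>(2) by blast
        qed
        then have "card ?V \<le> card (?U \<union> ?T)" by (intro card_mono) auto
        also have "\<dots> \<le> card ?U + card ?T" by (rule card_Un_le)
        finally have "cnt n G \<le> real (card ?U) + real (card ?T)" unfolding cnt_def by linarith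
        also have "\<dots> \<le> real (k n) * (2 * exp (- b * real n))" using elim by (simp add: algebra_simps)
        also have "\<dots> \<le> real (k n) * exp (- \<alpha> * real n)" using kn elim by (intro mult_left_mono) auto
        finally have "cnt n G / real (k n) \<le> exp (- \<alpha> * real n)" using kn by (simp add: pos_divide_le_eq mult.commute)
        then show ?case unfolding r[OF n] using cnt(1)[OF n] by (intro elog_scaled_le[OF n])
      qed
      then show ?thesis by (rule Limsup_bounded)
    qed
    have "limsup r \<le> - (INF y\<in>?Y closure_of G. action y)"
    proof (rule ccontr)
      assume "\<not> ?thesis"
      then have "- (INF y\<in>?Y closure_of G. action y) < limsup r" by simp
      then obtain z where z: "- (INF y\<in>?Y closure_of G. action y) < ereal z" "ereal z < limsup r"
        using ereal_dense2 by blast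
      then have "ereal (- z) < (INF y\<in>?Y closure_of G. action y)" using iffD1[OF ereal_uminus_less_reorder z(1)] by (simp only: uminus_ereal.simps)
      from up[OF this] z(2) show False by simp
    qed
    then show "limsup (\<lambda>n. ereal (1 / real n) * elog (measure (completion (?\<mu> n)) G)) \<le> - (INF y\<in>?Y closure_of G. action y)"
      unfolding r_def .
  qed
  have prob: "prob_space (?\<mu> n) \<and> sets (?\<mu> n) = sets (borel_of ?Y)" if "n \<ge> 1" for n
    using k[OF that] x[OF that] by (intro conjI prob_space_empirical_measure) auto
  have sub: "G \<subseteq> mspace C0" if "\<forall>n\<ge>1. G \<in> sets (completion (?\<mu> n))" for G
  proof -
    have "G \<in> sets (completion (?\<mu> 1))" using that by blast
    then show ?thesis using sets.sets_into_space[of G "completion (?\<mu> 1)"] by simp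
  qed
  show ?thesis
    unfolding satisfies_LDP_def Let_def
    using prob good_rate_function_action main[OF sub] Liminf_le_Limsup[OF sequentially_bot]
    unfolding good_rate_function_def by blast
qed

theorem theorem3p2:
  fixes M :: "'w measure"
    and W :: "real \<Rightarrow> 'w \<Rightarrow> real ^ 'd"
    and k :: "nat \<Rightarrow> nat"
  assumes "prob_space M"
    and "std_brownian_motion M W"
    and "\<And>n. n \<ge> 1 \<Longrightarrow> k n \<ge> 1"
    and "filterlim (\<lambda>n. ln (real (k n)) / real n) at_top sequentially"
  shows "good_rate_function (mtopology_of C0) (action :: (real \<Rightarrow> real ^ 'd) \<Rightarrow> ereal) \<and>
    (AE \<omega> in M. satisfies_LDP (mtopology_of C0) (brownian_empirical W k \<omega>) action)"
proof
  show "good_rate_function (mtopology_of C0) (action :: (real \<Rightarrow> real ^ 'd) \<Rightarrow> ereal)"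
    by (rule good_rate_function_action)
  interpret brownian_motion M W
    using assms(1,2) by (simp add: brownian_motion_def brownian_motion_axioms_def)
  note k = assms(3)
  obtain D :: "(real \<Rightarrow> real ^ 'd) set" where D: "countable D" "D \<subseteq> mspace C0"
    and dense: "\<And>\<phi> a r. \<phi> \<in> mspace C0 \<Longrightarrow> a \<in> \<rat> \<Longrightarrow> action \<phi> \<le> ereal a \<Longrightarrow> r > 0 \<Longrightarrow>
       \<exists>\<psi>\<in>D. action \<psi> \<le> ereal a \<and> mdist C0 \<psi> \<phi> < r"
    by (rule countable_action_dense) blast
  let ?x = "\<lambda>\<omega> n j. sample_path W n (k n) j \<omega>"
  \<comment> \<open>The estimates hold almost surely for fixed parameters, hence simultaneously for all parameters in
    countable sets.\<close>
  have "AE \<omega> in M. \<forall>a\<in>\<rat>. \<forall>b\<in>\<rat>. \<forall>q. b < a \<longrightarrow> (\<forall>\<^sub>F n in sequentially.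
       real (card {j \<in> {1..k n}. 2 * a < dyadic_energy q (?x \<omega> n j)}) \<le> real (k n) * exp (- b * real n))"
    using AE_few_high_energy[OF k] by (simp add: AE_ball_countable[OF countable_rat] AE_all_countable)
  moreover have "AE \<omega> in M. \<forall>\<eta>\<in>\<rat>. \<forall>b\<in>\<rat>. \<forall>m. 0 \<le> \<eta> \<longrightarrow> 16 \<le> \<eta>\<^sup>2 * 2 ^ m \<longrightarrow> b < \<eta>\<^sup>2 * 2 ^ m / 4 \<longrightarrow> (\<forall>\<^sub>F n in sequentially.
       real (card {j \<in> {1..k n}. \<not> chained m \<eta> (?x \<omega> n j)}) \<le> real (k n) * exp (- b * real n))"
    using AE_few_not_chained[OF k] by (simp add: AE_ball_countable[OF countable_rat] AE_all_countable)
  moreover have "AE \<omega> in M. \<forall>\<psi>\<in>D. \<forall>\<delta>\<in>\<rat>. \<forall>q. 0 < \<delta> \<longrightarrow> (\<exists>c>0. \<forall>\<^sub>F n in sequentially.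
       real (k n) * (c * exp (- tube_rate q \<psi> \<delta> * real n)) \<le>
       real (card {j \<in> {1..k n}. \<forall>i<2 ^ q. norm (dyadic_incr q (?x \<omega> n j) i - dyadic_incr q \<psi> i) \<le> \<delta>}))"
  proof -
    have "AE \<omega> in M. 0 < \<delta> \<longrightarrow> (\<exists>c>0. \<forall>\<^sub>F n in sequentially.
       real (k n) * (c * exp (- tube_rate q \<psi> \<delta> * real n)) \<le>
       real (card {j \<in> {1..k n}. \<forall>i<2 ^ q. norm (dyadic_incr q (?x \<omega> n j) i - dyadic_incr q \<psi> i) \<le> \<delta>}))" for \<psi> \<delta> q
    proof (cases "0 < \<delta>")
      case True
      obtain c where "c > 0" "AE \<omega> in M. \<forall>\<^sub>F n in sequentially.
         real (k n) * (c * exp (- tube_rate q \<psi> \<delta> * real n)) \<le>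
         real (card {j \<in> {1..k n}. \<forall>i<2 ^ q. norm (dyadic_incr q (?x \<omega> n j) i - dyadic_incr q \<psi> i) \<le> \<delta>})"
        using AE_many_in_tube[OF k assms(4) True] by blast
      then show ?thesis by (elim eventually_mono) auto
    qed simp
    then show ?thesis by (simp add: AE_ball_countable[OF countable_rat] AE_ball_countable[OF D(1)] AE_all_countable)
  qed
  moreover have "AE \<omega> in M. continuous_on {0..1} (\<lambda>t. W t \<omega>)"
    using bm by (simp add: std_brownian_motion_def)
  ultimately show "AE \<omega> in M. satisfies_LDP (mtopology_of C0) (brownian_empirical W k \<omega>) action"
  proof eventually_elim
    case (elim \<omega>)
    have "satisfies_LDP (mtopology_of C0) (\<lambda>n. empirical_measure (borel_of (mtopology_of C0)) (k n) (?x \<omega> n)) action"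
    proof (rule satisfies_LDP_of_counts[OF k _ D(2) dense])
      show "?x \<omega> n j \<in> mspace C0" if "n \<ge> 1" "j \<in> {1..k n}" for n j
        using that k[OF that(1)] elim(4) by (intro sample_path_in_C0)
    qed (use elim in blast)+
    then show ?case by (simp add: brownian_empirical_def[abs_def])
  qed
qed

end
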